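(* Let $G$ be a hamiltonian graph of order $n$ satisfying $e(G)>\left\lfloor \frac{n^2}{4}\right\rfloor+1$. Then, for every integer $\ell$ with $3\le \ell\le n$, one has $c_\ell(G)\ge n-\ell+2$ whenever at least one of the following holds: (i) $\ell\in\{3,4,5\}$ or $\ell\ge 11$ (with no further restriction on $n$); (ii) $\ell=6$, and $n\le 10$ or $n\ge 39$; (iii) $\ell=7$, and $n\le 12$ or $n\ge 360$; (iv) $\ell=8$, and $n\le 14$ or $n\ge 97$; (v) $\ell=9$, and $n\le 16$ or $n\ge 440$; (vi) $\ell=10$, and $n\le 18$ or $n\ge 124$.
   Context: All graphs are finite and simple. The order of a graph is its number of vertices, and $e(G)$ denotes the number of edges of $G$. A graph is hamiltonian if it contains a Hamilton cycle, i.e. a cycle through every vertex. $c_\ell(G)$ denotes the number of cycles of length $\ell$ in $G$, where cycles are counted as subgraphs (not necessarily induced). *)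

theory Defs
  imports Main
begin

type_synonym 'a graph = "'a set \<times> 'a set set"

abbreviation verts :: "'a graph \<Rightarrow> 'a set" where
  "verts \<equiv> fst"

abbreviation edges :: "'a graph \<Rightarrow> 'a set set" where
  "edges \<equiv> snd"

definition simple_graph :: "'a graph \<Rightarrow> bool" where
  "simple_graph G \<longleftrightarrow>
     finite (verts G) \<and> (\<forall>e \<in> edges G. e \<subseteq> verts G \<and> card e = 2)"

definition subgraph :: "'a graph \<Rightarrow> 'a graph \<Rightarrow> bool" where
  "subgraph H G \<longleftrightarrow>
     simple_graph H \<and> verts H \<subseteq> verts G \<and> edges H \<subseteq> edges G"

definition cycle_of_list :: "'a list \<Rightarrow> 'a graph" where
  "cycle_of_list xs =
     (set xs, {{xs ! i, xs ! (Suc i mod length xs)} | i. i < length xs})"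

definition is_cycle :: "nat \<Rightarrow> 'a graph \<Rightarrow> bool" where
  "is_cycle l C \<longleftrightarrow>
     3 \<le> l \<and> (\<exists>xs. distinct xs \<and> length xs = l \<and> C = cycle_of_list xs)"

definition hamiltonian :: "'a graph \<Rightarrow> bool" where
  "hamiltonian G \<longleftrightarrow>
     (\<exists>C l. is_cycle l C \<and> subgraph C G \<and> verts C = verts G)"

text \<open>A cycle is counted as a subgraph, that is, as a pair of a vertex set and an edge set, so
  all the vertex lists that differ by a rotation or a reversal contribute a single cycle.\<close>

definition num_cycles :: "nat \<Rightarrow> 'a graph \<Rightarrow> nat" where
  "num_cycles l G = card {C. is_cycle l C \<and> subgraph C G}"

lemma finite_cycles:
  assumes "simple_graph G"
  shows "finite {C. is_cycle l C \<and> subgraph C G}"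
proof (rule finite_subset)
  show "{C. is_cycle l C \<and> subgraph C G} \<subseteq> Pow (verts G) \<times> Pow (edges G)"
    by (auto simp: subgraph_def)
  have "edges G \<subseteq> Pow (verts G)" "finite (verts G)"
    using assms by (auto simp: simple_graph_def)
  then show "finite (Pow (verts G) \<times> Pow (edges G))"
    by (auto intro: finite_subset)
qed

end

theory Submission
  imports Defs
begin

text \<open>Let \<open>q\<close> be the number of edges minus \<open>n\<^sup>2 div 4\<close>. For \<open>5 \<le> l\<close> the bound \<open>n - l + q\<close> on the number of
  \<open>l\<close>-cycles is proved for all \<open>q \<ge> 1\<close> by induction on \<open>n\<close> and \<open>q\<close>: deleting an edge that lies on an \<open>l\<close>-cycle
  but not on a fixed Hamilton cycle reduces it to \<open>q = 1\<close>; for \<open>l = n\<close> such an edge exists by Sheehan's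
  theorem on second Hamilton cycles. If \<open>q = 1\<close> and \<open>l < n\<close>, Ore's closing argument makes \<open>G - v\<close>
  hamiltonian for some \<open>v\<close>. If \<open>v\<close> has degree below \<open>n div 2\<close>, then \<open>G - v\<close> has a larger excess and the
  induction hypothesis suffices; at degree \<open>n div 2\<close> one further \<open>l\<close>-cycle through \<open>v\<close> is missing, and it
  is found by comparing the neighbourhood of \<open>v\<close> with its translates along a Hamilton cycle of \<open>G - v\<close>.
  If no vertex of degree at most \<open>n div 2\<close> can be removed, then a run of such vertices on the Hamilton
  cycle can. A short run is again handled by induction; a long one has small degree sums on its
  edges, which forces large degree sums on other edges of the Hamilton cycle, and every edge of that
  kind closes many \<open>l\<close>-cycles with two chords. Triangles and 4-cycles are counted by removing a vertex of
  minimum degree.\<close>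

section \<open>Cycles as vertex lists\<close>

text \<open>Deletions are governed by the identity
  \<open>n\<^sup>2 div 4 = (n - 1)\<^sup>2 div 4 + n div 2\<close>: removing a vertex of degree
  \<open>d\<close> changes the excess \<open>q\<close> by \<open>n div 2 - d\<close>. Starting from
  \<open>q = 1\<close>, the removal of a set of \<open>w\<close> vertices is paid for if the excess
  rises by \<open>w\<close>, and falls short by a single cycle if it rises by \<open>w - 1\<close>.
  This is why \<open>n div 2\<close> is the critical degree and why so much effort goes into one
  more \<open>l\<close>-cycle. The obstacle is that the rest has to remain hamiltonian, so that a
  vertex of small degree cannot always be removed alone. The degree-sum count has little slack:
  summed over the edges of a Hamilton cycle, the degree sums minus \<open>n\<close> amount to
  \<open>4 * e - n\<^sup>2\<close>, where \<open>e\<close> is the number of edges. This is at least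
  3, and each cycle is found at most twice. A long run of low vertices lifts the total to twice its
  length. Triangles are separate because the bound \<open>n - l + q\<close> fails for them at
  \<open>q = 1\<close>: a balanced complete bipartite graph with one added edge has only
  \<open>n div 2\<close> triangles. The arguments for triangles and 4-cycles use no Hamilton
  cycle.\<close>

definition adj :: "'a graph \<Rightarrow> 'a \<Rightarrow> 'a \<Rightarrow> bool" where
  "adj G x y \<longleftrightarrow> {x, y} \<in> edges G"

text \<open>A path with a closing edge instead of indices modulo the length, so that cycles can be
  assembled by concatenating and reversing segments.\<close>

definition cyc :: "'a graph \<Rightarrow> 'a list \<Rightarrow> bool" where
  "cyc G xs \<longleftrightarrow> 3 \<le> length xs \<and> distinct xs \<and> successively (adj G) xs \<and> adj G (last xs) (hd xs)"

definition gdel :: "'a graph \<Rightarrow> 'a set \<Rightarrow> 'a graph" where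
  "gdel G W = (verts G - W, {e \<in> edges G. e \<inter> W = {}})"

definition edel :: "'a graph \<Rightarrow> 'a set \<Rightarrow> 'a graph" where
  "edel G f = (verts G, edges G - {f})"

definition nbrs :: "'a graph \<Rightarrow> 'a \<Rightarrow> 'a set" where
  "nbrs G v = {u. adj G v u}"

definition deg :: "'a graph \<Rightarrow> 'a \<Rightarrow> nat" where
  "deg G v = card (nbrs G v)"

abbreviation cedges :: "'a list \<Rightarrow> 'a set set" where
  "cedges xs \<equiv> edges (cycle_of_list xs)"

lemma adj_sym: "adj G x y \<longleftrightarrow> adj G y x"
  by (simp add: adj_def insert_commute)

lemma adj_neq: "simple_graph G \<Longrightarrow> adj G x y \<Longrightarrow> x \<noteq> y"
  by (auto simp: simple_graph_def adj_def)

lemma adj_irrefl [simp]: "simple_graph G \<Longrightarrow> \<not> adj G x x"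
  using adj_neq by fastforce

lemma adj_verts: "simple_graph G \<Longrightarrow> adj G x y \<Longrightarrow> x \<in> verts G \<and> y \<in> verts G"
  by (auto simp: simple_graph_def adj_def)

lemma finite_verts: "simple_graph G \<Longrightarrow> finite (verts G)"
  by (simp add: simple_graph_def)

lemma finite_edges: "simple_graph G \<Longrightarrow> finite (edges G)"
  by (rule finite_subset[of _ "Pow (verts G)"]) (auto simp: simple_graph_def)

lemma edge_doubleton:
  assumes "simple_graph G" "e \<in> edges G"
  obtains x y where "e = {x, y}" "x \<noteq> y" "adj G x y"
proof -
  have "card e = 2" using assms by (auto simp: simple_graph_def)
  then obtain x y where "e = {x, y}" "x \<noteq> y" by (auto simp: card_2_iff)
  then show ?thesis using that assms(2) by (simp add: adj_def)
qed

lemma nbrs_subset: "simple_graph G \<Longrightarrow> nbrs G v \<subseteq> verts G - {v}"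
  by (auto simp: nbrs_def dest: adj_verts adj_neq)

lemma finite_nbrs [simp]: "simple_graph G \<Longrightarrow> finite (nbrs G v)"
  by (meson finite_Diff finite_subset finite_verts nbrs_subset)

lemma deg_less: "simple_graph G \<Longrightarrow> v \<in> verts G \<Longrightarrow> deg G v < card (verts G)"
  using card_mono[of "verts G - {v}" "nbrs G v"] nbrs_subset[of G v] card_Diff1_less[of "verts G" v]
  by (simp add: deg_def finite_verts)

lemma simple_gdel [simp]: "simple_graph G \<Longrightarrow> simple_graph (gdel G W)"
  by (auto simp: simple_graph_def gdel_def)

lemma simple_edel [simp]: "simple_graph G \<Longrightarrow> simple_graph (edel G f)"
  by (auto simp: simple_graph_def edel_def)

lemma verts_gdel [simp]: "verts (gdel G W) = verts G - W"
  by (simp add: gdel_def)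

lemma verts_edel [simp]: "verts (edel G f) = verts G"
  by (simp add: edel_def)

lemma edges_edel [simp]: "edges (edel G f) = edges G - {f}"
  by (simp add: edel_def)

lemma adj_gdel [simp]: "adj (gdel G W) x y \<longleftrightarrow> adj G x y \<and> x \<notin> W \<and> y \<notin> W"
  by (auto simp: adj_def gdel_def)

lemma gdel_gdel: "gdel (gdel G A) B = gdel G (A \<union> B)"
  by (auto simp: gdel_def)

lemma nbrs_gdel: "v \<notin> W \<Longrightarrow> nbrs (gdel G W) v = nbrs G v - W"
  by (auto simp: nbrs_def)

lemma deg_gdel_single:
  assumes "simple_graph G" "v \<noteq> u"
  shows "deg (gdel G {u}) v = deg G v - (if adj G v u then 1 else 0)"
  using assms finite_nbrs[OF assms(1), of v]
  by (simp add: deg_def nbrs_gdel card_Diff_singleton_if) (simp add: nbrs_def)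

lemma card_verts_gdel_single: "simple_graph G \<Longrightarrow> v \<in> verts G \<Longrightarrow> card (verts (gdel G {v})) = card (verts G) - 1"
  by (simp add: finite_verts)

lemma deg_eq_card_edges:
  assumes "simple_graph G" shows "deg G v = card {e \<in> edges G. v \<in> e}"
proof -
  have "{e \<in> edges G. v \<in> e} = (\<lambda>u. {v, u}) ` nbrs G v"
  proof (intro set_eqI iffI)
    fix e assume e: "e \<in> {e \<in> edges G. v \<in> e}"
    then obtain x y where "e = {x, y}" "x \<noteq> y" "adj G x y"
      using assms edge_doubleton by blast
    then show "e \<in> (\<lambda>u. {v, u}) ` nbrs G v"
      using e adj_sym[of G x y] by (auto simp: nbrs_def)
  qed (auto simp: nbrs_def adj_def)
  moreover have "inj_on (\<lambda>u. {v, u}) (nbrs G v)"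
    by (auto simp: inj_on_def doubleton_eq_iff)
  ultimately show ?thesis by (simp add: card_image deg_def)
qed

lemma card_edges_gdel:
  assumes "simple_graph G"
  shows "card (edges (gdel G {v})) + deg G v = card (edges G)"
proof -
  let ?A = "{e \<in> edges G. v \<in> e}"
  have fin: "finite (edges G)" using assms by (rule finite_edges)
  have "edges (gdel G {v}) = edges G - ?A" by (auto simp: gdel_def)
  moreover have "card ?A \<le> card (edges G)" using fin by (intro card_mono) auto
  ultimately show ?thesis
    using fin by (simp add: card_Diff_subset deg_eq_card_edges[OF assms])
qed

lemma card_edges_edel: "simple_graph G \<Longrightarrow> f \<in> edges G \<Longrightarrow> card (edges (edel G f)) + 1 = card (edges G)"
  using finite_edges[of G] card_Suc_Diff1[of "edges G" f] by simp

lemma cedges_eq: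
  assumes "xs \<noteq> []"
  shows "cedges xs = {{xs ! i, xs ! Suc i} | i. Suc i < length xs} \<union> {{last xs, hd xs}}"
proof -
  have *: "{{xs ! i, xs ! (Suc i mod length xs)} | i. i < length xs}
     = {{xs ! i, xs ! Suc i} | i. Suc i < length xs} \<union> {{last xs, hd xs}}"
  proof (intro set_eqI iffI)
    fix e assume "e \<in> {{xs ! i, xs ! (Suc i mod length xs)} | i. i < length xs}"
    then obtain i where i: "i < length xs" "e = {xs ! i, xs ! (Suc i mod length xs)}" by auto
    show "e \<in> {{xs ! i, xs ! Suc i} | i. Suc i < length xs} \<union> {{last xs, hd xs}}"
    proof (cases "Suc i < length xs")
      case True then show ?thesis using i by auto
    next
      case False
      then have "Suc i = length xs" using i by simp
      then have "i = length xs - 1" by simp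
      then have "xs ! i = last xs" "xs ! (Suc i mod length xs) = hd xs"
        using assms \<open>Suc i = length xs\<close> by (simp_all add: last_conv_nth hd_conv_nth)
      then show ?thesis using i by simp
    qed
  next
    fix e assume e: "e \<in> {{xs ! i, xs ! Suc i} | i. Suc i < length xs} \<union> {{last xs, hd xs}}"
    then show "e \<in> {{xs ! i, xs ! (Suc i mod length xs)} | i. i < length xs}"
    proof
      assume "e \<in> {{xs ! i, xs ! Suc i} | i. Suc i < length xs}"
      then obtain i where "Suc i < length xs" "e = {xs ! i, xs ! Suc i}" by auto
      then show ?thesis by (auto intro!: exI[of _ i])
    next
      assume "e \<in> {{last xs, hd xs}}"
      then have "e = {xs ! (length xs - 1), xs ! (Suc (length xs - 1) mod length xs)}"
        using assms by (simp add: last_conv_nth hd_conv_nth)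
      moreover have "length xs - 1 < length xs" using assms by simp
      ultimately show ?thesis by blast
    qed
  qed
  show ?thesis unfolding cycle_of_list_def by (simp only: snd_conv *)
qed

lemma all_nat_split: "(\<forall>i. Q i) \<longleftrightarrow> Q 0 \<and> (\<forall>i. Q (Suc i))"
  by (metis not0_implies_Suc)

lemma successively_nth: "successively P xs \<longleftrightarrow> (\<forall>i. Suc i < length xs \<longrightarrow> P (xs ! i) (xs ! Suc i))"
proof (induction P xs rule: successively.induct)
  case (3 P x y xs)
  have "(\<forall>i. Suc i < length (x # y # xs) \<longrightarrow> P ((x # y # xs) ! i) ((x # y # xs) ! Suc i)) \<longleftrightarrow>
      P x y \<and> (\<forall>i. Suc i < length (y # xs) \<longrightarrow> P ((y # xs) ! i) ((y # xs) ! Suc i))"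
    by (subst all_nat_split) simp
  then show ?case using 3 by simp
qed auto

lemma cyc_iff_cedges:
  "cyc G xs \<longleftrightarrow> 3 \<le> length xs \<and> distinct xs \<and> cedges xs \<subseteq> edges G"
proof (cases "xs = []")
  case False
  show ?thesis unfolding cyc_def successively_nth cedges_eq[OF False] adj_def by auto
qed (auto simp: cyc_def)

lemma cyc_set: "simple_graph G \<Longrightarrow> cyc G xs \<Longrightarrow> set xs \<subseteq> verts G"
proof
  fix x assume G: "simple_graph G" "cyc G xs" "x \<in> set xs"
  then obtain i where i: "i < length xs" "x = xs ! i" by (metis in_set_conv_nth)
  have "{xs ! i, xs ! (Suc i mod length xs)} \<in> cedges xs" using i by (auto simp: cycle_of_list_def)
  then have "{xs ! i, xs ! (Suc i mod length xs)} \<subseteq> verts G"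
    using G(1,2) unfolding cyc_iff_cedges simple_graph_def by blast
  then show "x \<in> verts G" using i by simp
qed

lemma simple_cycle:
  assumes "3 \<le> length xs" "distinct xs" shows "simple_graph (cycle_of_list xs)"
proof -
  have "card {xs ! i, xs ! (Suc i mod length xs)} = 2" if "i < length xs" for i
  proof -
    have "Suc i mod length xs \<noteq> i" using that assms(1)
      by (cases "Suc i = length xs") auto
    moreover have "Suc i mod length xs < length xs" using assms(1) by (intro mod_less_divisor) linarith
    ultimately show ?thesis using that assms(2) by (simp add: nth_eq_iff_index_eq)
  qed
  moreover have "Suc i mod length xs < length xs" for i
    using assms(1) by (intro mod_less_divisor) linarith
  ultimately show ?thesis unfolding simple_graph_def cycle_of_list_def by auto
qed

text \<open>Bridge from counted subgraphs to lists: edges inside \<open>G\<close> force the vertices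
  of a cycle into \<open>G\<close>, so that only the edge condition of \<open>cyc\<close>
  remains.\<close>

lemma cycles_eq:
  assumes "simple_graph G" "3 \<le> l"
  shows "{C. is_cycle l C \<and> subgraph C G} = cycle_of_list ` {xs. cyc G xs \<and> length xs = l}"
proof (intro set_eqI iffI)
  fix C assume "C \<in> {C. is_cycle l C \<and> subgraph C G}"
  then obtain xs where "distinct xs" "length xs = l" "C = cycle_of_list xs" "edges C \<subseteq> edges G"
    by (auto simp: is_cycle_def subgraph_def)
  then show "C \<in> cycle_of_list ` {xs. cyc G xs \<and> length xs = l}"
    using assms by (auto simp: cyc_iff_cedges)
next
  fix C assume "C \<in> cycle_of_list ` {xs. cyc G xs \<and> length xs = l}"
  then obtain xs where xs: "cyc G xs" "length xs = l" "C = cycle_of_list xs" by auto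
  then have "verts C \<subseteq> verts G" using cyc_set[OF assms(1)] by (auto simp: cycle_of_list_def)
  then show "C \<in> {C. is_cycle l C \<and> subgraph C G}"
    using xs assms simple_cycle[of xs] by (auto simp: cyc_iff_cedges is_cycle_def subgraph_def)
qed

lemma num_cycles_eq:
  "simple_graph G \<Longrightarrow> 3 \<le> l \<Longrightarrow> num_cycles l G = card (cycle_of_list ` {xs. cyc G xs \<and> length xs = l})"
  by (simp add: num_cycles_def cycles_eq)

lemma finite_cyc: "simple_graph G \<Longrightarrow> finite {xs. cyc G xs \<and> length xs = l}"
  using cyc_set[of G] finite_lists_length_eq[OF finite_verts, of G l]
  by (rule_tac finite_subset) auto

lemma num_cycles_ge:
  assumes "simple_graph G" "3 \<le> l" "\<And>xs. xs \<in> L \<Longrightarrow> cyc G xs \<and> length xs = l"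
  shows "card (cycle_of_list ` L) \<le> num_cycles l G"
  unfolding num_cycles_eq[OF assms(1,2)]
  by (intro card_mono finite_imageI finite_cyc assms(1) image_mono) (use assms(3) in auto)

lemma num_cycles_pos:
  assumes "simple_graph G" "cyc G xs" shows "num_cycles (length xs) G \<ge> 1"
proof -
  have "3 \<le> length xs" using assms(2) by (simp add: cyc_def)
  then have "card (cycle_of_list ` {xs}) \<le> num_cycles (length xs) G"
    by (intro num_cycles_ge[OF assms(1)]) (use assms(2) in auto)
  then show ?thesis by simp
qed

lemma num_cycles_two:
  assumes "simple_graph G" "cyc G xs" "cyc G ys" "length xs = l" "length ys = l" "cycle_of_list xs \<noteq> cycle_of_list ys"
  shows "num_cycles l G \<ge> 2"
proof -
  have "3 \<le> l" using assms(2,4) by (simp add: cyc_def)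
  have "card (cycle_of_list ` {xs, ys}) \<le> num_cycles l G"
    by (rule num_cycles_ge[OF assms(1) \<open>3 \<le> l\<close>]) (use assms(2-5) in blast)
  then show ?thesis using assms(6) by simp
qed

text \<open>No list counted in \<open>G'\<close> yields the cycle of \<open>xs\<close>, because its
  edge set does not fit into \<open>G'\<close>. This serves vertex and edge deletions alike.\<close>

lemma num_cycles_mono_Suc:
  assumes G: "simple_graph G" "simple_graph G'" and E: "edges G' \<subseteq> edges G"
    and xs: "cyc G xs" "\<not> cyc G' xs"
  shows "num_cycles (length xs) G' + 1 \<le> num_cycles (length xs) G"
proof -
  let ?l = "length xs"
  have l: "3 \<le> ?l" using xs by (simp add: cyc_def)
  let ?A = "cycle_of_list ` {xs. cyc G' xs \<and> length xs = ?l}"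
  have "cycle_of_list xs \<notin> ?A"
    using xs by (auto simp: cyc_iff_cedges)
  moreover have "insert (cycle_of_list xs) ?A \<subseteq> cycle_of_list ` {xs. cyc G xs \<and> length xs = ?l}"
    using E xs(1) by (auto simp: cyc_iff_cedges)
  ultimately have "card (insert (cycle_of_list xs) ?A) \<le> num_cycles ?l G"
    unfolding num_cycles_eq[OF G(1) l] by (intro card_mono finite_imageI finite_cyc G)
  then show ?thesis using \<open>cycle_of_list xs \<notin> ?A\<close> finite_cyc[OF G(2), of ?l]
    by (simp add: num_cycles_eq[OF G(2) l])
qed

lemma num_cycles_mono:
  assumes "simple_graph G" "simple_graph G'" "edges G' \<subseteq> edges G" "3 \<le> l"
  shows "num_cycles l G' \<le> num_cycles l G"
  unfolding num_cycles_eq[OF assms(1,4)] num_cycles_eq[OF assms(2,4)]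
  by (intro card_mono finite_imageI finite_cyc assms(1) image_mono)
    (use assms(3) in \<open>auto simp: cyc_iff_cedges\<close>)

lemma edges_gdel_subset: "edges (gdel G W) \<subseteq> edges G"
  by (auto simp: gdel_def)

lemma num_cycles_gdel_le: "simple_graph G \<Longrightarrow> 3 \<le> l \<Longrightarrow> num_cycles l (gdel G W) \<le> num_cycles l G"
  by (rule num_cycles_mono) (simp_all add: edges_gdel_subset)

lemma num_cycles_gdel:
  assumes "simple_graph G" "cyc G xs" "length xs = l" "set xs \<inter> W \<noteq> {}"
  shows "num_cycles l (gdel G W) + 1 \<le> num_cycles l G"
proof -
  have "\<not> cyc (gdel G W) xs"
    using cyc_set[of "gdel G W" xs] assms by auto
  then show ?thesis using num_cycles_mono_Suc[of G "gdel G W" xs] assms by (simp add: edges_gdel_subset)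
qed

lemma num_cycles_edel:
  assumes "simple_graph G" "cyc G xs" "length xs = l" "f \<in> cedges xs"
  shows "num_cycles l (edel G f) + 1 \<le> num_cycles l G"
  using num_cycles_mono_Suc[of G "edel G f" xs] assms by (simp add: cyc_iff_cedges) blast

lemma num_cycles_obtain:
  assumes "simple_graph G" "3 \<le> l" "num_cycles l G \<ge> 1"
  obtains xs where "cyc G xs" "length xs = l"
proof -
  have "cycle_of_list ` {xs. cyc G xs \<and> length xs = l} \<noteq> {}"
    using assms(3) unfolding num_cycles_eq[OF assms(1,2)] by (metis card.empty not_one_le_zero)
  then show ?thesis using that by blast
qed

text \<open>Cyclic vertex orders are extended periodically to all integers, so that shifts and intervals of
  indices need no reduction modulo the length.\<close>

definition ring :: "'a graph \<Rightarrow> nat \<Rightarrow> (int \<Rightarrow> 'a) \<Rightarrow> bool" where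
  "ring G M c \<longleftrightarrow> 3 \<le> M \<and> (\<forall>i. c (i + int M) = c i) \<and> inj_on c {0..<int M} \<and> (\<forall>i. adj G (c i) (c (i + 1)))"

definition seg :: "(int \<Rightarrow> 'a) \<Rightarrow> int \<Rightarrow> int \<Rightarrow> 'a list" where
  "seg c i j = map c [i..j]"

text \<open>The codomain is arbitrary, so periodic Boolean predicates are covered along with
  periodic vertex sequences.\<close>

lemma ring_period_mult:
  assumes "\<forall>i::int. c (i + m) = c i" shows "c (i + k * m) = c i"
proof (induction k rule: int_induct[of _ 0])
  case (step1 k) then show ?case using assms[rule_format, of "i + k * m"] by (simp add: algebra_simps)
next
  case (step2 k) then show ?case using assms[rule_format, of "i + (k - 1) * m"] by (simp add: algebra_simps)
qed simp

lemma ring_mod: "ring G M c \<Longrightarrow> c (i mod int M) = c i"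
  using ring_period_mult[of c "int M" "i mod int M" "i div int M"] by (simp add: ring_def)

lemma ring_eq_iff:
  assumes "ring G M c" shows "c i = c j \<longleftrightarrow> i mod int M = j mod int M"
proof -
  have M: "int M > 0" using assms by (simp add: ring_def)
  have "c (i mod int M) = c (j mod int M) \<longleftrightarrow> i mod int M = j mod int M"
    using assms M by (intro inj_on_eq_iff) (auto simp: ring_def)
  then show ?thesis by (simp add: ring_mod[OF assms])
qed

lemma ring_inj:
  assumes "ring G M c" "s + int M \<ge> t" shows "inj_on c {s..<t}"
proof (rule inj_onI)
  fix i j assume ij: "i \<in> {s..<t}" "j \<in> {s..<t}" "c i = c j"
  then have "int M dvd i - j" by (simp add: ring_eq_iff[OF assms(1)] mod_eq_dvd_iff)
  moreover have "\<bar>i - j\<bar> < int M" using ij assms(2) by auto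
  ultimately show "i = j" using dvd_imp_le_int[of "i - j" "int M"] by (cases "i = j") auto
qed

lemma ring_neq: "ring G M c \<Longrightarrow> i < j \<Longrightarrow> j < i + int M \<Longrightarrow> c i \<noteq> c j"
  using ring_inj[of G M c "i + int M" i] by (fastforce dest: inj_onD)

lemma ring_adj: "ring G M c \<Longrightarrow> adj G (c i) (c (i + 1))"
  by (simp add: ring_def)

lemma ring_adj': "ring G M c \<Longrightarrow> adj G (c i) (c (i - 1))"
  using ring_adj[of G M c "i - 1"] by (simp add: adj_sym)

lemma ring_period: "ring G M c \<Longrightarrow> c (i + int M) = c i" "ring G M c \<Longrightarrow> c (i - int M) = c i"
  unfolding ring_def by (auto, metis diff_add_cancel)

lemma ring_M: "ring G M c \<Longrightarrow> 3 \<le> M" by (simp add: ring_def)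

lemma ring_range:
  assumes "ring G M c" shows "c ` {s..<s + int M} = range c"
proof
  show "range c \<subseteq> c ` {s..<s + int M}"
  proof
    fix x assume "x \<in> range c"
    then obtain i where x: "x = c i" by auto
    let ?j = "s + (i - s) mod int M"
    have M: "int M > 0" using assms by (simp add: ring_def)
    have "?j mod int M = i mod int M" by (simp add: mod_simps)
    then have "c ?j = c i" using ring_eq_iff[OF assms] by blast
    moreover have "?j \<in> {s..<s + int M}" using M by simp
    ultimately show "x \<in> c ` {s..<s + int M}" using x by (metis image_eqI)
  qed
qed auto

lemma ring_card_range: "ring G M c \<Longrightarrow> card (range c) = M"
  using ring_range[of G M c 0] ring_inj[of G M c "int M" 0] card_image[of c "{0..<int M}"] by simp

lemma ring_shift: assumes "ring G M c" shows "ring G M (\<lambda>i. c (i + s))"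
proof -
  have "inj_on (\<lambda>i. c (i + s)) {0..<int M}"
    using ring_inj[OF assms, of "s + int M" s] by (fastforce simp: inj_on_def)
  moreover have "adj G (c (i + s)) (c (i + 1 + s))" for i
    using ring_adj[OF assms, of "i + s"] by (simp add: algebra_simps)
  moreover have "c (i + int M + s) = c (i + s)" for i
    using ring_period(1)[OF assms, of "i + s"] by (simp add: algebra_simps)
  ultimately show ?thesis using assms by (simp add: ring_def)
qed

lemma ring_reflect: assumes "ring G M c" shows "ring G M (\<lambda>i. c (s - i))"
proof -
  have "inj_on (\<lambda>i. c (s - i)) {0..<int M}"
  proof (rule inj_onI)
    fix i j assume "i \<in> {0..<int M}" "j \<in> {0..<int M}" "c (s - i) = c (s - j)"
    then have "s - i = s - j"
      by (intro inj_onD[OF ring_inj[OF assms, of "s + 1" "s - int M + 1"]]) auto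
    then show "i = j" by simp
  qed
  moreover have "adj G (c (s - i)) (c (s - (i + 1)))" for i
    using ring_adj'[OF assms, of "s - i"] by (simp add: algebra_simps)
  moreover have "c (s - (i + int M)) = c (s - i)" for i
    using ring_period(2)[OF assms, of "s - i"] by (simp add: algebra_simps)
  ultimately show ?thesis using assms by (simp add: ring_def)
qed

lemma range_shift: "range (\<lambda>i::int. c (i + s)) = range c"
  by (auto simp: image_def) (metis diff_add_cancel)

lemma range_reflect: "range (\<lambda>i::int. c (s - i)) = range c"
  by (auto simp: image_def) (metis diff_diff_eq2 add_diff_cancel_left')

lemma set_seg [simp]: "set (seg c i j) = c ` {i..j}" by (simp add: seg_def)

lemma length_seg [simp]: "length (seg c i j) = nat (j - i + 1)" by (simp add: seg_def)

lemma seg_eq_Nil [simp]: "seg c i j = [] \<longleftrightarrow> j < i" by (simp add: seg_def)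

lemma hd_seg [simp]: "i \<le> j \<Longrightarrow> hd (seg c i j) = c i" by (simp add: seg_def upto.simps)

lemma last_seg [simp]: "i \<le> j \<Longrightarrow> last (seg c i j) = c j"
  by (simp add: seg_def upto_rec2)

lemma nth_seg: "k < nat (j - i + 1) \<Longrightarrow> seg c i j ! k = c (i + int k)"
  by (simp add: seg_def)

lemma seg_Cons: "i \<le> j \<Longrightarrow> seg c i j = c i # seg c (i + 1) j" by (simp add: seg_def upto.simps)

lemma distinct_seg: "ring G M c \<Longrightarrow> j < i + int M \<Longrightarrow> distinct (seg c i j)"
  using ring_inj[of G M c "j + 1" i] by (simp add: seg_def distinct_map atLeastLessThanPlusOne_atLeastAtMost_int)

lemma successively_seg: "ring G M c \<Longrightarrow> successively (adj G) (seg c i j)"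
  by (auto simp: successively_nth nth_seg ring_adj add.assoc[symmetric])
     (metis add.commute add.left_commute ring_adj)

lemma successively_adj_commute [simp]: "successively (\<lambda>x y. adj G y x) xs \<longleftrightarrow> successively (adj G) xs"
proof -
  have "(\<lambda>x y. adj G y x) = adj G" by (auto simp: adj_sym fun_eq_iff)
  then show ?thesis by (rule arg_cong)
qed

lemma hd_rev_seg [simp]: "i \<le> j \<Longrightarrow> hd (rev (seg c i j)) = c j" by (simp add: hd_rev)

lemma last_rev_seg [simp]: "i \<le> j \<Longrightarrow> last (rev (seg c i j)) = c i" by (simp add: last_rev)

lemma seg_disjoint:
  assumes "ring G M c" "j < s" "t < i + int M" "i \<le> s" "j \<le> t"
  shows "c ` {i..j} \<inter> c ` {s..t} = {}"
proof -
  have "inj_on c {i..<i + int M}" by (rule ring_inj[OF assms(1)]) simp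
  moreover have "{i..j} \<union> {s..t} \<subseteq> {i..<i + int M}" using assms by auto
  moreover have "{i..j} \<inter> {s..t} = {}" using assms by auto
  ultimately show ?thesis by (metis Un_subset_iff image_empty inj_on_image_Int)
qed

lemma cyc_of_ring:
  assumes "ring G M c" shows "cyc G (seg c s (s + int M - 1))" "length (seg c s (s + int M - 1)) = M"
proof -
  have M: "3 \<le> M" using assms by (rule ring_M)
  have "c (s + int M) = c s" by (rule ring_period[OF assms])
  then have "adj G (c (s + int M - 1)) (c s)"
    using ring_adj[OF assms, of "s + int M - 1"] by simp
  then show "cyc G (seg c s (s + int M - 1))"
    unfolding cyc_def using M distinct_seg[OF assms] successively_seg[OF assms] by auto
  show "length (seg c s (s + int M - 1)) = M" by simp
qed

lemma ring_of_cyc: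
  assumes "cyc G xs"
  obtains c where "ring G (length xs) c" "range c = set xs"
proof -
  let ?M = "length xs"
  define c where "c = (\<lambda>i::int. xs ! nat (i mod int ?M))"
  have M: "3 \<le> ?M" using assms by (simp add: cyc_def)
  then have M0: "int ?M > 0" by linarith
  have lt: "nat (i mod int ?M) < ?M" for i using M0 by (simp add: nat_less_iff)
  have inj: "inj_on c {0..<int ?M}"
    using assms by (auto simp: inj_on_def c_def cyc_def nth_eq_iff_index_eq)
  have "adj G (c i) (c (i + 1))" for i
  proof -
    let ?j = "nat (i mod int ?M)"
    have "nat ((i + 1) mod int ?M) = Suc ?j mod ?M"
    proof -
      have "int (Suc ?j mod ?M) = (i mod int ?M + 1) mod int ?M"
        using M0 by (simp add: zmod_int add.commute)
      also have "\<dots> = (i + 1) mod int ?M" by (simp add: mod_simps)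
      finally show ?thesis by linarith
    qed
    moreover have "{xs ! ?j, xs ! (Suc ?j mod ?M)} \<in> cedges xs"
      using lt by (auto simp: cycle_of_list_def)
    ultimately show ?thesis using assms by (auto simp: c_def adj_def cyc_iff_cedges)
  qed
  then have r: "ring G ?M c" using M inj by (simp add: ring_def c_def)
  have "range c = set xs"
  proof
    show "range c \<subseteq> set xs" using lt by (auto simp: c_def)
    show "set xs \<subseteq> range c"
    proof
      fix x assume "x \<in> set xs"
      then obtain k where "k < ?M" "x = xs ! k" by (metis in_set_conv_nth)
      then have "c (int k) = x" by (simp add: c_def)
      then show "x \<in> range c" by blast
    qed
  qed
  then show ?thesis using that r by blast
qed

lemma ring_edge_indices:
  assumes G: "simple_graph G" and r: "ring G M c" and e: "e \<in> edges G" "e \<subseteq> range c"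
  obtains s t where "e = {c s, c t}" "adj G (c s) (c t)" "0 \<le> s" "s < t" "t < int M"
proof -
  obtain u v where uv: "e = {u, v}" "u \<noteq> v" "adj G u v" using G e by (auto elim: edge_doubleton)
  have "u \<in> c ` {0..<0 + int M}" "v \<in> c ` {0..<0 + int M}" using uv(1) e(2) ring_range[OF r, of 0] by auto
  then obtain s t where st: "u = c s" "v = c t" "0 \<le> s" "s < int M" "0 \<le> t" "t < int M" by auto
  then have "s \<noteq> t" using uv(2) by auto
  then show ?thesis
  proof (cases "s < t")
    case True
    then show ?thesis using that[of s t] uv st by simp
  next
    case False
    then show ?thesis using that[of t s] uv st \<open>s \<noteq> t\<close> adj_sym[of G u] by (simp add: insert_commute)
  qed
qed

definition hamc :: "'a graph \<Rightarrow> (int \<Rightarrow> 'a) \<Rightarrow> bool" where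
  "hamc G c \<longleftrightarrow> ring G (card (verts G)) c \<and> range c = verts G"

lemma hamiltonian_iff:
  assumes "simple_graph G" shows "hamiltonian G \<longleftrightarrow> (\<exists>c. hamc G c)"
proof
  assume "hamiltonian G"
  then obtain xs where xs: "distinct xs" "3 \<le> length xs" "edges (cycle_of_list xs) \<subseteq> edges G"
      "verts (cycle_of_list xs) = verts G"
    unfolding hamiltonian_def is_cycle_def subgraph_def by blast
  then have "cyc G xs" "set xs = verts G" by (auto simp: cyc_iff_cedges cycle_of_list_def)
  then obtain c where "ring G (length xs) c" "range c = verts G" by (metis ring_of_cyc)
  then show "\<exists>c. hamc G c" unfolding hamc_def
    by (metis ring_card_range)
next
  assume "\<exists>c. hamc G c"
  then obtain c where c: "ring G (card (verts G)) c" "range c = verts G" by (auto simp: hamc_def)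
  let ?xs = "seg c 0 (0 + int (card (verts G)) - 1)"
  have "set ?xs = verts G" using ring_range[OF c(1), of 0] c(2)
    by (simp add: atLeastLessThanPlusOne_atLeastAtMost_int[symmetric])
  then have "verts (cycle_of_list ?xs) = verts G" by (simp add: cycle_of_list_def)
  moreover have "cycle_of_list ?xs \<in> {C. is_cycle (card (verts G)) C \<and> subgraph C G}"
    unfolding cycles_eq[OF assms ring_M[OF c(1)]] using cyc_of_ring[OF c(1), of 0] by auto
  ultimately show "hamiltonian G" unfolding hamiltonian_def by blast
qed

lemma hamiltonian_of_cyc: "simple_graph G \<Longrightarrow> cyc G xs \<Longrightarrow> set xs = verts G \<Longrightarrow> hamiltonian G"
  unfolding hamiltonian_iff hamc_def by (metis ring_of_cyc ring_card_range)

section \<open>Cycles through vertices outside a given cycle\<close>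

definition cnt :: "nat \<Rightarrow> (int \<Rightarrow> bool) \<Rightarrow> nat" where
  "cnt M P = card {i \<in> {0..<int M}. P i}"

lemma periodic_mod:
  assumes "\<And>i::int. P (i + int M) = P i" shows "P (i mod int M) = P i"
  using ring_period_mult[of P "int M" "i mod int M" "i div int M"] assms by simp

text \<open>Shifting and then reducing modulo \<open>M\<close> permutes one period.\<close>

lemma cnt_shift:
  assumes "\<And>i. P (i + int M) = P i"
  shows "cnt M (\<lambda>i. P (i + s)) = cnt M P"
proof (cases "M = 0")
  case False
  then have M: "int M > 0" by simp
  have "bij_betw (\<lambda>i. (i + s) mod int M) {i \<in> {0..<int M}. P (i + s)} {i \<in> {0..<int M}. P i}"
  proof (rule bij_betw_byWitness[where f' = "\<lambda>i. (i - s) mod int M"])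
    show "(\<lambda>i. (i - s) mod int M) ` {i \<in> {0..<int M}. P i} \<subseteq> {i \<in> {0..<int M}. P (i + s)}"
    proof
      fix j assume "j \<in> (\<lambda>i. (i - s) mod int M) ` {i \<in> {0..<int M}. P i}"
      then obtain i where i: "P i" "j = (i - s) mod int M" by auto
      have "P ((j + s) mod int M) = P (i mod int M)" using i by (simp add: mod_simps)
      then show "j \<in> {i \<in> {0..<int M}. P (i + s)}"
        using i M periodic_mod[of P M, OF assms] by simp
    qed
  qed (use M periodic_mod[of P M, OF assms] in \<open>auto simp: mod_simps\<close>)
  then show ?thesis unfolding cnt_def by (rule bij_betw_same_card)
qed (simp add: cnt_def)

lemma finite_cnt [simp]: "finite {i. 0 \<le> i \<and> i < int M \<and> P i}"
  by (rule finite_subset[of _ "{0..<int M}"]) auto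

lemma cnt_disj: "cnt M P + cnt M Q = cnt M (\<lambda>i. P i \<and> Q i) + cnt M (\<lambda>i. P i \<or> Q i)"
proof -
  have "{i \<in> {0..<int M}. P i \<or> Q i} = {i \<in> {0..<int M}. P i} \<union> {i \<in> {0..<int M}. Q i}"
    "{i \<in> {0..<int M}. P i \<and> Q i} = {i \<in> {0..<int M}. P i} \<inter> {i \<in> {0..<int M}. Q i}"
    by auto
  then show ?thesis unfolding cnt_def by (simp only:) (rule card_Un_Int[THEN trans], auto)
qed

lemma cnt_True [simp]: "cnt M (\<lambda>i. True) = M"
proof -
  have "{i \<in> {0..<int M}. True} = {0..<int M}" by auto
  then show ?thesis by (simp only: cnt_def card_atLeastLessThan_int)
qed

lemma cnt_False [simp]: "cnt M (\<lambda>i. False) = 0"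
  by (simp add: cnt_def)

lemma cnt_not: "cnt M P + cnt M (\<lambda>i. \<not> P i) = M"
  using cnt_disj[of M P "\<lambda>i. \<not> P i"] by simp

lemma cnt_mono: "(\<And>i. P i \<Longrightarrow> Q i) \<Longrightarrow> cnt M P \<le> cnt M Q"
  unfolding cnt_def by (intro card_mono) auto

lemma cnt_ge_two:
  assumes "\<And>i. P (i + int M) = P i" "P i" "P j" "i mod int M \<noteq> j mod int M" "M > 0"
  shows "cnt M P \<ge> 2"
proof -
  have "card {i mod int M, j mod int M} \<le> cnt M P"
    unfolding cnt_def using assms(2,3,5) periodic_mod[of P M, OF assms(1)] by (intro card_mono) auto
  then show ?thesis using assms(4) by simp
qed

lemma cnt_ge_one:
  assumes "\<And>i. P (i + int M) = P i" "P i" "M > 0"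
  shows "cnt M P \<ge> 1"
proof -
  have "card {i mod int M} \<le> cnt M P"
    unfolding cnt_def using assms(2,3) periodic_mod[of P M, OF assms(1)] by (intro card_mono) auto
  then show ?thesis by simp
qed

lemma cnt_ring:
  assumes "ring G M c"
  shows "card {x \<in> range c. Q x} = cnt M (\<lambda>i. Q (c i))"
proof -
  have "{x \<in> range c. Q x} = c ` {i \<in> {0..<int M}. Q (c i)}"
  proof (intro set_eqI iffI)
    fix x assume x: "x \<in> {x \<in> range c. Q x}"
    then obtain i where i: "x = c i" by auto
    have "int M > 0" using ring_M[OF assms] by linarith
    then have "i mod int M \<in> {i \<in> {0..<int M}. Q (c i)}"
      using x i by (simp add: ring_mod[OF assms])
    moreover have "x = c (i mod int M)" using i by (simp add: ring_mod[OF assms])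
    ultimately show "x \<in> c ` {i \<in> {0..<int M}. Q (c i)}" by (rule rev_image_eqI)
  qed auto
  moreover have "inj_on c {i \<in> {0..<int M}. Q (c i)}"
    using ring_inj[OF assms, of "int M" 0] by (auto simp: inj_on_def)
  ultimately show ?thesis by (simp add: card_image cnt_def)
qed

section \<open>Assembling cycles from segments of a ring\<close>

lemma cyc_append:
  assumes "successively (adj G) xs" "successively (adj G) ys" "distinct xs" "distinct ys"
    "set xs \<inter> set ys = {}" "xs \<noteq> []" "ys \<noteq> []" "adj G (last xs) (hd ys)" "adj G (last ys) (hd xs)"
    "3 \<le> length xs + length ys"
  shows "cyc G (xs @ ys)"
  using assms by (auto simp: cyc_def successively_append_iff)

lemma cyc_Cons:
  assumes "successively (adj G) xs" "distinct xs" "v \<notin> set xs" "adj G v (hd xs)" "adj G v (last xs)" "2 \<le> length xs"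
  shows "cyc G (v # xs)"
  using cyc_append[of G "[v]" xs] assms adj_sym[of G v] by force

lemma cyc_outside:
  assumes r: "ring G M c" and v: "v \<notin> range c" "adj G v (c i)" "adj G v (c j)" and "i < j" "j < i + int M"
  shows "cyc G (v # seg c i j)"
  by (rule cyc_Cons) (use assms successively_seg[OF r] distinct_seg[OF r] in auto)

lemma cyc_outside_pair:
  assumes r: "ring G M c" and "v \<notin> range c" "u \<notin> range c" "adj G u v" "adj G u (c i)" "adj G v (c j)"
    "u \<noteq> v" "i \<le> j" "j < i + int M"
  shows "cyc G (v # u # seg c i j)"
  by (rule cyc_Cons) (use assms successively_seg[OF r] distinct_seg[OF r] in \<open>auto simp: successively_Cons adj_sym\<close>)

text \<open>The route goes from \<open>v\<close> to \<open>c s\<close>, forward to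
  \<open>c x\<close>, across the chord, and backward from \<open>c y\<close> to
  \<open>c t\<close>.\<close>

lemma cyc_outside_chord:
  assumes r: "ring G M c" and v: "v \<notin> range c" "adj G v (c s)" "adj G v (c t)" and xy: "adj G (c x) (c y)"
    and "s \<le> x" "x < t" "t \<le> y" "y < s + int M"
  shows "cyc G (v # seg c s x @ rev (seg c t y))"
proof (rule cyc_Cons)
  have "c ` {s..x} \<inter> c ` {t..y} = {}" by (rule seg_disjoint[OF r]) (use assms in auto)
  then show "distinct (seg c s x @ rev (seg c t y))"
    using assms distinct_seg[OF r] by auto
  show "successively (adj G) (seg c s x @ rev (seg c t y))"
    using assms successively_seg[OF r] by (auto simp: successively_append_iff)
qed (use assms in auto)

text \<open>Both segments run forward here; the chord skips the positions strictly between
  \<open>x\<close> and \<open>y\<close>.\<close>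

lemma cyc_outside_jump:
  assumes r: "ring G M c" and v: "v \<notin> range c" "adj G v (c s)" "adj G v (c t)" and xy: "adj G (c x) (c y)"
    and "s \<le> x" "x < y" "y \<le> t" "t < s + int M"
  shows "cyc G (v # seg c s x @ seg c y t)"
proof (rule cyc_Cons)
  have "c ` {s..x} \<inter> c ` {y..t} = {}" by (rule seg_disjoint[OF r]) (use assms in auto)
  then show "distinct (seg c s x @ seg c y t)"
    using assms distinct_seg[OF r] by auto
  show "successively (adj G) (seg c s x @ seg c y t)"
    using assms successively_seg[OF r] by (auto simp: successively_append_iff)
qed (use assms in auto)

lemma bipartite_card_le:
  assumes "finite X" "finite Y" "\<And>e. e \<in> E \<Longrightarrow> \<exists>x\<in>X. \<exists>y\<in>Y. e = {x, y}"
  shows "card E \<le> card X * card Y"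
proof -
  have "E \<subseteq> (\<lambda>(x, y). {x, y}) ` (X \<times> Y)" using assms(3) by fastforce
  then have "card E \<le> card ((\<lambda>(x, y). {x, y}) ` (X \<times> Y))"
    using assms(1,2) by (intro card_mono) auto
  also have "\<dots> \<le> card (X \<times> Y)" by (intro card_image_le finite_cartesian_product assms)
  finally show ?thesis by (simp add: card_cartesian_product)
qed

text \<open>A walk from \<open>k\<close> in steps of two that never enters \<open>a\<close> would
  avoid the whole parity class of \<open>k\<close> modulo the even period, hence also
  \<open>j\<close>.\<close>

lemma up_step:
  fixes a :: "int \<Rightarrow> bool"
  assumes "\<And>i. a (i + m) = a i" "even m" "m > 0" "a j" "\<not> a k" "even (j - k)"
  shows "\<exists>i. even (i - k) \<and> \<not> a i \<and> a (i + 2)"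
proof (rule ccontr)
  assume *: "\<not> ?thesis"
  have 1: "\<not> a (k + 2 * int t)" for t
  proof (induction t)
    case (Suc t)
    moreover have "even ((k + 2 * int t) - k)" by simp
    ultimately have "\<not> a (k + 2 * int t + 2)" using * by blast
    then show ?case by (simp add: algebra_simps)
  qed (use assms in simp)
  \<comment> \<open>A multiple of the period that makes the number of steps from \<open>k\<close>
    nonnegative.\<close>
  define T where "T = (\<bar>j\<bar> + \<bar>k\<bar>) * m"
  define w where "w = j - k + T"
  have "(\<bar>j\<bar> + \<bar>k\<bar>) * 1 \<le> (\<bar>j\<bar> + \<bar>k\<bar>) * m" using assms(3) by (intro mult_left_mono) auto
  then have "\<bar>j\<bar> + \<bar>k\<bar> \<le> T" by (simp add: T_def)
  then have "w \<ge> 0" unfolding w_def by linarith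
  moreover have "even w" using assms by (simp add: w_def T_def)
  ultimately have "w = 2 * int (nat (w div 2))" by auto
  then have "\<not> a (k + w)" using 1 by metis
  moreover have "k + w = j + (\<bar>j\<bar> + \<bar>k\<bar>) * m" by (simp add: w_def T_def)
  ultimately show False using ring_period_mult[of a m j] assms(1,4) by metis
qed

definition hits :: "'a graph \<Rightarrow> nat \<Rightarrow> 'a set \<Rightarrow> bool" where
  "hits G l W \<longleftrightarrow> (\<exists>xs. cyc G xs \<and> length xs = l \<and> set xs \<inter> W \<noteq> {})"

lemma hitsI: "cyc G xs \<Longrightarrow> length xs = l \<Longrightarrow> x \<in> set xs \<Longrightarrow> x \<in> W \<Longrightarrow> hits G l W"
  unfolding hits_def by auto

text \<open>One outside vertex is completed by a segment of \<open>l - 1\<close> positions, two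
  adjacent ones by a segment of \<open>l - 2\<close>; hence the distances \<open>l - 2\<close> and
  \<open>l - 3\<close>. The third claim is the second one with the two outside vertices
  exchanged.\<close>

lemma not_hits_chords:
  assumes r: "ring G M c" and v: "v \<notin> range c" and l: "5 \<le> l" "l \<le> M" and no: "\<not> hits G l {v}"
  shows "\<not> (adj G v (c i) \<and> adj G v (c (i + (int l - 2))))"
    and "u \<notin> range c \<Longrightarrow> u \<noteq> v \<Longrightarrow> adj G u v \<Longrightarrow> \<not> (adj G u (c i) \<and> adj G v (c (i + (int l - 3))))"
    and "u \<notin> range c \<Longrightarrow> u \<noteq> v \<Longrightarrow> adj G u v \<Longrightarrow> \<not> (adj G u (c i) \<and> adj G v (c (i - (int l - 3))))"
proof -
  have len: "Suc (Suc (nat (int l - 2))) = l" "Suc (nat (int l - 1)) = l" using l by linarith+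
  show "\<not> (adj G v (c i) \<and> adj G v (c (i + (int l - 2))))"
    using no hitsI[OF cyc_outside[OF r v, of i "i + (int l - 2)"], of l v "{v}"] l by (auto simp: len)
  assume u: "u \<notin> range c" "u \<noteq> v" "adj G u v"
  show "\<not> (adj G u (c i) \<and> adj G v (c (i + (int l - 3))))"
    using no hitsI[OF cyc_outside_pair[OF r v u(1,3), of i "i + (int l - 3)"], of l v "{v}"] l u by (auto simp: len)
  show "\<not> (adj G u (c i) \<and> adj G v (c (i - (int l - 3))))"
    using no hitsI[OF cyc_outside_pair[OF r u(1) v, of "i - (int l - 3)" i], of l v "{v}"] l u adj_sym[of G u v] by (auto simp: len)
qed

text \<open>A parity class on which \<open>a\<close> is not constant contains an up-step, by
  \<open>up_step\<close>, so at most one class is of that kind. For even \<open>p\<close>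
  antiperiodicity makes both classes nonconstant; for odd \<open>p\<close> it carries a nonconstant
  class to the other one. So \<open>p\<close> is odd and \<open>a\<close> is constant on each
  class.\<close>

lemma alternating_of_one_up_step:
  fixes a :: "int \<Rightarrow> bool"
  assumes per: "\<And>i. a (i + int M) = a i" and M: "even M" "M > 0"
    and anti: "\<And>i. a (i + p) = (\<not> a i)"
    and up: "cnt M (\<lambda>m. \<not> a m \<and> a (m + 2)) \<le> 1"
  shows "odd p \<and> (\<forall>i. a (i + 1) = (\<not> a i))"
proof -
  \<comment> \<open>As \<open>M\<close> is even, positions of different parity remain different
    modulo \<open>M\<close>, and their up-steps are counted separately.\<close>
  have U: "False" if "\<not> a i" "a (i + 2)" "\<not> a j" "a (j + 2)" "odd (i - j)" for i j
  proof -
    have "a (m + int M + 2) = a (m + 2)" for m using per[of "m + 2"] by (simp add: algebra_simps)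
    moreover have "i mod int M \<noteq> j mod int M"
    proof
      assume "i mod int M = j mod int M"
      then have "int M dvd i - j" by (simp add: mod_eq_dvd_iff)
      moreover have "2 dvd int M" using M(1) by simp
      ultimately have "2 dvd i - j" by (rule dvd_trans[rotated])
      then show False using that(5) by simp
    qed
    ultimately have "cnt M (\<lambda>m. \<not> a m \<and> a (m + 2)) \<ge> 2"
      using that M by (intro cnt_ge_two[of _ M i j]) (auto simp: per)
    then show False using up by simp
  qed
  have nonconst: False if h: "a j1" "\<not> a k1" "even (j1 - k1)" "a j2" "\<not> a k2" "even (j2 - k2)" "odd (k1 - k2)" for j1 k1 j2 k2
  proof -
    obtain i1 where i1: "even (i1 - k1)" "\<not> a i1" "a (i1 + 2)"
      using up_step[of a "int M" j1 k1, OF per _ _ h(1-3)] M by auto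
    obtain i2 where i2: "even (i2 - k2)" "\<not> a i2" "a (i2 + 2)"
      using up_step[of a "int M" j2 k2, OF per _ _ h(4-6)] M by auto
    show False by (rule U[of i1 i2]) (use i1 i2 h(7) in auto)
  qed
  have p: "odd p"
  proof
    assume p: "even p"
    have 1: "\<exists>j k. a j \<and> \<not> a k \<and> even (j - i) \<and> even (k - i)" for i
    proof (cases "a i")
      case True
      then show ?thesis using anti[of i] p by (intro exI[of _ i] exI[of _ "i + p"]) auto
    next
      case False
      then show ?thesis using anti[of i] p by (intro exI[of _ "i + p"] exI[of _ i]) auto
    qed
    obtain j1 k1 where 2: "a j1" "\<not> a k1" "even (j1 - 0)" "even (k1 - 0)" using 1[of 0] by blast
    obtain j2 k2 where 3: "a j2" "\<not> a k2" "even (j2 - 1)" "even (k2 - 1)" using 1[of 1] by blast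
    show False by (rule nonconst[of j1 k1 j2 k2]) (use 2 3 in auto)
  qed
  have const: "a i = a k" if "even (i - k)" for i k
  proof -
    have "False" if h: "a i" "\<not> a k" "even (i - k)" for i k
      by (rule nonconst[of i k "k + p" "i + p"]) (use h p anti[of i] anti[of k] in auto)
    then show ?thesis using that by (metis dvd_diff_commute)
  qed
  have "a (i + 1) = (\<not> a i)" for i using const[of "i + 1" "i + p"] p anti[of i] by auto
  then show ?thesis using p by blast
qed

text \<open>Without such a cycle the neighbourhood of \<open>v\<close> alternates along the ring, and then an edge between
  positions of equal parity, which exists by the edge count, closes one after all.\<close>

lemma hits_pair_even:
  assumes G: "simple_graph G" and r: "ring G M c" and v: "v \<notin> range c" and u: "u \<notin> range c"
    and uv: "adj G u v" and M: "even M" and l: "5 \<le> l" "l \<le> M"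
    and A: "M div 2 \<le> card {x \<in> range c. adj G v x}"
    and B: "M div 2 \<le> card {x \<in> range c. adj G u x} + 1"
    and E: "(M div 2)\<^sup>2 < card {e \<in> edges G. e \<subseteq> range c}"
  shows "hits G l {v}"
proof (rule ccontr)
  assume no: "\<not> hits G l {v}"
  define p where "p = int l - 2"
  define a where "a i = adj G v (c i)" for i
  define b where "b i = adj G u (c i)" for i
  have p: "3 \<le> p" "p \<le> int M - 2" using l by (auto simp: p_def)
  have lp: "int l = p + 2" by (simp add: p_def)
  have perc: "c (i + int M) = c i" for i using ring_period[OF r] by blast
  have per: "a (i + int M) = a i" "b (i + int M) = b i" for i by (simp_all add: a_def b_def perc)
  have M0: "M > 0" using l by simp
  have cA: "cnt M a \<ge> M div 2" using A unfolding a_def cnt_ring[OF r] .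
  have cB: "cnt M b + 1 \<ge> M div 2" using B unfolding b_def cnt_ring[OF r] .
  have "u \<noteq> v" using uv adj_neq[OF G] by blast
  note chords = not_hits_chords[OF r v l no] not_hits_chords(2,3)[OF r v l no u this uv]
  have noA: "\<not> (a i \<and> a (i + p))" for i using chords(1)[of i] by (simp add: a_def p_def)
  have noB: "\<not> (b i \<and> a (i + (p - 1)))" "\<not> (b i \<and> a (i - (p - 1)))" for i
    using chords(4,5)[of i] by (simp_all add: a_def b_def p_def)
  have shA: "cnt M (\<lambda>i. a (i + s)) = cnt M a" for s by (rule cnt_shift) (rule per)
  \<comment> \<open>\<open>a\<close> and its translate by \<open>p\<close> are disjoint and each has
    at least half of the positions, so they are complementary.\<close>
  have anti: "a (i + p) = (\<not> a i)" for i
  proof -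
    have e: "(\<lambda>i. a i \<and> a (i + p)) = (\<lambda>i. False)" using noA by auto
    have "2 * (M div 2) \<le> cnt M (\<lambda>i. a i \<or> a (i + p))"
      using cnt_disj[of M a "\<lambda>i. a (i + p)"] cA shA[of p] unfolding e by simp
    then have "cnt M (\<lambda>i. \<not> (a i \<or> a (i + p))) = 0"
      using cnt_not[of M "\<lambda>i. a i \<or> a (i + p)"] M by simp
    moreover have "a (i + int M + p) = a (i + p)" for i using per(1)[of "i + p"] by (simp add: algebra_simps)
    ultimately have "a i \<or> a (i + p)"
      using cnt_ge_one[of "\<lambda>i. \<not> (a i \<or> a (i + p))" M i] M0 per by auto
    then show ?thesis using noA[of i] by blast
  qed
  \<comment> \<open>A position in \<open>b\<close> forces \<open>a\<close> at both ring neighbours.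
    The positions \<open>m\<close> with \<open>a (m + 1)\<close> false already make up half of the
    ring, while \<open>b\<close> misses at most \<open>M div 2 + 1\<close> positions; this leaves
    room for one position failing only at \<open>m - 1\<close>.\<close>
  have "cnt M (\<lambda>m. \<not> a m \<and> a (m + 2)) \<le> 1"
  proof -
    have s1: "a (m + (1 - p) + p) = a (m + 1)" "a (m - (p - 1)) = a (m + (1 - p))" for m
      by (simp_all add: algebra_simps)
    have dn: "a (m - (p - 1)) = (\<not> a (m + 1))" for m
      using anti[of "m + (1 - p)"] s1 by auto
    have upp: "a (m + (p - 1)) = (\<not> a (m - 1))" for m
      using anti[of "m - 1"] by (simp add: algebra_simps)
    let ?U = "\<lambda>m. \<not> a m \<and> a (m + 2)"
    have per': "?U (m + int M) = ?U m" for m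
      using per(1)[of m] per(1)[of "m + 2"] by (simp add: algebra_simps)
    have "cnt M (\<lambda>m. ?U (m + (-1))) = cnt M ?U" by (rule cnt_shift) (rule per')
    moreover have "(\<lambda>m. ?U (m + (-1))) = (\<lambda>m. \<not> a (m - 1) \<and> a (m + 1))" by (simp add: algebra_simps)
    ultimately have 1: "cnt M (\<lambda>m. \<not> a (m - 1) \<and> a (m + 1)) = cnt M ?U" by simp
    let ?V = "\<lambda>m. \<not> a (m - 1) \<and> a (m + 1)" and ?W = "\<lambda>m. \<not> a (m + 1)"
    have "cnt M ?V + cnt M ?W = cnt M (\<lambda>m. ?V m \<and> ?W m) + cnt M (\<lambda>m. ?V m \<or> ?W m)"
      by (rule cnt_disj)
    moreover have "(\<lambda>m. ?V m \<and> ?W m) = (\<lambda>m. False)" by auto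
    moreover have "cnt M (\<lambda>m. ?V m \<or> ?W m) \<le> cnt M (\<lambda>m. \<not> b m)"
      by (rule cnt_mono) (use noB dn upp in blast)
    moreover have "cnt M ?W = M div 2"
    proof -
      have "?W = (\<lambda>m. a (m + (1 + p)))"
      proof
        fix m show "?W m = a (m + (1 + p))" using anti[of "m + 1"] by (simp add: add.assoc)
      qed
      then have "cnt M ?W = cnt M a" using shA by simp
      moreover have "cnt M ?W + cnt M a = M" using shA[of 1] cnt_not[of M "\<lambda>m. a (m + 1)"] by simp
      ultimately show ?thesis by simp
    qed
    ultimately have "cnt M ?V + M div 2 \<le> M - cnt M b" using cnt_not[of M b] by simp
    then show ?thesis using 1 cB M by (auto elim!: evenE)
  qed
  then have alt: "odd p" "\<And>i. a (i + 1) = (\<not> a i)"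
    using alternating_of_one_up_step[of a M p] per anti M M0 by auto
  have alt2: "a (i - int k) = (if even k then a i else \<not> a i)" for i k
  proof (induction k)
    case (Suc k)
    have "a (i - int k) = (\<not> a (i - int (Suc k)))" using alt(2)[of "i - int (Suc k)"] by simp
    then show ?case using Suc by auto
  qed simp
  have alt3: "a (i - k) = (if even k then a i else \<not> a i)" if "k \<ge> 0" for i k
    using alt2[of i "nat k"] that by (simp add: even_nat_iff)
  have chord: "odd (y - x)" if xy: "adj G (c x) (c y)" "x < y" "y < x + int M" for x y
  proof
    assume ev: "even (y - x)"
    define d where "d = y - x"
    have "even d" "0 < d" "d < int M" "even (int M)" using ev xy M by (auto simp: d_def)
    then have d: "2 \<le> d" "d \<le> int M - 2" "even d" by presburger+
    \<comment> \<open>The arcs ending in \<open>x\<close> and \<open>y\<close> take \<open>k\<close>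
      and \<open>p - 1 - k\<close> steps, which gives \<open>p + 2\<close> vertices together with
      \<open>v\<close>. The parity of \<open>k\<close> makes both starting points neighbours of
      \<open>v\<close>, and the case distinction keeps the arcs disjoint.\<close>
    define k where "k = (if d \<ge> p then if a x then 0 else 1 else if a x then p - d + 1 else p - d)"
    have k: "0 \<le> k" "k \<le> p - 1" "p - 1 - k < d" "k < int M - d" "a x \<longleftrightarrow> even k"
      using d p alt(1) unfolding k_def by auto
    have ax: "a (x - k)" using alt3[of k x] k by auto
    have "a y = a x" using alt3[of d y] d by (simp add: d_def)
    then have ay: "a (y - (p - 1 - k))" using alt3[of "p - 1 - k" y] k alt(1) by auto
    have "cyc G (v # seg c (x - k) x @ rev (seg c (y - (p - 1 - k)) y))"
      by (rule cyc_outside_chord[OF r v]) (use ax ay k xy d in \<open>auto simp: a_def d_def\<close>)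
    moreover have "length (v # seg c (x - k) x @ rev (seg c (y - (p - 1 - k)) y)) = l"
      using k lp by simp
    ultimately show False using no hitsI[of G _ l v "{v}"] by fastforce
  qed
  \<comment> \<open>Now all edges run between the two parity classes, and there are too few such
    pairs.\<close>
  let ?X = "c ` {i \<in> {0..<int M}. even i}" and ?Y = "c ` {i \<in> {0..<int M}. odd i}"
  have "card {e \<in> edges G. e \<subseteq> range c} \<le> card ?X * card ?Y"
  proof (rule bipartite_card_le)
    fix e assume "e \<in> {e \<in> edges G. e \<subseteq> range c}"
    then obtain i j where ij: "e = {c i, c j}" "adj G (c i) (c j)" "0 \<le> i" "i < j" "j < int M"
      using ring_edge_indices[OF G r] by blast
    then have "odd (j - i)" using chord[of i j] by simp
    then have "even i \<and> odd j \<or> odd i \<and> even j" by auto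
    moreover have "i \<in> {0..<int M}" "j \<in> {0..<int M}" "e = {c j, c i}" using ij by auto
    ultimately show "\<exists>x\<in>?X. \<exists>y\<in>?Y. e = {x, y}" using ij(1) by blast
  qed auto
  also have "card ?X * card ?Y \<le> (M div 2) * (M div 2)"
  proof (intro mult_mono)
    have c1: "cnt M even = cnt M odd"
      using cnt_shift[of even M 1] M by simp
    have "cnt M even + cnt M odd = M" by (rule cnt_not)
    then have c2: "cnt M even = M div 2" "cnt M odd = M div 2" using c1 by simp_all
    show "card ?X \<le> M div 2"
      unfolding c2(1)[unfolded cnt_def, symmetric] by (rule card_image_le) simp
    show "card ?Y \<le> M div 2"
      unfolding c2(2)[unfolded cnt_def, symmetric] by (rule card_image_le) simp
  qed auto
  finally show False using E by (simp add: power2_eq_square)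
qed

section \<open>Rings of odd length\<close>

lemma dvd_linear_combination:
  fixes m :: int
  assumes "m dvd x" "m dvd y" "z = x * a + y * b"
  shows "m dvd z"
  using assms by simp

lemma odd_dvd_double: "odd m \<Longrightarrow> m dvd 2 * x \<Longrightarrow> m dvd x" for m x :: int
  by (simp add: coprime_dvd_mult_right_iff)

text \<open>Stepping by \<open>p\<close> flips \<open>a\<close> except at one position. As \<open>M\<close> is odd, the orbit of every position has to
  pass through that exception, so \<open>p\<close> is invertible modulo \<open>M\<close>.\<close>

lemma odd_antiperiodic_defect:
  fixes a :: "int \<Rightarrow> bool"
  assumes per: "\<And>i. a (i + int M) = a i" and M: "odd M"
    and uniq: "\<And>i j. \<not> a i \<Longrightarrow> \<not> a (i + p) \<Longrightarrow> \<not> a j \<Longrightarrow> \<not> a (j + p) \<Longrightarrow> i mod int M = j mod int M"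
    and disj: "\<And>i. \<not> (a i \<and> a (i + p))"
  obtains i0 r where "(r * p) mod int M = 1 mod int M"
    "\<And>j. a (i0 + j * p) \<longleftrightarrow> even (j mod int M) \<and> j mod int M \<noteq> 0"
proof -
  define N where "N i \<longleftrightarrow> \<not> a i \<and> \<not> a (i + p)" for i
  have M0: "int M > 0" using M by (auto elim: oddE)
  have perm: "a (i + k * int M) = a i" for i k using ring_period_mult[of a "int M" i k] per by simp
  have walk: "a (i + int t * p) = (if even t then a i else \<not> a i)" if "\<forall>s<t. \<not> N (i + int s * p)" for i t
    using that
  proof (induction t)
    case (Suc t)
    have "a (i + int t * p + p) = (\<not> a (i + int t * p))"
      using Suc.prems disj[of "i + int t * p"] by (auto simp: N_def)
    then show ?case using Suc by (auto simp: algebra_simps)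
  qed simp
  have ex: "\<exists>s<M. N (i + int s * p)" for i
  proof (rule ccontr)
    assume "\<not> ?thesis"
    then have "a (i + int M * p) = (\<not> a i)" using walk[of M i] M by auto
    then show False using perm[of i p] by (simp add: mult.commute)
  qed
  obtain i0 where i0: "N i0" using ex by blast
  \<comment> \<open>An orbit started one position earlier reaches the same exceptional residue, so
    that \<open>s * p\<close> is congruent to 1.\<close>
  obtain s where "N (i0 - 1 + int s * p)" using ex by blast
  then have "(i0 - 1 + int s * p) mod int M = i0 mod int M"
    using uniq i0 unfolding N_def by blast
  then have "int M dvd int s * p - 1" by (simp add: mod_eq_dvd_iff)
  then have r: "(int s * p) mod int M = 1 mod int M" by (simp add: mod_eq_dvd_iff)
  have noN: "\<not> N (i0 + j * p)" if "j mod int M \<noteq> 0" for j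
  proof
    assume "N (i0 + j * p)"
    then have "(i0 + j * p) mod int M = i0 mod int M" using uniq i0 unfolding N_def by blast
    then have "int M dvd j * p" by (simp add: mod_eq_dvd_iff)
    then have "int M dvd j"
      by (rule dvd_linear_combination[OF _ \<open>int M dvd int s * p - 1\<close>, of "j * p" j "int s" "- j"])
        (simp add: algebra_simps)
    then show False using that by simp
  qed
  \<comment> \<open>Both \<open>i0\<close> and \<open>i0 + p\<close> lie outside \<open>a\<close>;
    from there on the values alternate until the orbit closes.\<close>
  have main: "a (i0 + int (Suc j) * p) = odd j" if "Suc j \<le> M" for j
    using that
  proof (induction j)
    case 0 then show ?case using i0 by (simp add: N_def)
  next
    case (Suc j)
    have "\<not> N (i0 + int (Suc j) * p)" using Suc.prems by (intro noN) simp
    then have "a (i0 + int (Suc j) * p + p) = (\<not> a (i0 + int (Suc j) * p))"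
      using disj by (auto simp: N_def)
    then show ?case using Suc by (simp add: algebra_simps)
  qed
  have "a (i0 + j * p) \<longleftrightarrow> even (j mod int M) \<and> j mod int M \<noteq> 0" for j
  proof -
    have "i0 + j * p = i0 + (j mod int M) * p + (j div int M * p) * int M"
    proof -
      have "j = j mod int M + j div int M * int M" by simp
      then obtain R Q where "j = R + Q * int M" "R = j mod int M" "Q = j div int M" by blast
      then show ?thesis by (metis add.assoc distrib_right mult.commute mult.left_commute)
    qed
    then have e: "a (i0 + j * p) = a (i0 + (j mod int M) * p)" using perm by metis
    show ?thesis
    proof (cases "j mod int M = 0")
      case True then show ?thesis using e i0 by (simp add: N_def)
    next
      case False
      define k where "k = nat (j mod int M - 1)"
      have "0 \<le> j mod int M" "j mod int M < int M" using M0 by simp_all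
      then have k: "j mod int M = int (Suc k)" "Suc k \<le> M" using False by (auto simp: k_def)
      show ?thesis using e main[OF k(2)] k(1) by simp
    qed
  qed
  then show ?thesis using that r by blast
qed

text \<open>In coordinates along the orbit of \<open>p\<close> the set \<open>a\<close> consists of
  the nonzero even residues. The size of \<open>b\<close> admits at most one residue outside
  \<open>a\<close> whose translate by a certain \<open>t\<close> is inside, and this forces
  \<open>t = 2\<close>. Hence \<open>2 * p\<close> is 1 modulo \<open>M\<close>, and halving the
  coordinates turns the even residues into an interval.\<close>

lemma half_interval:
  fixes a b :: "int \<Rightarrow> bool"
  assumes per: "\<And>i. a (i + int M) = a i" "\<And>i. b (i + int M) = b i"
    and M: "odd M" and p: "3 \<le> p" "p \<le> int M - 2"
    and cA: "M div 2 \<le> cnt M a" and cB: "M div 2 \<le> cnt M b"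
    and noA: "\<And>i. \<not> (a i \<and> a (i + p))"
    and noB: "\<And>i. \<not> (b i \<and> a (i + (p - 1)))" "\<And>i. \<not> (b i \<and> a (i - (p - 1)))"
  shows "2 * p = int M + 1" "cnt M b = M div 2" "\<exists>i0. \<forall>i. a i \<longleftrightarrow> (i - i0) mod int M \<in> {1..p - 1}"
proof -
  let ?k = "M div 2"
  have M0: "M > 0" "int M > 0" "int M \<ge> 5" using p by linarith+
  have shA: "cnt M (\<lambda>i. a (i + s)) = cnt M a" for s by (rule cnt_shift) (rule per)
  have perm: "a i = a j" if "i mod int M = j mod int M" for i j
    using periodic_mod[of a M] per that by metis
  let ?N = "\<lambda>i. \<not> a i \<and> \<not> a (i + p)"
  have e: "(\<lambda>i. a i \<and> a (i + p)) = (\<lambda>i. False)" using noA by auto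
  have "cnt M (\<lambda>i. a i \<or> a (i + p)) = 2 * cnt M a"
    using cnt_disj[of M a "\<lambda>i. a (i + p)"] shA[of p] unfolding e by simp
  moreover have "(\<lambda>i. \<not> (a i \<or> a (i + p))) = ?N" by auto
  ultimately have cN: "2 * cnt M a + cnt M ?N = M" using cnt_not[of M "\<lambda>i. a i \<or> a (i + p)"] by simp
  then have N1: "cnt M ?N \<le> 1" "cnt M a = ?k" using cA M by presburger+
  have perN: "?N (i + int M) = ?N i" for i
    using per(1)[of i] per(1)[of "i + p"] by (simp add: algebra_simps)
  have uniq: "i mod int M = j mod int M" if "\<not> a i" "\<not> a (i + p)" "\<not> a j" "\<not> a (j + p)" for i j
    using cnt_ge_two[of ?N M i j] that perN M0 N1(1) by fastforce
  obtain i0 r where r: "(r * p) mod int M = 1 mod int M"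
      and al: "\<And>j. a (i0 + j * p) \<longleftrightarrow> even (j mod int M) \<and> j mod int M \<noteq> 0"
    using odd_antiperiodic_defect[of a M p, OF per(1) M uniq noA] by blast
  have rp: "int M dvd r * p - 1" using r by (simp add: mod_eq_dvd_iff)
  let ?V = "\<lambda>m. \<not> a (m + (p - 1)) \<and> a (m - (p - 1))"
  \<comment> \<open>Neither \<open>?V\<close> nor the disjoint \<open>?W\<close>, which has
    \<open>M div 2\<close> positions, meets \<open>b\<close>.\<close>
  have cV: "cnt M ?V + cnt M b \<le> ?k + 1"
  proof -
    let ?W = "\<lambda>m. a (m + (p - 1))"
    have "cnt M ?V + cnt M ?W = cnt M (\<lambda>m. ?V m \<and> ?W m) + cnt M (\<lambda>m. ?V m \<or> ?W m)"
      by (rule cnt_disj)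
    moreover have "(\<lambda>m. ?V m \<and> ?W m) = (\<lambda>m. False)" by auto
    moreover have "cnt M (\<lambda>m. ?V m \<or> ?W m) \<le> cnt M (\<lambda>m. \<not> b m)"
      by (rule cnt_mono) (use noB in blast)
    moreover have "cnt M ?W = ?k" using shA N1(2) by simp
    ultimately have "cnt M ?V + ?k + cnt M b \<le> M" using cnt_not[of M b] by simp
    then show ?thesis using M by presburger
  qed
  have perV: "?V (m + int M) = ?V m" for m
    using per(1)[of "m + (p - 1)"] per(1)[of "m - (p - 1)"] by (simp add: algebra_simps)
  define al' where "al' j \<longleftrightarrow> even (j mod int M) \<and> j mod int M \<noteq> 0" for j :: int
  \<comment> \<open>Shifting positions by \<open>2 - 2 * p\<close> shifts orbit coordinates by
    \<open>2 * r - 2\<close>, since \<open>r\<close> inverts \<open>p\<close> modulo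
    \<open>M\<close>.\<close>
  define t where "t = (2 * r - 2) mod int M"
  have t: "0 \<le> t" "t < int M" using M0 by (auto simp: t_def)
  have Viff: "?V (i0 + j * p - (p - 1)) \<longleftrightarrow> \<not> al' j \<and> al' (j + t)" for j
  proof -
    have "int M dvd (2 * r - 2) - t" by (simp add: t_def mod_eq_dvd_iff[symmetric])
    then have "int M dvd (i0 + (j + t) * p) - (i0 + j * p - (p - 1) - (p - 1))"
      by (rule dvd_linear_combination[OF _ rp, of _ _ "- p" 2]) (simp add: algebra_simps)
    then have "a (i0 + j * p - (p - 1) - (p - 1)) = a (i0 + (j + t) * p)"
      by (intro perm[symmetric]) (simp only: mod_eq_dvd_iff)
    then show ?thesis using al by (simp add: al'_def)
  qed
  have two: False if "\<not> al' i" "al' (i + t)" "\<not> al' j" "al' (j + t)" "0 \<le> i" "i < j" "j < int M" for i j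
  proof -
    have "\<not> int M dvd j - i" using that zdvd_imp_le[of "int M" "j - i"] by auto
    moreover have "int M dvd (j - i) * (r * p - 1)" using rp by simp
    ultimately have "\<not> int M dvd ((i0 + j * p - (p - 1)) - (i0 + i * p - (p - 1)))"
    proof -
      have "int M dvd j - i" if "int M dvd (j - i) * p"
      proof -
        show ?thesis
          by (rule dvd_linear_combination[OF that rp, of _ r "i - j"]) (simp add: algebra_simps)
      qed
      then show ?thesis using \<open>\<not> int M dvd j - i\<close> by (auto simp: algebra_simps)
    qed
    then have "(i0 + j * p - (p - 1)) mod int M \<noteq> (i0 + i * p - (p - 1)) mod int M"
      by (simp add: mod_eq_dvd_iff)
    then have "cnt M ?V \<ge> 2"
      using cnt_ge_two[of ?V M "i0 + j * p - (p - 1)" "i0 + i * p - (p - 1)", OF perV] Viff that M0 by blast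
    then show False using cV cB by simp
  qed
  have alv: "al' j \<longleftrightarrow> even j \<and> j \<noteq> 0" if "0 \<le> j" "j < int M" for j
    using that by (simp add: al'_def)
  have alw: "al' j \<longleftrightarrow> odd j \<and> j \<noteq> int M" if "int M \<le> j" "j < 2 * int M" for j
  proof -
    have "(j - int M) mod int M = j - int M" using that by (intro mod_pos_pos_trivial) auto
    then have "j mod int M = j - int M" by simp
    then show ?thesis using M by (auto simp: al'_def)
  qed
  have oddM: "odd (int M)" using M by simp
  have tnot0: "t \<noteq> 0"
  proof
    assume "t = 0"
    then have "int M dvd 2 * r - 2" by (simp add: t_def dvd_eq_mod_eq_0)
    then have "int M dvd 2 * (p - 1)"
      by (rule dvd_linear_combination[OF _ rp, of _ _ "- p" 2]) (simp add: algebra_simps)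
    then have "int M dvd p - 1" by (rule odd_dvd_double[OF oddM])
    then show False using p zdvd_imp_le[of "int M" "p - 1"] by simp
  qed
  have tnotm2: "t \<noteq> int M - 2"
  proof
    assume "t = int M - 2"
    moreover have "(int M - 2) mod int M = int M - 2"
      by (rule mod_pos_pos_trivial) (use M0 in auto)
    ultimately have "(2 * r - 2) mod int M = (int M - 2) mod int M" by (simp only: t_def)
    then have "int M dvd 2 * r - int M" by (simp add: mod_eq_dvd_iff algebra_simps)
    then have "int M dvd 2 * r" using dvd_add[of "int M" "2 * r - int M" "int M"] by simp
    then have "int M dvd 2"
      by (rule dvd_linear_combination[OF _ rp, of _ _ "p" "-2"]) (simp add: algebra_simps)
    then show False using M0 zdvd_imp_le[of "int M" 2] by simp
  qed
  \<comment> \<open>Another even \<open>t\<close> would have the two witnesses \<open>0\<close> and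
    \<open>int M - 2\<close>, an odd \<open>t\<close> the witnesses \<open>1\<close> and
    \<open>3\<close>.\<close>
  have t2: "t = 2"
  proof (rule ccontr)
    assume "t \<noteq> 2"
    show False
    proof (cases "even t")
      case True
      then have "t \<ge> 4" using tnot0 \<open>t \<noteq> 2\<close> t by presburger
      then show False using two[of 0 "int M - 2"] alv[of 0] alv[of t] alv[of "int M - 2"] alw[of "int M - 2 + t"] True t M0 oddM
        by auto
    next
      case False
      then have "t \<le> int M - 4" using t tnotm2 oddM by presburger
      then show False using two[of 1 3] alv[of 1] alv[of 3] alv[of "1 + t"] alv[of "3 + t"] False t M0 oddM
        by auto
    qed
  qed
  have "cnt M ?V \<ge> 1"
    using cnt_ge_one[of ?V M "i0 + 0 * p - (p - 1)", OF perV] Viff[of 0] alv[of 0] alv[of 2] t2 M0 by auto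
  then show cb: "cnt M b = ?k" using cV cB by simp
  have "(2 * r - 2) mod int M = 2 mod int M" using t2 M0(3) by (simp add: t_def)
  then have "int M dvd (2 * r - 2) - 2" by (simp only: mod_eq_dvd_iff)
  then have "int M dvd 2 * (r - 2)" by (simp add: algebra_simps)
  then have "int M dvd r - 2" by (rule odd_dvd_double[OF oddM])
  then have d2p: "int M dvd 2 * p - 1"
    by (rule dvd_linear_combination[OF _ rp, of _ _ "- p" 1]) (simp add: algebra_simps)
  then obtain q where q: "2 * p - 1 = int M * q" by (auto elim: dvdE)
  have "q > 0"
  proof (rule ccontr)
    assume "\<not> q > 0"
    then have "int M * q \<le> 0" by (intro mult_nonneg_nonpos) auto
    then show False using q p by linarith
  qed
  moreover have "q < 2"
  proof (rule ccontr)
    assume "\<not> q < 2"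
    then have "int M * 2 \<le> int M * q" by (intro mult_left_mono) auto
    then show False using q p by linarith
  qed
  ultimately have "q = 1" by simp
  then show pM: "2 * p = int M + 1" using q by simp
  have "a i \<longleftrightarrow> (i - i0) mod int M \<in> {1..p - 1}" for i
  proof -
    let ?d = "(i - i0) mod int M"
    have d: "0 \<le> ?d" "?d < int M" using M0 by simp_all
    \<comment> \<open>Since \<open>2 * p\<close> is 1 modulo \<open>M\<close>, orbit coordinate
      \<open>2 * ?d\<close> belongs to position \<open>i0 + ?d\<close>.\<close>
    have "int M dvd (i0 + 2 * ?d * p) - i"
    proof -
      have "int M dvd ?d - (i - i0)" by (simp add: mod_eq_dvd_iff[symmetric])
      then have "int M dvd (?d - (i - i0)) + (2 * p - 1) * ?d" using d2p by (intro dvd_add dvd_mult2)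
      then show ?thesis by (simp add: algebra_simps)
    qed
    then have "a i = a (i0 + 2 * ?d * p)" by (intro perm) (simp add: mod_eq_dvd_iff dvd_diff_commute)
    also have "\<dots> = al' (2 * ?d)" using al by (simp add: al'_def)
    also have "\<dots> = (?d \<in> {1..p - 1})"
    proof (cases "2 * ?d < int M")
      case True
      then show ?thesis using alv[of "2 * ?d"] d pM by auto
    next
      case False
      then show ?thesis using alw[of "2 * ?d"] d pM by auto
    qed
    finally show ?thesis .
  qed
  then show "\<exists>i0. \<forall>i. a i \<longleftrightarrow> (i - i0) mod int M \<in> {1..p - 1}" by blast
qed

text \<open>The configuration left over by \<open>half_interval\<close>. The only edges closing no
  cycle of length \<open>p + 2\<close> are those inside the interval of neighbours, ring edges
  outside it, and edges from the interval to the two end positions of its complement. These are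
  fewer than assumed.\<close>

lemma hits_interval_nbrs:
  assumes G: "simple_graph G" and r: "ring G M c" and v: "v \<notin> range c" and p: "3 \<le> p" "2 * p = M + 1"
    and a: "\<And>i. 0 \<le> i \<Longrightarrow> i \<le> int p - 2 \<Longrightarrow> adj G v (c i)"
    and E: "M\<^sup>2 div 4 + 2 \<le> card {e \<in> edges G. e \<subseteq> range c}"
  shows "hits G (p + 2) {v}"
proof (rule ccontr)
  assume no: "\<not> hits G (p + 2) {v}"
  let ?p = "int p"
  have M: "int M = 2 * ?p - 1" using p by linarith
  have perc: "c (i + (2 * ?p - 1)) = c i" for i using ring_period(1)[OF r, of i] M by simp
  \<comment> \<open>The start \<open>?p - (y - x)\<close> compensates for the positions skipped by
    the chord; the end \<open>2 * ?p - 1\<close> is position \<open>0\<close> again.\<close>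
  have DD: False if "adj G (c x) (c y)" "?p - 1 \<le> x" "x + 2 \<le> y" "y \<le> 2 * ?p - 2" for x y
  proof -
    have "adj G v (c (2 * ?p - 1))" using a[of 0] perc[of 0] p by simp
    then have "cyc G (v # seg c (?p - (y - x)) x @ seg c y (2 * ?p - 1))"
      by (intro cyc_outside_jump[OF r v]) (use a that M in auto)
    then show False using no hitsI[of G _ "p + 2" v "{v}"] that p by fastforce
  qed
  \<comment> \<open>A single position \<open>x\<close>, then \<open>?p\<close> positions beginning
    with \<open>y\<close>, forward or backward according to which direction avoids \<open>x\<close>.
    The last position is again a neighbour of \<open>v\<close>.\<close>
  have ID: False if "adj G (c x) (c y)" "0 \<le> x" "x \<le> ?p - 2" "?p \<le> y" "y \<le> 2 * ?p - 3" for x y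
  proof (cases "y \<le> x + ?p - 1")
    case True
    have "adj G v (c (y + ?p - 1))" using a[of "y - ?p"] perc[of "y - ?p"] that by (simp add: algebra_simps)
    then have "cyc G (v # seg c x x @ seg c y (y + ?p - 1))"
      by (intro cyc_outside_jump[OF r v]) (use a that M True in auto)
    then show False using no hitsI[of G _ "p + 2" v "{v}"] that p by fastforce
  next
    case False
    have "cyc G (v # seg c x x @ rev (seg c (y + 1 - ?p) y))"
      by (intro cyc_outside_chord[OF r v]) (use a that M False in auto)
    then show False using no hitsI[of G _ "p + 2" v "{v}"] that p by fastforce
  qed
  define I where "I = c ` {0..?p - 2}"
  define E1 where "E1 = {e. e \<subseteq> I \<and> card e = 2}"
  define E2 where "E2 = (\<lambda>b. {c b, c (b + 1)}) ` {?p - 1..2 * ?p - 3}"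
  define E3 where "E3 = {e. \<exists>x\<in>I. \<exists>y\<in>{c (?p - 1), c (2 * ?p - 2)}. e = {x, y}}"
  have fI: "finite I" by (simp add: I_def)
  have cI: "card I \<le> p - 1" unfolding I_def by (rule card_image_le[THEN order_trans]) auto
  have c1: "card E1 \<le> (p - 1) choose 2"
  proof -
    have "card E1 = card I choose 2" unfolding E1_def by (rule n_subsets[OF fI])
    also have "\<dots> \<le> (p - 1) choose 2"
      unfolding choose_two by (intro div_le_mono mult_le_mono diff_le_mono cI)
    finally show ?thesis .
  qed
  have c2: "card E2 \<le> p - 1" unfolding E2_def by (rule card_image_le[THEN order_trans]) auto
  have "card E3 \<le> card I * card {c (?p - 1), c (2 * ?p - 2)}"
    by (rule bipartite_card_le) (auto simp: fI E3_def)
  also have "\<dots> \<le> (p - 1) * 2" using cI by (intro mult_mono) (auto simp: card_insert_if)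
  finally have c3: "card E3 \<le> (p - 1) * 2" .
  have "{e \<in> edges G. e \<subseteq> range c} \<subseteq> E1 \<union> E2 \<union> E3"
  proof
    fix e assume "e \<in> {e \<in> edges G. e \<subseteq> range c}"
    then obtain i j where ij: "e = {c i, c j}" "adj G (c i) (c j)" "0 \<le> i" "i < j" "j < int M"
      using ring_edge_indices[OF G r] by blast
    then have "i < j" "0 \<le> i" "j \<le> 2 * ?p - 2" using M by auto
    have "c i \<noteq> c j" using ij(2) G adj_neq by metis
    note ij = ij(1) \<open>i < j\<close> ij(2) \<open>0 \<le> i\<close> \<open>j \<le> 2 * ?p - 2\<close>
    note ij = ij \<open>c i \<noteq> c j\<close>
    consider "j \<le> ?p - 2" | "?p - 1 \<le> i" "j = i + 1" | "?p - 1 \<le> i" "i + 2 \<le> j"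
      | "i \<le> ?p - 2" "j = ?p - 1 \<or> j = 2 * ?p - 2" | "i \<le> ?p - 2" "?p \<le> j" "j \<le> 2 * ?p - 3"
      using ij by linarith
    then show "e \<in> E1 \<union> E2 \<union> E3"
    proof cases
      case 1 then show ?thesis using ij by (auto simp: E1_def I_def)
    next
      case 2 then show ?thesis using ij by (auto simp: E2_def)
    next
      case 3 then show ?thesis using ij DD[of i j] by blast
    next
      case 4 then show ?thesis using ij by (auto simp: E3_def I_def)
    next
      case 5 then show ?thesis using ij ID[of i j] by blast
    qed
  qed
  moreover have fin: "finite E1" "finite E2" "finite E3"
  proof -
    show "finite E1" unfolding E1_def using fI by simp
    show "finite E2" by (simp add: E2_def)
    show "finite E3" using fI by (intro finite_subset[of E3 "(\<lambda>(x, y). {x, y}) ` (I \<times> {c (?p - 1), c (2 * ?p - 2)})"])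
      (auto simp: E3_def)
  qed
  ultimately have "card {e \<in> edges G. e \<subseteq> range c} \<le> card (E1 \<union> E2 \<union> E3)"
    by (intro card_mono) auto
  also have "\<dots> \<le> card E1 + card E2 + card E3"
    using card_Un_le[of "E1 \<union> E2" E3] card_Un_le[of E1 E2] by linarith
  finally have "M\<^sup>2 div 4 + 2 \<le> ((p - 1) choose 2) + (p - 1) * 3" using E c1 c2 c3 by linarith
  moreover obtain q where q: "p = q + 3" using p(1) by (metis add.commute le_Suc_ex)
  moreover have "M = 2 * q + 5" using p q by simp
  moreover have "M\<^sup>2 div 4 = (q + 2) * (q + 3)"
  proof -
    have "M\<^sup>2 = 4 * ((q + 2) * (q + 3)) + 1" using \<open>M = 2 * q + 5\<close> by (simp add: power2_eq_square algebra_simps)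
    then show ?thesis by simp
  qed
  moreover have "2 * ((p - 1) choose 2) = (q + 2) * (q + 1)" using q by (simp add: choose_two)
  ultimately have "2 * ((q + 2) * (q + 3)) + 4 \<le> (q + 2) * (q + 1) + 6 * (q + 2)" by simp
  then show False by (simp add: algebra_simps)
qed

text \<open>\<open>half_interval\<close> leaves exactly \<open>M div 2\<close> positions in
  \<open>b\<close> and an interval of neighbours of \<open>v\<close>. The first alternative in
  \<open>E\<close> contradicts the former, the second one the latter by
  \<open>hits_interval_nbrs\<close>.\<close>

lemma hits_pair_odd:
  assumes G: "simple_graph G" and r: "ring G M c" and v: "v \<notin> range c" and u: "u \<notin> range c"
    and uv: "adj G u v" and M: "odd M" and l: "5 \<le> l" "l \<le> M"
    and A: "M div 2 \<le> card {x \<in> range c. adj G v x}"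
    and B: "M div 2 \<le> card {x \<in> range c. adj G u x}"
    and E: "M div 2 < card {x \<in> range c. adj G u x} \<or> M\<^sup>2 div 4 + 2 \<le> card {e \<in> edges G. e \<subseteq> range c}"
  shows "hits G l {v}"
proof (rule ccontr)
  assume no: "\<not> hits G l {v}"
  define p where "p = int l - 2"
  define a where "a i = adj G v (c i)" for i
  define b where "b i = adj G u (c i)" for i
  have p: "3 \<le> p" "p \<le> int M - 2" using l by (auto simp: p_def)
  have lp: "int l = p + 2" by (simp add: p_def)
  have perc: "c (i + int M) = c i" for i using ring_period[OF r] by blast
  have per: "a (i + int M) = a i" "b (i + int M) = b i" for i by (simp_all add: a_def b_def perc)
  have cA: "cnt M a \<ge> M div 2" using A unfolding a_def cnt_ring[OF r] .
  have cB: "cnt M b \<ge> M div 2" using B unfolding b_def cnt_ring[OF r] .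
  have "u \<noteq> v" using uv adj_neq[OF G] by blast
  note chords = not_hits_chords[OF r v l no] not_hits_chords(2,3)[OF r v l no u this uv]
  have noA: "\<not> (a i \<and> a (i + p))" for i using chords(1)[of i] by (simp add: a_def p_def)
  have noB: "\<not> (b i \<and> a (i + (p - 1)))" "\<not> (b i \<and> a (i - (p - 1)))" for i
    using chords(4,5)[of i] by (simp_all add: a_def b_def p_def)
  note H = half_interval[OF per M p cA cB noA noB]
  have "cnt M b = card {x \<in> range c. adj G u x}" unfolding b_def cnt_ring[OF r] ..
  then have E: "M\<^sup>2 div 4 + 2 \<le> card {e \<in> edges G. e \<subseteq> range c}" using E H(2) by simp
  obtain i0 where i0: "\<And>i. a i \<longleftrightarrow> (i - i0) mod int M \<in> {1..p - 1}" using H(3) by blast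
  have "hits G (nat p + 2) {v}"
  proof (rule hits_interval_nbrs[OF G ring_shift[OF r, of "i0 + 1"]])
    show "adj G v (c (i + (i0 + 1)))" if "0 \<le> i" "i \<le> int (nat p) - 2" for i
      using i0[of "i + (i0 + 1)"] that p by (simp add: a_def)
  qed (use v p H(1) E in \<open>auto simp: range_shift\<close>)
  moreover have "nat p + 2 = l" using lp p by linarith
  ultimately show False using no by simp
qed

section \<open>Degree sums along a Hamilton cycle\<close>

lemma mod_succ_int:
  fixes m n :: int
  assumes "n > 0" shows "(m + 1) mod n = (if m mod n = n - 1 then 0 else m mod n + 1)"
proof -
  have "0 \<le> m mod n" "m mod n < n" using assms by simp_all
  moreover have "(m + 1) mod n = (m mod n + 1) mod n" by (simp add: mod_simps)
  ultimately show ?thesis by (auto simp: mod_pos_pos_trivial)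
qed

lemma mod_pred_int:
  fixes m n :: int
  assumes "n > 0" shows "(m - 1) mod n = (if m mod n = 0 then n - 1 else m mod n - 1)"
proof -
  have "0 \<le> (m - 1) mod n" "(m - 1) mod n < n" "m mod n \<ge> 0" using assms by simp_all
  then show ?thesis using mod_succ_int[OF assms, of "m - 1"] by auto
qed

lemma ring_mem_image:
  assumes r: "ring G M c" and "0 \<le> s" "t < int M"
  shows "c m \<in> c ` {i + s..i + t} \<longleftrightarrow> s \<le> (m - i) mod int M \<and> (m - i) mod int M \<le> t"
proof
  assume "c m \<in> c ` {i + s..i + t}"
  then obtain x where x: "c m = c (i + x)" "s \<le> x" "x \<le> t"
  proof -
    from \<open>c m \<in> c ` {i + s..i + t}\<close> obtain y where y: "c m = c y" "i + s \<le> y" "y \<le> i + t" by auto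
    show ?thesis by (rule that[of "y - i"]) (use y in auto)
  qed
  then have "m mod int M = (i + x) mod int M"
    using ring_eq_iff[OF r] by blast
  then have "(m - i) mod int M = (i + x - i) mod int M" by (rule mod_diff_cong) simp
  then show "s \<le> (m - i) mod int M \<and> (m - i) mod int M \<le> t" using x assms by simp
next
  assume h: "s \<le> (m - i) mod int M \<and> (m - i) mod int M \<le> t"
  have "(i + (m - i) mod int M) mod int M = m mod int M" by (simp add: mod_simps)
  then have "c m = c (i + (m - i) mod int M)" using ring_eq_iff[OF r] by metis
  then show "c m \<in> c ` {i + s..i + t}" using h by auto
qed

lemma cedges_consecutive: "{x, y} \<in> cedges (us @ x # y # vs)"
proof -
  let ?xs = "us @ x # y # vs"
  have "{?xs ! length us, ?xs ! (Suc (length us) mod length ?xs)} \<in> cedges ?xs"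
    unfolding cycle_of_list_def by (simp only: snd_conv mem_Collect_eq) (intro exI[of _ "length us"], simp)
  moreover have "?xs ! (Suc (length us) mod length ?xs) = y" by (simp add: nth_append)
  ultimately show ?thesis by (simp add: nth_append)
qed

text \<open>The means of telling cycles apart: a pair of vertices at other indices is not an edge of
  the cycle.\<close>

lemma cedges_nth_iff:
  assumes "distinct xs" "{xs ! a, xs ! b} \<in> cedges xs" "a < b" "b < length xs"
  shows "b = Suc a \<or> a = 0 \<and> Suc b = length xs"
proof -
  obtain i where i: "i < length xs" "{xs ! a, xs ! b} = {xs ! i, xs ! (Suc i mod length xs)}"
    using assms(2) by (auto simp: cycle_of_list_def)
  have "Suc i mod length xs < length xs" using i(1) by (intro mod_less_divisor) linarith
  then have "(a = i \<and> b = Suc i mod length xs) \<or> (a = Suc i mod length xs \<and> b = i)"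
    using i assms by (auto simp: doubleton_eq_iff nth_eq_iff_index_eq)
  then show ?thesis using i(1) assms(3) by (cases "Suc i = length xs") auto
qed

lemma seg_split: "i \<le> j \<Longrightarrow> j \<le> k \<Longrightarrow> seg c i k = seg c i (j - 1) @ seg c j k"
  unfolding seg_def map_append[symmetric] by (rule arg_cong[of _ _ "map c"], rule upto_split1) auto

lemma seg_consecutive:
  assumes "i \<le> m" "m < j"
  shows "seg c i j = seg c i (m - 1) @ c m # c (m + 1) # seg c (m + 2) j"
proof -
  have "seg c i j = seg c i (m - 1) @ seg c m j" using assms by (intro seg_split) auto
  also have "seg c m j = c m # seg c (m + 1) j" using assms by (intro seg_Cons) auto
  also have "seg c (m + 1) j = c (m + 1) # seg c (m + 2) j" using assms seg_Cons[of "m + 1" j c] by (simp add: add.assoc)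
  finally show ?thesis .
qed

text \<open>The two chords from \<open>c i\<close> and \<open>c (i + 1)\<close> that close an \<open>l\<close>-cycle with parts of the Hamilton
  cycle: slot \<open>k\<close> uses the chords ending in \<open>c (i + k)\<close> and \<open>c (i + far n l k)\<close>.\<close>

definition far :: "int \<Rightarrow> int \<Rightarrow> int \<Rightarrow> int" where
  "far n l k = (if k \<le> n - l + 2 then k + l - 3 else k + l - n - 1)"

text \<open>For small \<open>k\<close> the ring edge at \<open>i\<close> is kept and joined by the
  two chords to a run of \<open>l - 2\<close> positions. For large \<open>k\<close> the chords
  cross: the ring edge at \<open>i\<close> is dropped and the second arc, ending in
  \<open>c (i + n) = c i\<close>, is traversed backward.\<close>

definition slot_cycle :: "(int \<Rightarrow> 'a) \<Rightarrow> int \<Rightarrow> int \<Rightarrow> int \<Rightarrow> int \<Rightarrow> 'a list" where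
  "slot_cycle c n l i k =
     (if k \<le> n - l + 2 then seg c i (i + 1) @ seg c (i + k) (i + far n l k)
      else seg c (i + 1) (i + far n l k) @ rev (seg c (i + k) (i + n)))"

definition slot :: "'a graph \<Rightarrow> (int \<Rightarrow> 'a) \<Rightarrow> int \<Rightarrow> int \<Rightarrow> int \<Rightarrow> int \<Rightarrow> bool" where
  "slot G c n l i k \<longleftrightarrow> 2 \<le> k \<and> k \<le> n - 1 \<and> adj G (c (i + 1)) (c (i + k)) \<and> adj G (c i) (c (i + far n l k))"

lemma far_bounds:
  assumes "5 \<le> l" "l < n" "2 \<le> k" "k \<le> n - 1"
  shows "2 \<le> far n l k" "far n l k \<le> n - 1" "k > n - l + 2 \<Longrightarrow> far n l k \<le> l - 2 \<and> far n l k < k - 1"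
    "k \<le> n - l + 2 \<Longrightarrow> k < far n l k"
  using assms by (auto simp: far_def)

lemma slot_cycle_cyc:
  assumes r: "ring G M c" and l: "5 \<le> l" "l < int M" and s: "slot G c (int M) l i k"
  shows "cyc G (slot_cycle c (int M) l i k)" "length (slot_cycle c (int M) l i k) = nat l"
proof -
  let ?n = "int M" and ?j = "far (int M) l k"
  have k: "2 \<le> k" "k \<le> ?n - 1" using s by (auto simp: slot_def)
  note j = far_bounds[OF l k]
  have cn: "c (i + ?n) = c i" by (rule ring_period[OF r])
  show "length (slot_cycle c ?n l i k) = nat l"
    using k j l by (auto simp: slot_cycle_def far_def)
  show "cyc G (slot_cycle c ?n l i k)"
  proof (cases "k \<le> ?n - l + 2")
    case True
    have "c ` {i..i + 1} \<inter> c ` {i + k..i + ?j} = {}" by (rule seg_disjoint[OF r]) (use k j in auto)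
    then have "cyc G (seg c i (i + 1) @ seg c (i + k) (i + ?j))"
      using s k j l True distinct_seg[OF r] successively_seg[OF r] adj_sym[of G "c i"]
      by (intro cyc_append) (auto simp: slot_def)
    then show ?thesis using True by (simp add: slot_cycle_def)
  next
    case False
    have "c ` {i + 1..i + ?j} \<inter> c ` {i + k..i + ?n} = {}"
      by (rule seg_disjoint[OF r]) (use k j False in auto)
    then have "cyc G (seg c (i + 1) (i + ?j) @ rev (seg c (i + k) (i + ?n)))"
      using s k j l False distinct_seg[OF r] successively_seg[OF r] adj_sym[of G "c i"] adj_sym[of G "c (i + 1)"] cn
      by (intro cyc_append) (auto simp: slot_def)
    then show ?thesis using False by (simp add: slot_cycle_def)
  qed
qed

section \<open>Recovering a slot from its cycle\<close>

context
  fixes G :: "'a graph" and c :: "int \<Rightarrow> 'a" and M :: nat and l :: int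
  assumes r: "ring G M c" and l: "5 \<le> l" "l < int M"
begin

text \<open>The base index \<open>i\<close> of a slot is read off its cycle as the unique position satisfying the first of
  these three predicates that holds anywhere.\<close>

definition gapped :: "'a graph \<Rightarrow> int \<Rightarrow> bool" where
  "gapped C m \<longleftrightarrow> c m \<in> verts C \<and> c (m + 1) \<in> verts C \<and> {c m, c (m + 1)} \<notin> edges C"

definition domino :: "'a graph \<Rightarrow> int \<Rightarrow> bool" where
  "domino C m \<longleftrightarrow> c m \<in> verts C \<and> c (m + 1) \<in> verts C \<and> c (m - 1) \<notin> verts C \<and> c (m + 2) \<notin> verts C"

definition start :: "'a graph \<Rightarrow> int \<Rightarrow> bool" where
  "start C m \<longleftrightarrow> c m \<in> verts C \<and> c (m - 1) \<notin> verts C"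

lemma mods:
  "0 \<le> (m - i) mod int M" "(m - i) mod int M < int M"
  "(m + 1 - i) mod int M = (if (m - i) mod int M = int M - 1 then 0 else (m - i) mod int M + 1)"
  "(m - 1 - i) mod int M = (if (m - i) mod int M = 0 then int M - 1 else (m - i) mod int M - 1)"
  "(m + 2 - i) mod int M = (if (m - i) mod int M = int M - 1 then 1 else if (m - i) mod int M = int M - 2 then 0 else (m - i) mod int M + 2)"
proof -
  have M: "int M > 2" using l by simp
  then show "0 \<le> (m - i) mod int M" "(m - i) mod int M < int M" by simp_all
  show 1: "(m + 1 - i) mod int M = (if (m - i) mod int M = int M - 1 then 0 else (m - i) mod int M + 1)" for m
    using mod_succ_int[of "int M" "m - i"] M by (simp add: algebra_simps)
  show "(m - 1 - i) mod int M = (if (m - i) mod int M = 0 then int M - 1 else (m - i) mod int M - 1)"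
    using mod_pred_int[of "int M" "m - i"] M by (simp add: algebra_simps)
  show "(m + 2 - i) mod int M = (if (m - i) mod int M = int M - 1 then 1 else if (m - i) mod int M = int M - 2 then 0 else (m - i) mod int M + 2)"
    using 1[of m] 1[of "m + 1"] M by (auto simp: add.commute)
qed

lemma verts_slot_near:
  assumes "2 \<le> k" "k \<le> int M - l + 2"
  shows "c m \<in> verts (cycle_of_list (slot_cycle c (int M) l i k)) \<longleftrightarrow>
    (m - i) mod int M \<le> 1 \<or> k \<le> (m - i) mod int M \<and> (m - i) mod int M \<le> k + l - 3"
proof -
  have "c m \<in> c ` {i + 0..i + 1} \<longleftrightarrow> 0 \<le> (m - i) mod int M \<and> (m - i) mod int M \<le> 1"
    by (rule ring_mem_image[OF r]) (use l in auto)
  moreover have "c m \<in> c ` {i + k..i + (k + l - 3)} \<longleftrightarrow> k \<le> (m - i) mod int M \<and> (m - i) mod int M \<le> k + l - 3"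
    by (rule ring_mem_image[OF r]) (use assms in auto)
  ultimately show ?thesis
    using assms mods(1)[of m i] by (simp add: cycle_of_list_def slot_cycle_def far_def add.assoc)
qed

lemma verts_slot_far:
  assumes "k > int M - l + 2" "k \<le> int M - 1"
  shows "c m \<in> verts (cycle_of_list (slot_cycle c (int M) l i k)) \<longleftrightarrow>
    (m - i) mod int M \<le> k + l - int M - 1 \<or> k \<le> (m - i) mod int M"
proof -
  let ?x = "(m - i) mod int M"
  have "c ` {i + k..i + int M} = insert (c i) (c ` {i + k..i + (int M - 1)})"
  proof -
    have "{i + k..i + int M} = insert (i + int M) {i + k..i + (int M - 1)}" using assms by auto
    then show ?thesis using ring_period[OF r, of i] by simp
  qed
  moreover have "c m \<in> c ` {i + 1..i + (k + l - int M - 1)} \<longleftrightarrow> 1 \<le> ?x \<and> ?x \<le> k + l - int M - 1"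
    by (rule ring_mem_image[OF r]) (use assms l in auto)
  moreover have "c m \<in> c ` {i + k..i + (int M - 1)} \<longleftrightarrow> k \<le> ?x \<and> ?x \<le> int M - 1"
    by (rule ring_mem_image[OF r]) (use assms l in auto)
  moreover have "c m = c i \<longleftrightarrow> ?x = 0"
    by (simp add: ring_eq_iff[OF r] mod_eq_dvd_iff dvd_eq_mod_eq_0)
  ultimately show ?thesis
    using assms mods(1,2)[of m i] by (auto simp: cycle_of_list_def slot_cycle_def far_def add.assoc)
qed

lemma ring_shift_rep: "\<exists>q. c m = c q \<and> c (m + 1) = c (q + 1) \<and> q = i + (m - i) mod int M"
proof -
  let ?q = "i + (m - i) mod int M"
  have 1: "?q mod int M = m mod int M" by (simp add: mod_simps)
  then have "(?q + 1) mod int M = (m + 1) mod int M" by (intro mod_add_cong) simp_all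
  then have "c m = c ?q" "c (m + 1) = c (?q + 1)"
    using ring_eq_iff[OF r, of m ?q] ring_eq_iff[OF r, of "m + 1" "?q + 1"] 1 by simp_all
  then show ?thesis by blast
qed

text \<open>For these \<open>k\<close> position \<open>i - 1\<close> is off the cycle, so no run of
  positions wraps around. Every run is traversed edge by edge; for \<open>k = 2\<close> both runs
  merge, and the chord between them is a ring edge.\<close>

lemma slot_near_not_gapped:
  assumes "2 \<le> k" "k < int M - l + 2"
  shows "\<not> gapped (cycle_of_list (slot_cycle c (int M) l i k)) m"
proof
  let ?C = "cycle_of_list (slot_cycle c (int M) l i k)"
  let ?x = "(m - i) mod int M"
  assume g: "gapped ?C m"
  obtain q where q: "c m = c q" "c (m + 1) = c (q + 1)" "q = i + ?x" using ring_shift_rep by blast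
  have "?x = 0 \<or> ?x = 1 \<and> k = 2 \<or> k \<le> ?x \<and> ?x < k + l - 3"
  proof -
    have k: "2 \<le> k" "k \<le> int M - l + 2" using assms by simp_all
    obtain x where x: "?x = x" by simp
    show ?thesis
      using g assms l mods(1,2)[of m i]
      unfolding gapped_def verts_slot_near[OF k] mods(3) x by (auto split: if_splits)
  qed
  moreover have False if "?x = 0"
    using that g q assms cedges_consecutive[of "c q" "c (q + 1)" "[]" "seg c (i + k) (i + far (int M) l k)"]
    by (simp add: gapped_def slot_cycle_def seg_def upto.simps)
  moreover have False if x: "?x = 1 \<and> k = 2"
  proof -
    have "seg c i (i + 1) = [c i, c (i + 1)]" by (simp add: seg_def upto.simps)
    moreover have "seg c (i + 2) (i + far (int M) l k) = c (i + 2) # seg c (i + 3) (i + far (int M) l k)"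
      using x l seg_Cons[of "i + 2" "i + far (int M) l k" c] by (simp add: far_def add.assoc)
    ultimately have "slot_cycle c (int M) l i k = [c i] @ c (i + 1) # c (i + 2) # seg c (i + 3) (i + far (int M) l k)"
      using x l by (simp add: slot_cycle_def)
    moreover have "c m = c (i + 1)" "c (m + 1) = c (i + 2)" using q x by (simp_all add: add.commute)
    ultimately show False using g cedges_consecutive unfolding gapped_def by metis
  qed
  moreover have False if "k \<le> ?x \<and> ?x < k + l - 3"
    using that g q assms
      cedges_consecutive[of "c q" "c (q + 1)" "seg c i (i + 1) @ seg c (i + k) (q - 1)" "seg c (q + 2) (i + far (int M) l k)"]
      seg_consecutive[of "i + k" q "i + far (int M) l k" c]
    by (simp add: gapped_def slot_cycle_def far_def)
  ultimately show False by (elim disjE) simp_all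
qed

text \<open>\<open>c i\<close> and \<open>c (i + 1)\<close> are the initial vertices of two
  different arcs. Any other two successive positions on the cycle lie in one arc, because a position
  is missing between \<open>far\<close> and \<open>k\<close>.\<close>

lemma slot_far_gapped:
  assumes "int M - l + 2 < k" "k \<le> int M - 1"
  shows "gapped (cycle_of_list (slot_cycle c (int M) l i k)) m \<longleftrightarrow> (m - i) mod int M = 0"
proof
  let ?j = "far (int M) l k"
  let ?Z = "slot_cycle c (int M) l i k"
  let ?C = "cycle_of_list ?Z"
  let ?x = "(m - i) mod int M"
  obtain q where q: "c m = c q" "c (m + 1) = c (q + 1)" "q = i + ?x" using ring_shift_rep by blast
  have Z: "?Z = seg c (i + 1) (i + ?j) @ rev (seg c (i + k) (i + int M))" using assms by (simp add: slot_cycle_def)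
  have j: "2 \<le> ?j" "?j \<le> l - 2" "?j < k" using far_bounds[of l "int M" k] l assms by auto
  {
    assume g: "gapped ?C m"
    have "?x = 0 \<or> 1 \<le> ?x \<and> ?x < ?j \<or> k \<le> ?x"
    proof -
      obtain x where x: "?x = x" by simp
      show ?thesis
        using g assms l mods(1,2)[of m i]
        unfolding gapped_def verts_slot_far[OF assms] mods(3) x far_def by (auto split: if_splits)
    qed
    moreover have False if "1 \<le> ?x \<and> ?x < ?j"
      using that g q Z
        cedges_consecutive[of "c q" "c (q + 1)" "seg c (i + 1) (q - 1)" "seg c (q + 2) (i + ?j) @ rev (seg c (i + k) (i + int M))"]
        seg_consecutive[of "i + 1" q "i + ?j" c]
      by (simp add: gapped_def)
    moreover have False if "k \<le> ?x"
      using that g q Z mods(2)[of m i]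
        cedges_consecutive[of "c (q + 1)" "c q" "seg c (i + 1) (i + ?j) @ rev (seg c (q + 2) (i + int M))" "rev (seg c (i + k) (q - 1))"]
        seg_consecutive[of "i + k" q "i + int M" c]
      by (simp add: gapped_def insert_commute)
    ultimately show "?x = 0" by blast
  }
  {
    assume x: "?x = 0"
    have d: "distinct ?Z"
    proof -
      have "c ` {i + 1..i + ?j} \<inter> c ` {i + k..i + int M} = {}"
        by (rule seg_disjoint[OF r]) (use j assms in auto)
      then show ?thesis using Z distinct_seg[OF r] j assms by auto
    qed
    have len: "length ?Z = nat l" using Z j assms by (auto simp: far_def)
    \<comment> \<open>\<open>c i\<close> opens the reversed arc, at an index which is neither
      \<open>1\<close> nor the last one.\<close>
    have "?Z ! nat ?j = c i"
      using Z j assms ring_period[OF r, of i] by (simp add: nth_append rev_nth nth_seg far_def)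
    moreover have "?Z ! 0 = c (i + 1)" using Z j by (simp add: nth_append nth_seg)
    ultimately have "{c i, c (i + 1)} \<notin> edges ?C"
      using cedges_nth_iff[OF d, of 0 "nat ?j"] j len by (auto simp: insert_commute)
    moreover have "c m = c i" "c (m + 1) = c (i + 1)" using x q by simp_all
    moreover have "c i \<in> verts ?C" "c (i + 1) \<in> verts ?C"
      using verts_slot_far[OF assms] j assms l by (simp_all add: far_def)
    ultimately show "gapped ?C m" by (simp add: gapped_def)
  }
qed

text \<open>The run at \<open>i\<close> has two positions, the other one \<open>l - 2\<close>, which
  is at least three.\<close>

lemma slot_near_domino:
  assumes "2 < k" "k < int M - l + 2"
  shows "domino (cycle_of_list (slot_cycle c (int M) l i k)) m \<longleftrightarrow> (m - i) mod int M = 0"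
proof -
  have k: "2 \<le> k" "k \<le> int M - l + 2" using assms by simp_all
  obtain x where x: "(m - i) mod int M = x" by simp
  show ?thesis
    using assms l mods(1,2)[of m i] unfolding domino_def verts_slot_near[OF k] mods(3-5) x
    by (auto split: if_splits)
qed

lemma slot_two_domino:
  "\<not> domino (cycle_of_list (slot_cycle c (int M) l i 2)) m"
proof -
  have k: "2 \<le> (2::int)" "2 \<le> int M - l + 2" using l by simp_all
  obtain x where x: "(m - i) mod int M = x" by simp
  show ?thesis
    using l mods(1,2)[of m i] unfolding domino_def verts_slot_near[OF k] mods(3-5) x
    by (auto split: if_splits)
qed

lemma slot_two_start:
  "start (cycle_of_list (slot_cycle c (int M) l i 2)) m \<longleftrightarrow> (m - i) mod int M = 0"
proof -
  have k: "2 \<le> (2::int)" "2 \<le> int M - l + 2" using l by simp_all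
  obtain x where x: "(m - i) mod int M = x" by simp
  show ?thesis
    using l mods(1,2)[of m i] unfolding start_def verts_slot_near[OF k] mods(3-5) x
    by (auto split: if_splits)
qed

text \<open>Here \<open>far\<close> is \<open>int M - 1\<close>, and the cycle occupies a single run
  from \<open>i + k\<close> around to \<open>i + 1\<close>.\<close>

lemma slot_last_start:
  "start (cycle_of_list (slot_cycle c (int M) l i (int M - l + 2))) m \<longleftrightarrow> (m - i) mod int M = int M - l + 2"
proof -
  have k: "2 \<le> int M - l + 2" "int M - l + 2 \<le> int M - l + 2" using l by simp_all
  obtain x where x: "(m - i) mod int M = x" by simp
  show ?thesis
    using l mods(1,2)[of m i] unfolding start_def verts_slot_near[OF k] mods(3-5) x
    by (auto split: if_splits)
qed

text \<open>Cycles with a single chord arise from two slots, one of them with \<open>k = int M - l + 2\<close>; separating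
  that value of \<open>k\<close> makes the map from slots to cycles injective on each part.\<close>

definition slots :: "bool \<Rightarrow> (int \<times> int) set" where
  "slots b = {(i, k). 0 \<le> i \<and> i < int M \<and> slot G c (int M) l i k \<and> (k = int M - l + 2 \<longleftrightarrow> b)}"

lemma slots_inj_base:
  assumes "(i, k) \<in> slots b" "(i', k') \<in> slots b"
    and eq: "cycle_of_list (slot_cycle c (int M) l i k) = cycle_of_list (slot_cycle c (int M) l i' k')"
  shows "i = i' \<and> k = k'"
proof -
  let ?C = "cycle_of_list (slot_cycle c (int M) l i k)"
  let ?K = "int M - l + 2"
  have k: "2 \<le> k" "k \<le> int M - 1" "2 \<le> k'" "k' \<le> int M - 1" "0 \<le> i" "i < int M" "0 \<le> i'" "i' < int M"
    "k = ?K \<longleftrightarrow> b" "k' = ?K \<longleftrightarrow> b"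
    using assms by (auto simp: slots_def slot_def)
  have "(i - i') mod int M = 0 \<and> (?K < k \<longleftrightarrow> ?K < k') \<and> (k = 2 \<longleftrightarrow> k' = 2)"
  proof (cases b)
    case True
    have "start ?C (i + ?K)" using True k l by (simp add: slot_last_start)
    then have "(i + ?K - i') mod int M = ?K" using True k eq slot_last_start[of i' "i + ?K"] by simp
    moreover have "?K mod int M = ?K" using l by (intro mod_pos_pos_trivial) auto
    ultimately have "(i + ?K - i') mod int M = ?K mod int M" by (simp only:)
    then have "int M dvd i + ?K - i' - ?K" by (simp only: mod_eq_dvd_iff)
    then have "(i - i') mod int M = 0" by (simp add: algebra_simps dvd_eq_mod_eq_0)
    then show ?thesis using True k by simp
  next
    case False
    consider "?K < k" | "2 < k" "k < ?K" | "k = 2" using k False by linarith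
    then show ?thesis
    proof cases
      case 1
      then have "gapped ?C i" using k by (simp add: slot_far_gapped)
      then have "\<not> k' < ?K" using eq slot_near_not_gapped[of k' i' i] k by auto
      then have "?K < k'" using k False by simp
      then show ?thesis using 1 k l eq \<open>gapped ?C i\<close> slot_far_gapped[of k' i' i] by simp
    next
      case 2
      then have d: "domino ?C i" using k by (simp add: slot_near_domino)
      have "\<not> gapped ?C i'" using 2 k slot_near_not_gapped by blast
      then have "\<not> ?K < k'" using eq slot_far_gapped[of k' i' i'] k by auto
      moreover have "k' \<noteq> 2" using d eq slot_two_domino[of i' i] by auto
      ultimately have "2 < k'" "k' < ?K" using k False by simp_all
      then show ?thesis using 2 d eq slot_near_domino[of k' i' i] by simp
    next
      case 3
      have "\<not> gapped ?C i'" using 3 l slot_near_not_gapped[of 2] by auto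
      then have a: "\<not> ?K < k'" using eq slot_far_gapped[of k' i' i'] k by auto
      have "\<not> domino ?C i'" using 3 slot_two_domino by auto
      then have "\<not> (2 < k' \<and> k' < ?K)" using eq slot_near_domino[of k' i' i'] by auto
      then have k2: "k' = 2" using a k False by linarith
      have "start ?C i" using 3 slot_two_start[of i i] by simp
      then show ?thesis using eq 3 k2 slot_two_start[of i' i] l by simp
    qed
  qed
  then have *: "int M dvd i - i'" "?K < k \<longleftrightarrow> ?K < k'" "k = 2 \<longleftrightarrow> k' = 2" by auto
  have i: "i = i'"
  proof (rule ccontr)
    assume "i \<noteq> i'"
    then show False using *(1) k dvd_imp_le_int[of "i - i'" "int M"] by auto
  qed
  have V: "c m \<in> verts ?C \<longleftrightarrow> c m \<in> verts (cycle_of_list (slot_cycle c (int M) l i k'))" for m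
    using eq i by simp
  have x: "(i + x - i) mod int M = x" if "0 \<le> x" "x < int M" for x using that by simp
  have "k = k'"
  proof (cases "?K < k")
    case True
    then have k': "?K < k'" using * by simp
    have W: "(x \<le> k + l - int M - 1 \<or> k \<le> x) = (x \<le> k' + l - int M - 1 \<or> k' \<le> x)"
      if "0 \<le> x" "x < int M" for x
      using V[of "i + x"] x[OF that] by (simp only: verts_slot_far[OF True k(2)] verts_slot_far[OF k' k(4)])
    show ?thesis
    proof (cases k k' rule: linorder_cases)
      case less then show ?thesis using W[of k] W[of "k' - 1"] k l by auto
    next
      case greater then show ?thesis using W[of k'] W[of "k - 1"] k l by auto
    qed
  next
    case False
    then have k': "k \<le> ?K" "k' \<le> ?K" using * by simp_all
    have W: "(x \<le> 1 \<or> k \<le> x \<and> x \<le> k + l - 3) = (x \<le> 1 \<or> k' \<le> x \<and> x \<le> k' + l - 3)"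
      if "0 \<le> x" "x < int M" for x
      using V[of "i + x"] x[OF that]
      by (simp only: verts_slot_near[OF k(1) k'(1)] verts_slot_near[OF k(3) k'(2)])
    show ?thesis
    proof (cases k k' rule: linorder_cases)
      case less then show ?thesis using W[of k] k l * by auto
    next
      case greater then show ?thesis using W[of k'] k l * by auto
    qed
  qed
  then show ?thesis using i by blast
qed

lemma card_slots_le:
  assumes "simple_graph G"
  shows "card (slots b) \<le> num_cycles (nat l) G"
proof -
  let ?f = "\<lambda>(i, k). slot_cycle c (int M) l i k"
  have "inj_on (\<lambda>p. cycle_of_list (?f p)) (slots b)"
    using slots_inj_base by (fastforce simp: inj_on_def)
  then have "card (slots b) = card (cycle_of_list ` ?f ` slots b)"
    by (simp add: card_image image_image)
  also have "\<dots> \<le> num_cycles (nat l) G"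
    by (rule num_cycles_ge[OF assms])
      (use l slot_cycle_cyc[OF r l] in \<open>auto simp: slots_def\<close>)
  finally show ?thesis .
qed

text \<open>Either class of slots maps injectively to cycles, whence the factor two.\<close>

lemma sum_slots_le:
  assumes "simple_graph G"
  shows "(\<Sum>i\<in>{0..<int M}. card {k. slot G c (int M) l i k}) \<le> 2 * num_cycles (nat l) G"
proof -
  have fin: "finite {k. slot G c (int M) l i k}" for i
    by (rule finite_subset[of _ "{2..int M - 1}"]) (auto simp: slot_def)
  have "(\<Sum>i\<in>{0..<int M}. card {k. slot G c (int M) l i k}) = card (SIGMA i : {0..<int M}. {k. slot G c (int M) l i k})"
    using fin by (intro card_SigmaI[symmetric]) auto
  also have "(SIGMA i : {0..<int M}. {k. slot G c (int M) l i k}) = slots True \<union> slots False"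
    by (auto simp: slots_def)
  also have "card \<dots> \<le> card (slots True) + card (slots False)" by (rule card_Un_le)
  finally show ?thesis using card_slots_le[OF assms, of True] card_slots_le[OF assms, of False] by linarith
qed

end

lemma deg_cnt:
  assumes "simple_graph G" "hamc G c"
  shows "deg G x = cnt (card (verts G)) (\<lambda>k. adj G x (c (s + k)))"
proof -
  let ?n = "card (verts G)"
  have r: "ring G ?n c" and R: "range c = verts G" using assms by (auto simp: hamc_def)
  have "nbrs G x = {y \<in> range c. adj G x y}" using R assms(1) by (auto simp: nbrs_def dest: adj_verts)
  then have "deg G x = cnt ?n (\<lambda>k. adj G x (c k))" by (simp add: deg_def cnt_ring[OF r])
  also have "\<dots> = cnt ?n (\<lambda>k. adj G x (c (k + s)))"
    by (rule cnt_shift[symmetric]) (simp add: ring_period[OF r])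
  finally show ?thesis by (simp add: add.commute)
qed

text \<open>Pigeonhole: \<open>far\<close> permutes the \<open>n - 2\<close> values of
  \<open>k\<close>, so the chords at \<open>c (i + 1)\<close> and those at \<open>c i\<close> are
  two sets of values of \<open>k\<close>, and their intersection consists of slots. The ring edge
  between the two vertices accounts for one neighbour of each.\<close>

lemma slots_per_edge:
  assumes G: "simple_graph G" and h: "hamc G c" and l: "5 \<le> l" "l < int (card (verts G))"
  shows "deg G (c i) + deg G (c (i + 1)) \<le> card (verts G) + card {k. slot G c (int (card (verts G))) l i k}"
proof -
  let ?n = "card (verts G)"
  let ?U = "{2..int ?n - 1}"
  have r: "ring G ?n c" using h by (simp add: hamc_def)
  define A where "A = {k \<in> ?U. adj G (c (i + 1)) (c (i + k))}"
  define B where "B = {j \<in> ?U. adj G (c i) (c (i + j))}"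
  define B' where "B' = {k \<in> ?U. adj G (c i) (c (i + far (int ?n) l k))}"
  have fin: "finite A" "finite B" "finite B'"
    by (rule finite_subset[of _ ?U]; auto simp: A_def B_def B'_def)+
  have n: "int ?n > 5" using l by simp
  have "deg G (c (i + 1)) \<le> card (insert 0 A)"
  proof -
    have "k = 0 \<or> k \<ge> 2" if "0 \<le> k" "adj G (c (i + 1)) (c (i + k))" for k
    proof -
      have "k \<noteq> 1" using that(2) adj_neq[OF G] by blast
      then show ?thesis using that(1) by linarith
    qed
    then show ?thesis unfolding deg_cnt[OF G h, of _ i] cnt_def A_def
      by (intro card_mono finite.insertI fin(1)[unfolded A_def]) auto
  qed
  then have A: "deg G (c (i + 1)) \<le> card A + 1" using fin(1) by (simp add: card_insert_if split: if_splits)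
  have "deg G (c i) \<le> card (insert 1 B)"
  proof -
    have "k = 1 \<or> k \<ge> 2" if "0 \<le> k" "adj G (c i) (c (i + k))" for k
    proof -
      have "k \<noteq> 0" using that(2) adj_neq[OF G] by fastforce
      then show ?thesis using that(1) by linarith
    qed
    then show ?thesis unfolding deg_cnt[OF G h, of _ i] cnt_def B_def
      by (intro card_mono finite.insertI fin(2)[unfolded B_def]) auto
  qed
  then have B: "deg G (c i) \<le> card B + 1" using fin(2) by (simp add: card_insert_if split: if_splits)
  have "card B \<le> card (far (int ?n) l ` B')"
  proof (rule card_mono)
    show "B \<subseteq> far (int ?n) l ` B'"
    proof
      fix j assume j: "j \<in> B"
      \<comment> \<open>The inverse image of \<open>j\<close> under \<open>far\<close>.\<close>
      define k where "k = (if j \<ge> l - 1 then j - l + 3 else j - l + int ?n + 1)"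
      have "far (int ?n) l k = j" "k \<in> ?U" using j l by (auto simp: far_def k_def B_def)
      then show "j \<in> far (int ?n) l ` B'" using j unfolding B_def B'_def by force
    qed
  qed (use fin in simp)
  also have "\<dots> \<le> card B'" by (rule card_image_le) (rule fin)
  finally have B': "card B \<le> card B'" .
  have "card A + card B' = card (A \<union> B') + card (A \<inter> B')" using fin(1,3) by (rule card_Un_Int)
  moreover have "card (A \<union> B') \<le> card ?U" by (rule card_mono) (auto simp: A_def B'_def)
  moreover have "card ?U = ?n - 2" using n by simp
  moreover have "A \<inter> B' = {k. slot G c (int ?n) l i k}" by (auto simp: A_def B'_def slot_def)
  ultimately show ?thesis using A B B' n by simp
qed

text \<open>Truncated subtraction: edges of small degree sum contribute \<open>0\<close>.\<close>

lemma sum_excess_le: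
  assumes G: "simple_graph G" and h: "hamc G c" and l: "5 \<le> l" "l < card (verts G)"
  shows "(\<Sum>i\<in>{0..<int (card (verts G))}. deg G (c i) + deg G (c (i + 1)) - card (verts G)) \<le> 2 * num_cycles l G"
proof -
  let ?n = "card (verts G)"
  have r: "ring G ?n c" using h by (simp add: hamc_def)
  have "(\<Sum>i\<in>{0..<int ?n}. deg G (c i) + deg G (c (i + 1)) - ?n)
      \<le> (\<Sum>i\<in>{0..<int ?n}. card {k. slot G c (int ?n) (int l) i k})"
  proof (rule sum_mono)
    fix i show "deg G (c i) + deg G (c (i + 1)) - ?n \<le> card {k. slot G c (int ?n) (int l) i k}"
      using slots_per_edge[OF G h, of "int l" i] l by simp
  qed
  also have "\<dots> \<le> 2 * num_cycles l G"
    using sum_slots_le[OF r, of "int l"] G l by simp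
  finally show ?thesis .
qed

section \<open>A second Hamilton cycle\<close>

lemma even_card_involution:
  assumes "finite S" "\<And>x. x \<in> S \<Longrightarrow> f x \<in> S" "\<And>x. x \<in> S \<Longrightarrow> f (f x) = x" "\<And>x. x \<in> S \<Longrightarrow> f x \<noteq> x"
  shows "even (card S)"
  using assms
proof (induction "card S" arbitrary: S rule: less_induct)
  case less
  show ?case
  proof (cases "S = {}")
    case False
    then obtain x where x: "x \<in> S" by blast
    let ?T = "S - {x, f x}"
    have "card {x, f x} = 2" using x less.prems(4)[OF x] by simp
    then have c: "card S = card ?T + 2"
      using x less.prems card_Diff_subset[of "{x, f x}" S] card_mono[of S "{x, f x}"] by simp
    have "even (card ?T)"
    proof (rule less.hyps)
      show "card ?T < card S" using c by simp
      show "f y \<in> ?T" if "y \<in> ?T" for y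
        using that less.prems(2,3) x by (metis Diff_iff insert_iff singletonD)
    qed (use less.prems in auto)
    then show ?thesis using c by simp
  qed simp
qed

text \<open>Thomason's lollipop argument: reversing the tail of a Hamilton path behind a neighbour of its
  last vertex pairs up the Hamilton paths, and the unpaired ones close up to Hamilton cycles.\<close>

lemma second_hamilton_path:
  fixes B :: "'a \<Rightarrow> 'a \<Rightarrow> bool"
  assumes sym: "\<And>x y. B x y \<Longrightarrow> B y x" and bip: "\<And>x y. B x y \<Longrightarrow> x \<in> U \<longleftrightarrow> y \<notin> U"
    and V: "finite V" and three: "\<And>x. x \<in> V \<Longrightarrow> x \<in> U \<Longrightarrow> card {y \<in> V. B x y} = 3"
    and H: "distinct H" "set H = V" "successively B H" "B (last H) (hd H)" "hd H \<notin> U"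
    and n: "even (length H)" "4 \<le> length H"
  obtains P where "P \<noteq> H" "distinct P" "set P = V" "successively B P" "B (last P) (hd P)" "P ! 0 = H ! 0" "P ! 1 = H ! 1"
proof -
  define n where "n = length H"
  have n': "even n" "4 \<le> n" using n by (simp_all add: n_def)
  define \<P> where "\<P> = {P. distinct P \<and> set P = V \<and> successively B P \<and> P ! 0 = H ! 0 \<and> P ! 1 = H ! 1}"
  have len: "length P = n" if "P \<in> \<P>" for P
    using that H by (simp add: \<P>_def n_def distinct_card[symmetric])
  have fin: "finite \<P>"
    by (rule finite_subset[OF _ finite_lists_length_eq[OF V, of n]]) (use len in \<open>auto simp: \<P>_def\<close>)
  have par: "P ! i \<in> U \<longleftrightarrow> odd i" if "P \<in> \<P>" "i < n" for P i
    using that(2)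
  proof (induction i)
    case 0
    then show ?case using that H n' by (simp add: \<P>_def hd_conv_nth n_def[symmetric]) (metis hd_conv_nth list.size(3) n_def not_numeral_le_zero)
  next
    case (Suc i)
    have "B (P ! i) (P ! Suc i)" using that Suc.prems len[OF that(1)] by (simp add: \<P>_def successively_nth)
    then show ?case using Suc bip by auto
  qed
  \<comment> \<open>Reversal behind position \<open>0\<close> would change the second vertex, so
    this neighbour is recorded by \<open>clo\<close>; reversal behind \<open>n - 2\<close> would
    return the same path.\<close>
  define piv where "piv P = {i \<in> {1..n - 3}. B (last P) (P ! i)}" for P
  define clo where "clo P \<longleftrightarrow> B (last P) (P ! 0)" for P
  have last: "last P = P ! (n - 1)" if "P \<in> \<P>" for P
    using len[OF that] n' by (metis last_conv_nth list.size(3) not_numeral_le_zero)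
  \<comment> \<open>The last position is odd, so the last vertex lies in \<open>U\<close>. Besides
    its predecessor it has two neighbours, each of them a pivot or the first vertex.\<close>
  have deg: "card (piv P) + (if clo P then 1 else 0) = 2" if P: "P \<in> \<P>" for P
  proof -
    have D: "distinct P" "set P = V" "successively B P" using P by (auto simp: \<P>_def)
    have lV: "last P \<in> V" "last P \<in> U"
      using par[OF P, of "n - 1"] last[OF P] n' D len[OF P] by (auto intro!: nth_mem)
    let ?J = "{j. j < n \<and> B (last P) (P ! j)}"
    have "{y \<in> V. B (last P) y} = (!) P ` ?J"
      using D len[OF P] by (force simp: set_conv_nth)
    moreover have "inj_on ((!) P) ?J"
      using D len[OF P] by (auto simp: inj_on_def nth_eq_iff_index_eq)
    ultimately have c3: "card ?J = 3" using three[OF lV] by (simp add: card_image)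
    have "B (P ! (n - 2)) (P ! Suc (n - 2))"
      using D(3) len[OF P] n' by (simp add: successively_nth)
    moreover have "Suc (n - 2) = n - 1" using n' by simp
    ultimately have "B (last P) (P ! (n - 2))" using sym last[OF P] by simp
    moreover have "\<not> B (last P) (P ! (n - 1))" using last[OF P] bip by metis
    moreover have "j = 0 \<or> j \<in> {1..n - 3} \<or> j = n - 2 \<or> j = n - 1" if "j < n" for j
      using that by auto
    ultimately have "?J = insert (n - 2) (piv P \<union> (if clo P then {0} else {}))"
      using n' by (auto simp: piv_def clo_def)
    moreover have "finite (piv P)" "0 \<notin> piv P" "n - 2 \<notin> piv P" using n' by (auto simp: piv_def)
    ultimately have "card ?J = Suc (card (piv P) + (if clo P then 1 else 0))"
      using n' by auto
    then show ?thesis using c3 by simp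
  qed
  define S where "S = Sigma \<P> piv"
  \<comment> \<open>After the reversal the last vertex is \<open>P ! Suc i\<close>, a neighbour of
    \<open>P ! i\<close>; so \<open>i\<close> is again a pivot and undoes the step.\<close>
  define flip where "flip = (\<lambda>(P :: 'a list, i). (take (Suc i) P @ rev (drop (Suc i) P), i))"
  have S: "finite S" unfolding S_def using fin by (auto simp: piv_def)
  have flip: "flip x \<in> S \<and> flip (flip x) = x \<and> flip x \<noteq> x" if xS: "x \<in> S" for x
  proof -
    obtain P i where x: "x = (P, i)" "P \<in> \<P>" "1 \<le> i" "i \<le> n - 3" "B (last P) (P ! i)"
      using xS by (auto simp: S_def piv_def)
    let ?Q = "take (Suc i) P @ rev (drop (Suc i) P)"
    have lP: "length P = n" by (rule len[OF x(2)])
    have i: "Suc i < n" using x n' by simp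
    have D: "distinct P" "set P = V" "successively B P" "P ! 0 = H ! 0" "P ! 1 = H ! 1"
      using x(2) by (auto simp: \<P>_def)
    have sw: "(\<lambda>x y. B y x) = B" using sym by blast
    have PP: "P = take (Suc i) P @ drop (Suc i) P" by simp
    have sc: "successively B (take (Suc i) P)" "successively B (drop (Suc i) P)"
      using D(3) PP by (metis successively_append_iff)+
    have l1: "last (take (Suc i) P) = P ! i" using i lP by (simp add: take_Suc_conv_app_nth)
    have ne: "drop (Suc i) P \<noteq> []" using i lP by simp
    have hd: "hd (rev (drop (Suc i) P)) = last P" using ne by (simp add: hd_rev)
    have "successively B ?Q"
      using sc l1 hd sym[OF x(5)] by (simp only: successively_append_iff successively_rev sw) simp
    moreover have "distinct ?Q"
      using D(1) by (metis PP distinct_append distinct_rev set_rev)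
    moreover have "set ?Q = V" using D(2) by (metis PP set_append set_rev)
    moreover have "?Q ! 0 = H ! 0" "?Q ! 1 = H ! 1"
      using D(4,5) i lP x(3) by (auto simp: nth_append)
    ultimately have Q: "?Q \<in> \<P>" by (simp add: \<P>_def)
    have lQ: "last ?Q = P ! Suc i" using ne i lP by (simp add: last_rev hd_drop_conv_nth)
    have "B (P ! i) (P ! Suc i)" using D(3) i lP by (simp add: successively_nth)
    moreover have "?Q ! i = P ! i" using i lP by (simp add: nth_append)
    ultimately have "B (last ?Q) (?Q ! i)" using sym lQ by simp
    then have "i \<in> piv ?Q" using x by (simp add: piv_def)
    then have 1: "flip x \<in> S" using x Q by (simp add: flip_def S_def)
    have 2: "flip (flip x) = x" using x i lP by (simp add: flip_def min_def)
    have "P ! Suc i \<noteq> P ! (n - 1)" using D(1) i lP x(4) n' by (simp add: nth_eq_iff_index_eq)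
    then have "?Q \<noteq> P" using lQ last[OF x(2)] by metis
    then have 3: "flip x \<noteq> x" using x by (simp add: flip_def)
    show ?thesis using 1 2 3 by blast
  qed
  have "even (card S)" by (rule even_card_involution[OF S, of flip]) (use flip in blast)+
  moreover have "card S = (\<Sum>P\<in>\<P>. card (piv P))" unfolding S_def using fin by (intro card_SigmaI) (auto simp: piv_def)
  \<comment> \<open>The pivots are even in number, hence so are the closing paths, and
    \<open>H\<close> cannot be the only one.\<close>
  moreover have "(\<Sum>P\<in>\<P>. card (piv P)) + card {P \<in> \<P>. clo P} = 2 * card \<P>"
  proof -
    have "(\<Sum>P\<in>\<P>. card (piv P)) + (\<Sum>P\<in>\<P>. if clo P then 1 else 0) = (\<Sum>P\<in>\<P>. 2)"
      unfolding sum.distrib[symmetric] by (rule sum.cong) (use deg in auto)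
    moreover have "(\<Sum>P\<in>\<P>. if clo P then 1 else 0) = card {P \<in> \<P>. clo P}"
      using fin by (simp add: sum.If_cases Int_def)
    ultimately show ?thesis by simp
  qed
  ultimately have ev: "even (card {P \<in> \<P>. clo P})" by (metis dvd_add_right_iff dvd_triv_left)
  have HP: "H \<in> {P \<in> \<P>. clo P}"
    using H n' by (simp add: \<P>_def clo_def) (metis hd_conv_nth list.size(3) n_def not_numeral_le_zero)
  have "{P \<in> \<P>. clo P} \<noteq> {H}" using ev by (metis card_1_singleton_iff One_nat_def odd_one)
  then obtain P where P: "P \<in> \<P>" "clo P" "P \<noteq> H" using HP by blast
  have "P ! 0 = hd P" using len[OF P(1)] n' by (metis hd_conv_nth list.size(3) not_numeral_le_zero)
  then show ?thesis using that[of P] P by (auto simp: \<P>_def clo_def)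
qed

text \<open>After two successive vertices a cycle can be continued in only one way. This turns
  different Hamilton paths into different cycles.\<close>

lemma cyc_eq_of_first_two:
  assumes P: "distinct P" and Q: "distinct Q" "length Q = length P"
    and eq: "cedges P = cedges Q" "P ! 0 = Q ! 0" "P ! 1 = Q ! 1" and s: "set P = set Q"
  shows "P = Q"
proof (rule nth_equalityI)
  have "Suc i < length P \<longrightarrow> P ! i = Q ! i \<and> P ! Suc i = Q ! Suc i" for i
  proof (induction i)
    case (Suc i)
    show ?case
    proof
      assume i: "Suc (Suc i) < length P"
      then have IH: "P ! i = Q ! i" "P ! Suc i = Q ! Suc i" using Suc by auto
      have "P ! Suc (Suc i) \<in> set Q" using i s by (metis nth_mem)
      then obtain j where j: "j < length Q" "Q ! j = P ! Suc (Suc i)" by (metis in_set_conv_nth)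
      have "{P ! Suc i, P ! (Suc (Suc i) mod length P)} \<in> cedges P"
        unfolding cycle_of_list_def using i by (simp only: snd_conv mem_Collect_eq) (intro exI[of _ "Suc i"], simp)
      then have e: "{Q ! Suc i, Q ! j} \<in> cedges Q" using i IH j eq(1) by simp
      have "j \<noteq> i" using IH j P i by (metis Suc_n_not_le_n le_SucI less_or_eq_imp_le nth_eq_iff_index_eq Suc_lessD)
      moreover have "j \<noteq> Suc i" using IH j P i by (metis Suc_lessD n_not_Suc_n nth_eq_iff_index_eq)
      ultimately have "j = Suc (Suc i)"
        using cedges_nth_iff[OF Q(1), of "Suc i" j] cedges_nth_iff[OF Q(1), of j "Suc i"] e j i Q(2)
        by (cases j "Suc i" rule: linorder_cases) (auto simp: insert_commute)
      then show "P ! Suc i = Q ! Suc i \<and> P ! Suc (Suc i) = Q ! Suc (Suc i)" using IH j by simp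
    qed
  qed (use eq in simp)
  then show "P ! i = Q ! i" if "i < length P" for i
    using that eq(2) by (cases i) auto
qed (use Q in simp)

text \<open>The two chords replace the ring edges at \<open>s\<close> and at \<open>t\<close>; the
  new cycle uses the edge between \<open>c s\<close> and \<open>c t\<close>, the ring does
  not.\<close>

lemma two_hamilton_cycles_of_crossing:
  assumes G: "simple_graph G" and r: "ring G M c"
    and ch: "adj G (c s) (c t)" "adj G (c (s + 1)) (c (t + 1))" "s + 2 \<le> t" "t \<le> s + int M - 2"
  shows "num_cycles M G \<ge> 2"
proof -
  let ?H = "seg c s (s + int M - 1)" and ?Z = "seg c (s + 1) t @ rev (seg c (t + 1) (s + int M))"
  have cs: "c (s + int M) = c s" by (rule ring_period[OF r])
  have dj: "c ` {s + 1..t} \<inter> c ` {t + 1..s + int M} = {}"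
    by (rule seg_disjoint[OF r]) (use ch in auto)
  have Z: "cyc G ?Z"
    by (rule cyc_append)
      (use ch dj cs distinct_seg[OF r] successively_seg[OF r] adj_sym[of G "c s"] adj_sym[of G "c (s + 1)"] in auto)
  have "seg c (s + 1) t = seg c (s + 1) (t - 1) @ [c t]"
    using ch seg_split[of "s + 1" t t c] by (simp add: seg_def)
  moreover have "rev (seg c (t + 1) (s + int M)) = c s # rev (seg c (t + 1) (s + int M - 1))"
  proof -
    have "seg c (t + 1) (s + int M) = seg c (t + 1) (s + int M - 1) @ [c (s + int M)]"
      using ch seg_split[of "t + 1" "s + int M" "s + int M" c] by (simp add: seg_def)
    then show ?thesis using cs by simp
  qed
  ultimately have "{c t, c s} \<in> cedges ?Z" using cedges_consecutive by fastforce
  moreover have "{c t, c s} \<notin> cedges ?H"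
  proof
    assume e: "{c t, c s} \<in> cedges ?H"
    have n: "?H ! 0 = c s" "?H ! nat (t - s) = c t" using ch by (simp_all add: nth_seg)
    have "distinct ?H" by (rule distinct_seg[OF r]) simp
    moreover have "0 < nat (t - s)" "nat (t - s) \<noteq> Suc 0" "Suc (nat (t - s)) < M" using ch by linarith+
    ultimately show False
      using cedges_nth_iff[of ?H 0 "nat (t - s)"] e n by (simp add: insert_commute)
  qed
  ultimately have "cycle_of_list ?Z \<noteq> cycle_of_list ?H" by metis
  then show ?thesis
    by (intro num_cycles_two[OF G Z]) (use cyc_of_ring[OF r, of s] ch in auto)
qed

text \<open>The Hamilton cycle and one chord for each odd position form a bipartite graph whose odd
  positions have degree three, the setting of \<open>second_hamilton_path\<close>.\<close>

lemma sheehan_lollipop: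
  assumes G: "simple_graph G" and h: "hamc G c" and n: "n = card (verts G)" "even n" "4 \<le> n"
    and ch: "\<And>i. odd i \<Longrightarrow> \<exists>j. even j \<and> adj G (c i) (c j) \<and> c j \<noteq> c (i - 1) \<and> c j \<noteq> c (i + 1)"
  shows "num_cycles n G \<ge> 2"
proof -
  have r: "ring G n c" and R: "range c = verts G" using h n by (auto simp: hamc_def)
  have par: "even i \<longleftrightarrow> even j" if "c i = c j" for i j
  proof -
    have "int n dvd i - j" using that ring_eq_iff[OF r] by (simp add: mod_eq_dvd_iff)
    then have "2 dvd i - j" using n(2) by (meson dvd_trans even_of_nat_iff)
    then show ?thesis by simp
  qed
  define U where "U = c ` {i. odd i}"
  have U: "c i \<in> U \<longleftrightarrow> odd i" for i using par unfolding U_def by blast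
  have "\<forall>x\<in>U. \<exists>y. adj G x y \<and> y \<in> verts G - U \<and> (\<forall>i. x = c i \<longrightarrow> y \<noteq> c (i - 1) \<and> y \<noteq> c (i + 1))"
  proof
    fix x assume "x \<in> U"
    then obtain i where i: "x = c i" "odd i" by (auto simp: U_def)
    obtain j where j: "even j" "adj G (c i) (c j)" "c j \<noteq> c (i - 1)" "c j \<noteq> c (i + 1)" using ch[OF i(2)] by blast
    have e: "c (k - 1) = c (i - 1) \<and> c (k + 1) = c (i + 1)" if "c i = c k" for k
    proof -
      have "int n dvd k - i" using that ring_eq_iff[OF r] by (metis mod_eq_dvd_iff)
      then show ?thesis by (simp add: ring_eq_iff[OF r] mod_eq_dvd_iff)
    qed
    have "c j \<in> verts G - U" using j(1) U R by auto
    moreover have "\<forall>k. x = c k \<longrightarrow> c j \<noteq> c (k - 1) \<and> c j \<noteq> c (k + 1)"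
      using j(3,4) e i(1) by metis
    ultimately show "\<exists>y. adj G x y \<and> y \<in> verts G - U \<and> (\<forall>i. x = c i \<longrightarrow> y \<noteq> c (i - 1) \<and> y \<noteq> c (i + 1))"
      using i(1) j(2) by blast
  qed
  then obtain g where g: "\<And>x. x \<in> U \<Longrightarrow> adj G x (g x) \<and> g x \<in> verts G - U \<and> (\<forall>i. x = c i \<longrightarrow> g x \<noteq> c (i - 1) \<and> g x \<noteq> c (i + 1))"
    by metis
  define B where "B x y \<longleftrightarrow> (\<exists>i. x = c i \<and> y = c (i + 1)) \<or> (\<exists>i. y = c i \<and> x = c (i + 1))
      \<or> (x \<in> U \<and> y = g x) \<or> (y \<in> U \<and> x = g y)" for x y
  have Badj: "B x y \<Longrightarrow> adj G x y" for x y
    using ring_adj[OF r] g adj_sym[of G] unfolding B_def by metis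
  let ?H = "seg c 0 (int n - 1)"
  have HV: "set ?H = verts G"
    using ring_range[OF r, of 0] R by (simp add: atLeastLessThanPlusOne_atLeastAtMost_int[symmetric])
  have H: "distinct ?H" "successively (adj G) ?H" using distinct_seg[OF r] successively_seg[OF r] by auto
  have HB: "successively B ?H"
    unfolding successively_nth
  proof (intro allI impI)
    fix i assume "Suc i < length ?H"
    then have "?H ! i = c (int i)" "?H ! Suc i = c (int i + 1)" by (simp_all add: nth_seg add.commute)
    then show "B (?H ! i) (?H ! Suc i)" unfolding B_def by blast
  qed
  have cn: "c (int n - 1 + 1) = c 0" using ring_period(1)[OF r, of 0] by simp
  obtain P where P: "P \<noteq> ?H" "distinct P" "set P = verts G" "successively B P" "B (last P) (hd P)" "P ! 0 = ?H ! 0" "P ! 1 = ?H ! 1"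
  proof (rule second_hamilton_path[of B U "verts G" ?H])
    show "B x y \<Longrightarrow> B y x" for x y by (auto simp: B_def)
    show "x \<in> U \<longleftrightarrow> y \<notin> U" if "B x y" for x y
      using that g U by (auto simp: B_def)
    show "finite (verts G)" using G by (rule finite_verts)
    show "card {y \<in> verts G. B x y} = 3" if x: "x \<in> U" for x
    proof -
      obtain i where i: "x = c i" "odd i" using x by (auto simp: U_def)
      have e: "c (k - 1) = c (i - 1) \<and> c (k + 1) = c (i + 1)" if "c i = c k" for k
      proof -
        have "int n dvd k - i" using that ring_eq_iff[OF r] by (metis mod_eq_dvd_iff)
        then show ?thesis by (simp add: ring_eq_iff[OF r] mod_eq_dvd_iff)
      qed
      have "{y \<in> verts G. B x y} = {c (i - 1), c (i + 1), g x}"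
      proof (intro set_eqI iffI)
        fix y assume "y \<in> {y \<in> verts G. B x y}"
        then consider k where "x = c k" "y = c (k + 1)" | k where "y = c k" "x = c (k + 1)" | "y = g x" | "y \<in> U" "x = g y"
          by (auto simp: B_def)
        then show "y \<in> {c (i - 1), c (i + 1), g x}"
        proof cases
          case 1 then show ?thesis using e[of k] i by simp
        next
          case 2 then show ?thesis using e[of "k + 1"] i by simp
        next
          case 4 then show ?thesis using g[of y] x by auto
        qed simp
      next
        fix y assume "y \<in> {c (i - 1), c (i + 1), g x}"
        moreover have "B x (c (i - 1))" unfolding B_def by (rule disjI2, rule disjI1, rule exI[of _ "i - 1"]) (simp add: i)
        moreover have "B x (c (i + 1))" "B x (g x)" using i x by (auto simp: B_def)
        ultimately show "y \<in> {y \<in> verts G. B x y}" using R g[OF x] by auto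
      qed
      moreover have "c (i - 1) \<noteq> c (i + 1)" using ring_neq[OF r, of "i - 1" "i + 1"] n by simp
      moreover have "g x \<noteq> c (i - 1)" "g x \<noteq> c (i + 1)" using g[OF x] i by auto
      ultimately show ?thesis by (simp add: card_insert_if eq_commute[of "g x"])
    qed
    show "B (last ?H) (hd ?H)" using n cn by (auto simp: B_def intro: exI[of _ "int n - 1"])
    show "hd ?H \<notin> U" using n U[of 0] by simp
  qed (use H HV HB n in auto)
  have lP: "length P = n" using P(2,3) n(1) by (metis distinct_card)
  have "successively (adj G) P" using P(4) Badj unfolding successively_nth by blast
  then have cP: "cyc G P" using P lP n Badj by (simp add: cyc_def)
  have "cycle_of_list P \<noteq> cycle_of_list ?H"
    using cyc_eq_of_first_two[OF P(2) H(1)] P HV lP n by auto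
  then show ?thesis
    by (intro num_cycles_two[OF G cP]) (use cyc_of_ring[OF r, of 0] lP in auto)
qed

section \<open>Counting chords by distance\<close>

lemma cnt_no_consecutive_cyclic:
  assumes "\<And>i. P (i + int M) = P i" "\<And>i. \<not> (P i \<and> P (i + 1))"
  shows "2 * cnt M P \<le> M"
proof -
  have "cnt M P + cnt M (\<lambda>i. P (i + 1)) = cnt M (\<lambda>i. P i \<and> P (i + 1)) + cnt M (\<lambda>i. P i \<or> P (i + 1))"
    by (rule cnt_disj)
  moreover have "cnt M (\<lambda>i. P (i + 1)) = cnt M P" by (rule cnt_shift) (rule assms)
  moreover have "(\<lambda>i. P i \<and> P (i + 1)) = (\<lambda>i. False)" using assms(2) by auto
  moreover have "cnt M (\<lambda>i. P i \<or> P (i + 1)) \<le> M"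
    using cnt_not[of M "\<lambda>i. P i \<or> P (i + 1)"] by simp
  ultimately show ?thesis by simp
qed

text \<open>The set and its shift by one are disjoint; on an interval the shift may stick out by one
  position, which costs one unit compared with the cyclic version.\<close>

lemma card_no_consecutive:
  fixes a b :: int
  assumes "\<And>i. a \<le> i \<Longrightarrow> i < b \<Longrightarrow> \<not> (P i \<and> P (i + 1))" "a \<le> b + 1"
  shows "2 * int (card {i \<in> {a..b}. P i}) \<le> b - a + 2"
proof -
  let ?A = "{i \<in> {a..b}. P i}"
  have fin: "finite ?A" by (rule finite_subset[of _ "{a..b}"]) auto
  have "?A \<inter> (\<lambda>i. i + 1) ` ?A = {}" using assms(1) by fastforce
  then have "card ?A + card ((\<lambda>i. i + 1) ` ?A) = card (?A \<union> (\<lambda>i. i + 1) ` ?A)"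
    using fin by (intro card_Un_disjoint[symmetric]) auto
  also have "\<dots> \<le> card {a..b + 1}" by (intro card_mono) auto
  finally have "card ?A + card ?A \<le> nat (b + 2 - a)" by (simp add: card_image)
  then show ?thesis using assms(2) by linarith
qed

text \<open>For odd \<open>n\<close> every edge joins two positions at a unique even distance \<open>k\<close>. Chords at the same distance
  starting in consecutive positions would cross, so each distance \<open>k < n - 1\<close> has at most \<open>n div 2\<close> of them.\<close>

lemma sheehan_odd:
  assumes G: "simple_graph G" and h: "hamc G c" and n: "n = card (verts G)" "odd n"
    and e: "n\<^sup>2 div 4 + 2 \<le> card (edges G)"
  shows "num_cycles n G \<ge> 2"
proof (rule ccontr)
  assume no: "\<not> ?thesis"
  have r: "ring G n c" and R: "range c = verts G" using h n by (auto simp: hamc_def)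
  obtain m where m: "n = 2 * m + 1" using n(2) by (auto elim: oddE)
  have m1: "1 \<le> m" using ring_M[OF r] m by simp
  define f where "f k = (\<lambda>s. {c s, c (s + k)}) ` {s \<in> {0..<int n}. adj G (c s) (c (s + k))}" for k
  have "edges G \<subseteq> (\<Union>j\<in>{1..m}. f (2 * int j))"
  proof
    fix x assume "x \<in> edges G"
    moreover from this have "x \<subseteq> range c" using G R by (auto simp: simple_graph_def)
    ultimately obtain s t where st: "x = {c s, c t}" "adj G (c s) (c t)" "0 \<le> s" "s < t" "t < int n"
      using ring_edge_indices[OF G r] by metis
    have "\<exists>j\<in>{1..m}. x \<in> f (2 * int j)"
    proof (cases "even (t - s)")
      case True
      then obtain d where d: "t - s = 2 * d" unfolding dvd_def by blast
      then have "nat d \<in> {1..m}" using st m by auto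
      moreover have "s + 2 * int (nat d) = t" using d st by simp
      then have "x \<in> f (2 * int (nat d))"
        unfolding f_def using st by (intro image_eqI[of _ _ s]) auto
      ultimately show ?thesis by blast
    next
      case False
      then have "even (s + int n - t)" using m by simp
      then obtain d where d: "s + int n - t = 2 * d" unfolding dvd_def by blast
      then have "nat d \<in> {1..m}" using st m by auto
      moreover have "t + 2 * int (nat d) = s + int n" using d st by simp
      then have "c (t + 2 * int (nat d)) = c s" using ring_period(1)[OF r, of s] by simp
      then have "x \<in> f (2 * int (nat d))"
        unfolding f_def using st adj_sym[of G "c s"] by (intro image_eqI[of _ _ t]) (auto simp: insert_commute)
      ultimately show ?thesis by blast
    qed
    then show "x \<in> (\<Union>j\<in>{1..m}. f (2 * int j))" by blast
  qed
  then have "card (edges G) \<le> card (\<Union>j\<in>{1..m}. f (2 * int j))"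
    by (intro card_mono) (auto simp: f_def)
  also have "\<dots> \<le> (\<Sum>j\<in>{1..m}. card (f (2 * int j)))" by (rule card_UN_le) simp
  \<comment> \<open>Distance \<open>2 * m = n - 1\<close> is a step back by one: this class consists
    of the ring edges.\<close>
  also have "\<dots> \<le> (\<Sum>j\<in>{1..m}. if j = m then n else m)"
  proof (rule sum_mono)
    fix j assume j: "j \<in> {1..m}"
    let ?k = "2 * int j"
    have le: "card (f ?k) \<le> cnt n (\<lambda>s. adj G (c s) (c (s + ?k)))"
      unfolding f_def cnt_def by (rule card_image_le) simp
    show "card (f ?k) \<le> (if j = m then n else m)"
    proof (cases "j = m")
      case True
      have "cnt n (\<lambda>s. adj G (c s) (c (s + ?k))) \<le> n"
        using cnt_not[of n "\<lambda>s. adj G (c s) (c (s + ?k))"] by simp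
      then show ?thesis using True le by simp
    next
      case False
      have "2 * cnt n (\<lambda>s. adj G (c s) (c (s + ?k))) \<le> n"
      proof (rule cnt_no_consecutive_cyclic)
        show "adj G (c (i + int n)) (c (i + int n + ?k)) = adj G (c i) (c (i + ?k))" for i
          using ring_period(1)[OF r, of i] ring_period(1)[OF r, of "i + ?k"] by (simp add: algebra_simps)
        show "\<not> (adj G (c i) (c (i + ?k)) \<and> adj G (c (i + 1)) (c (i + 1 + ?k)))" for i
          using two_hamilton_cycles_of_crossing[OF G r, of i "i + ?k"] no j m False
          by (auto simp: algebra_simps)
      qed
      then show ?thesis using le m False by simp
    qed
  qed
  also have "\<dots> = n + (m - 1) * m"
  proof -
    have "{1..m} = insert m {1..m - 1}" using m1 by auto
    then have "(\<Sum>j\<in>{1..m}. if j = m then n else m) = n + (\<Sum>j\<in>{1..m - 1}. if j = m then n else m)"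
      using m1 by simp
    also have "(\<Sum>j\<in>{1..m - 1}. if j = m then n else m) = (\<Sum>j\<in>{1..m - 1}. m)"
      using m1 by (intro sum.cong) auto
    finally show ?thesis by simp
  qed
  finally have "card (edges G) \<le> n + (m - 1) * m" .
  moreover have "n\<^sup>2 div 4 = m * m + m"
  proof -
    have "n\<^sup>2 = 4 * (m * m + m) + 1" using m by (simp add: power2_eq_square algebra_simps)
    then show ?thesis by simp
  qed
  moreover obtain q where "m = Suc q" using m1 by (cases m) auto
  ultimately show False using e m by (simp add: algebra_simps)
qed

text \<open>The count of the odd case is applied to the \<open>n - 1\<close> positions other than \<open>0\<close>. A chord from \<open>0\<close> to \<open>k\<close>
  excludes the chord from \<open>1\<close> to \<open>k + 1\<close>, which compensates for it.\<close>

lemma sheehan_even_chords: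
  assumes G: "simple_graph G" and h: "hamc G c" and n: "n = card (verts G)" "even n"
    and ev: "\<And>j. odd j \<Longrightarrow> adj G (c 0) (c j) \<Longrightarrow> c j = c (-1) \<or> c j = c 1"
    and e: "n\<^sup>2 div 4 + 2 \<le> card (edges G)"
  shows "num_cycles n G \<ge> 2"
proof (rule ccontr)
  assume no: "\<not> ?thesis"
  have r: "ring G n c" and R: "range c = verts G" using h n by (auto simp: hamc_def)
  obtain m where m: "n = 2 * m" using n(2) by (auto elim: evenE)
  have m2: "2 \<le> m" using ring_M[OF r] m by simp
  have im: "int n = 2 * int m" using m by simp
  have per: "c (i + 2 * int m) = c i" for i using ring_period(1)[OF r] im by metis
  have nand: "\<not> (adj G (c s) (c t) \<and> adj G (c (s + 1)) (c (t + 1)))" if "s + 2 \<le> t" "t \<le> s + 2 * int m - 2" for s t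
    using two_hamilton_cycles_of_crossing[OF G r, of s t] no that im by auto
  define A where "A = (\<lambda>i. {c i, c (i + 1)}) ` {0..<2 * int m}"
  \<comment> \<open>On the ring of the positions other than \<open>0\<close>, distance
    \<open>2 * int m - 2\<close> is a step back by one. Only \<open>Y\<close> is not an edge of the
    Hamilton cycle there; \<open>X\<close> is the chord from \<open>0\<close> assigned to this
    class.\<close>
  define X where "X = (if adj G (c 0) (c (2 * int m - 2)) then {{c 0, c (2 * int m - 2)}} else {})"
  define Y where "Y = (if adj G (c 1) (c (2 * int m - 1)) then {{c 1, c (2 * int m - 1)}} else {})"
  define F0 where "F0 j = (if adj G (c 0) (c (2 * j)) then {{c 0, c (2 * j)}} else {})" for j
  \<comment> \<open>On the odd ring of positions \<open>1\<close> to \<open>2 * int m - 1\<close>,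
    \<open>P j\<close> and \<open>Q j\<close> give the chords of distance \<open>2 * j\<close>
    without and with wrap-around. \<open>F0 j\<close> is the chord from \<open>0\<close> assigned to
    the same class.\<close>
  define P where "P j = {s \<in> {1..2 * int m - 1 - 2 * j}. adj G (c s) (c (s + 2 * j))}" for j
  define Q where "Q j = {s \<in> {2 * int m - 2 * j..2 * int m - 1}. adj G (c s) (c (s + 2 * j - 2 * int m + 1))}" for j
  define F where "F j = F0 j \<union> (\<lambda>s. {c s, c (s + 2 * j)}) ` P j \<union> (\<lambda>s. {c s, c (s + 2 * j - 2 * int m + 1)}) ` Q j" for j
  have fin: "finite (P j)" "finite (Q j)" for j
    by (rule finite_subset[of _ "{1..2 * int m - 1 - 2 * j}"]; auto simp: P_def)
       (rule finite_subset[of _ "{2 * int m - 2 * j..2 * int m - 1}"]; auto simp: Q_def)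
  have finF: "finite (F j)" for j using fin by (simp add: F_def F0_def)
  have cF: "card (F j) \<le> m" if j: "1 \<le> j" "j \<le> int m - 2" for j
  proof -
    have Q: "2 * int (card (Q j)) \<le> 2 * j + 1"
    proof -
      have "2 * int (card (Q j)) \<le> (2 * int m - 1) - (2 * int m - 2 * j) + 2"
        unfolding Q_def
      proof (rule card_no_consecutive)
        fix i
        show "\<not> (adj G (c i) (c (i + 2 * j - 2 * int m + 1)) \<and> adj G (c (i + 1)) (c (i + 1 + 2 * j - 2 * int m + 1)))"
          using nand[of "i + 2 * j - 2 * int m + 1" i] j adj_sym[of G "c i"] adj_sym[of G "c (i + 1)"]
          by (auto simp: algebra_simps)
      qed (use j in auto)
      then show ?thesis by simp
    qed
    have nandP: "\<not> (adj G (c i) (c (i + 2 * j)) \<and> adj G (c (i + 1)) (c (i + 1 + 2 * j)))" for i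
      using nand[of i "i + 2 * j"] j by (auto simp: algebra_simps)
    have P: "2 * int (card (P j)) \<le> 2 * int m - 2 * j - (if adj G (c 0) (c (2 * j)) then 1 else 0)"
    proof (cases "adj G (c 0) (c (2 * j))")
      case True
      have "P j = {s \<in> {2..2 * int m - 1 - 2 * j}. adj G (c s) (c (s + 2 * j))}"
      proof -
        have "\<not> adj G (c 1) (c (1 + 2 * j))" using nandP[of 0] True by simp
        then have "s \<noteq> 1" if "adj G (c s) (c (s + 2 * j))" for s using that by blast
        then show ?thesis unfolding P_def by force
      qed
      then have "2 * int (card (P j)) \<le> (2 * int m - 1 - 2 * j) - 2 + 2"
        by (simp only:) (rule card_no_consecutive, use nandP j in auto)
      then show ?thesis using True by simp
    next
      case False
      have "2 * int (card (P j)) \<le> (2 * int m - 1 - 2 * j) - 1 + 2"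
        unfolding P_def by (rule card_no_consecutive) (use nandP j in auto)
      then show ?thesis using False by simp
    qed
    have "card (F j) \<le> card (F0 j) + card (P j) + card (Q j)"
      unfolding F_def
      by (intro order.trans[OF card_Un_le] add_mono card_image_le fin order.refl)
    moreover have "card (F0 j) = (if adj G (c 0) (c (2 * j)) then 1 else 0)" by (simp add: F0_def)
    moreover have "int (card (Q j)) \<le> j" using Q by presburger
    moreover have "int (card (P j)) \<le> int m - j - (if adj G (c 0) (c (2 * j)) then 1 else 0)"
    proof (cases "adj G (c 0) (c (2 * j))")
      case True
      then have "2 * int (card (P j)) \<le> 2 * int m - 2 * j - 1" using P by simp
      then have "int (card (P j)) \<le> int m - j - 1" by presburger
      then show ?thesis using True by simp
    qed (use P in simp)
    ultimately show ?thesis by (auto split: if_splits)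
  qed
  have "edges G \<subseteq> A \<union> (X \<union> Y) \<union> (\<Union>j\<in>{1..int m - 2}. F j)"
  proof
    fix x assume "x \<in> edges G"
    moreover from this have "x \<subseteq> range c" using G R by (auto simp: simple_graph_def)
    ultimately obtain s t where st: "x = {c s, c t}" "adj G (c s) (c t)" "0 \<le> s" "s < t" "t < int n"
      using ring_edge_indices[OF G r] by metis
    have A: "x \<in> A" if "c t = c (s + 1) \<or> s = 0 \<and> c t = c (- 1)"
    proof (cases "c t = c (s + 1)")
      case True then show ?thesis using st im by (auto simp: A_def)
    next
      case False
      then have "s = 0" "c t = c (2 * int m - 1)" using that per[of "-1"] by auto
      then show ?thesis using st m2 per[of 0] unfolding A_def
        by (intro image_eqI[of _ _ "2 * int m - 1"]) (auto simp: insert_commute)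
    qed
    show "x \<in> A \<union> (X \<union> Y) \<union> (\<Union>j\<in>{1..int m - 2}. F j)"
    proof (cases "s = 0")
      case True
      show ?thesis
      proof (cases "odd t")
        case True
        then show ?thesis using ev[of t] st A \<open>s = 0\<close> by auto
      next
        case False
        then obtain d where d: "t = 2 * d" unfolding dvd_def by blast
        show ?thesis
        proof (cases "d = int m - 1")
          case True
          then have "t = 2 * int m - 2" using d by simp
          then have "x \<in> X" using st \<open>s = 0\<close> by (simp add: X_def)
          then show ?thesis by blast
        next
          case False
          then have "x \<in> F d" "d \<in> {1..int m - 2}" using st d \<open>s = 0\<close> im by (auto simp: F_def F0_def)
          then show ?thesis by blast
        qed
      qed
    next
      case False
      show ?thesis
      proof (cases "even (t - s)")
        case True
        then obtain d where d: "t - s = 2 * d" unfolding dvd_def by blast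
        show ?thesis
        proof (cases "d = int m - 1")
          case True
          then have "s = 1" "t = 2 * int m - 1" using d False st im by auto
          then have "x \<in> Y" using st by (simp add: Y_def)
          then show ?thesis by blast
        next
          case neq: False
          have "s + 2 * d = t" using d by simp
          then have "s \<in> P d" "x = {c s, c (s + 2 * d)}" using st False im by (auto simp: P_def)
          then have "x \<in> F d" unfolding F_def by blast
          moreover have "d \<in> {1..int m - 2}" using d st im False neq by auto
          ultimately show ?thesis by blast
        qed
      next
        case odd: False
        show ?thesis
        proof (cases "t = s + 1")
          case True
          then show ?thesis using A by blast
        next
          case neq: False
          have "even (2 * int m - 1 - (t - s))" using odd by simp
          then obtain d where d: "2 * int m - 1 - (t - s) = 2 * d" unfolding dvd_def by blast
          have e1: "t + 2 * d - 2 * int m + 1 = s" using d by simp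
          then have "t \<in> Q d" "x = {c t, c (t + 2 * d - 2 * int m + 1)}"
            unfolding e1 using st False im d by (simp_all add: Q_def e1 adj_sym insert_commute)
          then have "x \<in> F d" unfolding F_def by blast
          moreover have "d \<in> {1..int m - 2}" using d st im False neq odd by (auto; presburger)
          ultimately show ?thesis by blast
        qed
      qed
    qed
  qed
  then have "card (edges G) \<le> card (A \<union> (X \<union> Y) \<union> (\<Union>j\<in>{1..int m - 2}. F j))"
    using finF by (intro card_mono) (auto simp: A_def X_def Y_def)
  also have "\<dots> \<le> card A + card (X \<union> Y) + card (\<Union>j\<in>{1..int m - 2}. F j)"
    by (intro order.trans[OF card_Un_le] add_mono card_Un_le order.refl)
  also have "card A \<le> 2 * m"
    unfolding A_def by (rule order.trans[OF card_image_le]) auto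
  also have "card (X \<union> Y) \<le> 1"
  proof -
    have "\<not> (adj G (c (2 * int m - 2)) (c (0 + 2 * int m)) \<and> adj G (c (2 * int m - 1)) (c (1 + 2 * int m)))"
      using nand[of "2 * int m - 2" "2 * int m"] m2 by (simp add: algebra_simps)
    then have "X = {} \<or> Y = {}"
      using per[of 0] per[of 1] adj_sym[of G "c 0"] adj_sym[of G "c 1"] by (auto simp: X_def Y_def)
    then show ?thesis by (auto simp: X_def Y_def)
  qed
  also have "card (\<Union>j\<in>{1..int m - 2}. F j) \<le> (\<Sum>j\<in>{1..int m - 2}. card (F j))" by (rule card_UN_le) simp
  also have "(\<Sum>j\<in>{1..int m - 2}. card (F j)) \<le> (\<Sum>j\<in>{1..int m - 2}. m)"
    by (rule sum_mono) (use cF in auto)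
  also have "(\<Sum>j\<in>{1..int m - 2}. m) = (m - 2) * m" using m2 by (simp add: nat_diff_distrib)
  finally have "card (edges G) \<le> 2 * m + 1 + (m - 2) * m" by simp
  moreover have "n\<^sup>2 div 4 = m * m" using m by (simp add: power2_eq_square)
  moreover obtain q where "m = q + 2" using m2 by (metis add.commute le_Suc_ex)
  ultimately show False using e by (simp add: algebra_simps)
qed

text \<open>For even order, if each odd position has a further neighbour at an even one, the
  lollipop argument applies. Otherwise some vertex has all its chords at even distance; moved to
  position \<open>0\<close>, it satisfies the assumption of
  \<open>sheehan_even_chords\<close>.\<close>

lemma sheehan:
  assumes G: "simple_graph G" and h: "hamiltonian G" and n: "n = card (verts G)"
    and e: "n\<^sup>2 div 4 + 2 \<le> card (edges G)"
  shows "num_cycles n G \<ge> 2"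
proof -
  obtain c where c: "hamc G c" using h G hamiltonian_iff by blast
  have r: "ring G n c" using c n by (simp add: hamc_def)
  show ?thesis
  proof (cases "odd n")
    case True
    then show ?thesis using sheehan_odd[OF G c n] e by simp
  next
    case False
    then have ev: "even n" by simp
    have n4: "4 \<le> n" using ring_M[OF r] ev by presburger
    show ?thesis
    proof (cases "\<forall>i. odd i \<longrightarrow> (\<exists>j. even j \<and> adj G (c i) (c j) \<and> c j \<noteq> c (i - 1) \<and> c j \<noteq> c (i + 1))")
      case True
      then show ?thesis using sheehan_lollipop[OF G c n ev n4] by blast
    next
      case False
      then obtain i where i: "odd i" "\<And>j. even j \<Longrightarrow> adj G (c i) (c j) \<Longrightarrow> c j = c (i - 1) \<or> c j = c (i + 1)" by blast
      have "hamc G (\<lambda>x. c (x + i))" using c ring_shift range_shift unfolding hamc_def by metis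
      then show ?thesis
      proof (rule sheehan_even_chords[OF G _ n ev _ e])
        show "c (j + i) = c (- 1 + i) \<or> c (j + i) = c (1 + i)" if "odd j" "adj G (c (0 + i)) (c (j + i))" for j
          using i(2)[of "j + i"] i(1) that by (simp add: add.commute)
      qed
    qed
  qed
qed

section \<open>Triangles and four-cycles\<close>

lemma handshake:
  assumes "simple_graph G" shows "(\<Sum>v\<in>verts G. deg G v) = 2 * card (edges G)"
proof -
  have "(\<Sum>v\<in>verts G. card {e \<in> edges G. v \<in> e}) = (\<Sum>e\<in>edges G. 2)"
  proof (rule sum_multicount_gen)
    show "\<forall>e\<in>edges G. card {v \<in> verts G. v \<in> e} = 2"
    proof
      fix e assume "e \<in> edges G"
      then have "{v \<in> verts G. v \<in> e} = e" "card e = 2" using assms by (auto simp: simple_graph_def)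
      then show "card {v \<in> verts G. v \<in> e} = 2" by simp
    qed
  qed (simp_all add: finite_verts finite_edges assms)
  then show ?thesis by (simp add: deg_eq_card_edges[OF assms])
qed

lemma sum_deg_swap:
  assumes "simple_graph G" "A \<subseteq> verts G"
  shows "(\<Sum>a\<in>A. deg G a) = (\<Sum>w\<in>verts G. card (nbrs G w \<inter> A))"
proof -
  have f: "finite A" "finite (verts G)" using assms finite_verts finite_subset by blast+
  have 1: "nbrs G a = {w \<in> verts G. adj G a w}" for a using adj_verts[OF assms(1)] by (auto simp: nbrs_def)
  have 2: "{a \<in> A. adj G a w} = nbrs G w \<inter> A" for w by (auto simp: nbrs_def adj_sym)
  have "(\<Sum>a\<in>A. card {w \<in> verts G. adj G a w}) = (\<Sum>w\<in>verts G. card {a \<in> A. adj G a w})"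
    by (rule sum_multicount_gen) (use f in auto)
  then show ?thesis unfolding 2 by (simp add: deg_def 1)
qed

lemma deg_gdel_le: "simple_graph G \<Longrightarrow> deg (gdel G W) v \<le> deg G v"
  unfolding deg_def by (rule card_mono[OF finite_nbrs]) (auto simp: nbrs_def)

lemma card_edges_gdel_ge:
  assumes "simple_graph G" "finite N"
  shows "card (edges G) \<le> card (edges (gdel G N)) + (\<Sum>a\<in>N. deg G a)"
  using assms(2)
proof (induction N rule: finite_induct)
  case empty
  have "edges (gdel G {}) = edges G" by (auto simp: gdel_def)
  then show ?case by simp
next
  case (insert a N)
  have "gdel G (insert a N) = gdel (gdel G N) {a}" by (simp add: gdel_gdel)
  then show ?case
    using insert card_edges_gdel[of "gdel G N" a] deg_gdel_le[OF assms(1), of N a] assms(1) by simp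
qed

lemma card_edges_le_choose:
  assumes "simple_graph G" shows "2 * card (edges G) \<le> card (verts G) * (card (verts G) - 1)"
proof -
  have "(\<Sum>v\<in>verts G. deg G v) \<le> (\<Sum>v\<in>verts G. card (verts G) - 1)"
    by (rule sum_mono) (use deg_less[OF assms] in fastforce)
  then show ?thesis using handshake[OF assms] by simp
qed

lemma min_deg:
  assumes "simple_graph G" "verts G \<noteq> {}"
  obtains v where "v \<in> verts G" "card (verts G) * deg G v \<le> 2 * card (edges G)" "\<And>w. w \<in> verts G \<Longrightarrow> deg G v \<le> deg G w"
proof -
  obtain v where v: "v \<in> verts G" "\<And>w. w \<in> verts G \<Longrightarrow> deg G v \<le> deg G w"
  proof -
    have fin: "finite (deg G ` verts G)" using finite_verts[OF assms(1)] by simp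
    then have "Min (deg G ` verts G) \<in> deg G ` verts G" using assms(2) by (intro Min_in) simp_all
    then obtain u where u: "u \<in> verts G" "deg G u = Min (deg G ` verts G)" by auto
    then have "deg G u \<le> deg G w" if "w \<in> verts G" for w using Min_le[OF fin, of "deg G w"] that by simp
    then show ?thesis using u that by blast
  qed
  have "(\<Sum>w\<in>verts G. deg G v) \<le> (\<Sum>w\<in>verts G. deg G w)" by (rule sum_mono) (use v in auto)
  then show ?thesis using that v handshake[OF assms(1)] by simp
qed

lemma square_div_4: "(2 * m)\<^sup>2 div 4 = m * m" "(2 * m + 1)\<^sup>2 div 4 = m * m + (m::nat)"
proof -
  show "(2 * m)\<^sup>2 div 4 = m * m" by (simp add: power2_eq_square)
  have "(2 * m + 1)\<^sup>2 = 4 * (m * m + m) + 1" by (simp add: power2_eq_square algebra_simps)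
  then show "(2 * m + 1)\<^sup>2 div 4 = m * m + m" by simp
qed

text \<open>The accounting of every vertex deletion: a vertex of degree \<open>Suc n div 2\<close>
  can be removed from a graph of order \<open>Suc n\<close> without changing the excess.\<close>

lemma square_div_4_Suc: "(Suc n)\<^sup>2 div 4 = n\<^sup>2 div 4 + Suc n div 2"
proof (cases "even n")
  case True
  then obtain m where "n = 2 * m" by (elim evenE)
  then show ?thesis using square_div_4(1)[of m] square_div_4(2)[of m] by simp
next
  case False
  then obtain m where "n = 2 * m + 1" by (elim oddE)
  then show ?thesis using square_div_4(1)[of "Suc m"] square_div_4(2)[of m] by simp
qed

text \<open>Larger degrees throughout would exceed the degree sum. The triangle shows that the order
  has to be at least four.\<close>

lemma ex_low_vertex:
  assumes G: "simple_graph G" and n: "4 \<le> card (verts G)" and e: "card (edges G) = (card (verts G))\<^sup>2 div 4 + 1"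
  obtains v where "v \<in> verts G" "deg G v \<le> card (verts G) div 2"
proof -
  let ?n = "card (verts G)"
  have "verts G \<noteq> {}" using n by auto
  then obtain v where v: "v \<in> verts G" "?n * deg G v \<le> 2 * card (edges G)" using min_deg[OF G] by metis
  have "deg G v \<le> ?n div 2"
  proof (rule ccontr)
    assume "\<not> ?thesis"
    then have "?n * (?n div 2 + 1) \<le> ?n * deg G v" by (intro mult_le_mono) auto
    then have le: "?n * (?n div 2 + 1) \<le> 2 * (?n\<^sup>2 div 4 + 1)" using v e by simp
    show False
    proof (cases "even ?n")
      case True
      then obtain m where m: "?n = 2 * m" by (elim evenE)
      then show False using le square_div_4(1)[of m] n by (simp add: algebra_simps)
    next
      case False
      then obtain m where m: "?n = 2 * m + 1" by (elim oddE)
      then show False using le square_div_4(2)[of m] n by (simp add: algebra_simps)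
    qed
  qed
  then show ?thesis using that v by blast
qed

text \<open>Without such a cycle every other vertex has at most one neighbour in \<open>?N\<close>.
  The resulting degree bounds on \<open>?N\<close> and on the remaining vertices \<open>?R\<close>
  contradict the number of edges.\<close>

lemma four_cycle_through:
  assumes G: "simple_graph G" and v: "v \<in> verts G" and d: "deg G v = card (verts G) div 2"
    and n: "4 \<le> card (verts G)" and e: "(card (verts G))\<^sup>2 div 4 + 1 \<le> card (edges G)"
  shows "\<exists>xs. cyc G xs \<and> length xs = 4 \<and> v \<in> set xs"
proof (rule ccontr)
  assume no: "\<not> ?thesis"
  let ?V = "verts G" and ?N = "nbrs G v" and ?n = "card (verts G)"
  let ?R = "?V - insert v ?N"
  have fin: "finite ?V" "finite ?N" using G by (simp_all add: finite_verts)
  have NV: "?N \<subseteq> ?V - {v}" by (rule nbrs_subset[OF G])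
  have one: "card (nbrs G w \<inter> ?N) \<le> 1" if "w \<noteq> v" for w
  proof (rule ccontr)
    assume "\<not> ?thesis"
    then have "2 \<le> card (nbrs G w \<inter> ?N)" by simp
    then obtain T where "T \<subseteq> nbrs G w \<inter> ?N" "card T = 2" by (meson obtain_subset_with_card_n)
    then obtain a b where "a \<noteq> b" "a \<in> nbrs G w" "b \<in> nbrs G w" "a \<in> ?N" "b \<in> ?N"
      by (auto simp: card_2_iff)
    then have "cyc G [v, a, w, b]"
      using that adj_neq[OF G] adj_sym[of G] by (auto simp: cyc_def nbrs_def)
    then have "\<exists>xs. cyc G xs \<and> length xs = 4 \<and> v \<in> set xs" by (intro exI[of _ "[v, a, w, b]"]) simp
    then show False using no by blast
  qed
  have V: "?V = insert v (?N \<union> ?R)" "v \<notin> ?N \<union> ?R" "?N \<inter> ?R = {}" using v NV by auto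
  have cR: "card ?R + ?n div 2 + 1 = ?n"
  proof -
    have "card (insert v ?N) = ?n div 2 + 1" using V(2) fin d by (simp add: deg_def)
    moreover have "insert v ?N \<subseteq> ?V" using v NV by auto
    ultimately show ?thesis using card_Diff_subset[of "insert v ?N" ?V] card_mono[of ?V "insert v ?N"] fin by simp
  qed
  have "2 * card (edges G) = (\<Sum>w\<in>insert v (?N \<union> ?R). deg G w)" using handshake[OF G] V(1) by simp
  also have "\<dots> = deg G v + ((\<Sum>w\<in>?N. deg G w) + (\<Sum>w\<in>?R. deg G w))"
    using V(2,3) fin by (simp add: sum.union_disjoint)
  \<comment> \<open>Double counting: every vertex other than \<open>v\<close> is reached from
    \<open>?N\<close> at most once.\<close>
  also have "(\<Sum>w\<in>?N. deg G w) \<le> deg G v + (?n - 1)"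
  proof -
    have "(\<Sum>w\<in>?N. deg G w) = (\<Sum>w\<in>?V. card (nbrs G w \<inter> ?N))"
      by (rule sum_deg_swap[OF G]) (use NV in auto)
    also have "\<dots> = card (nbrs G v \<inter> ?N) + (\<Sum>w\<in>?V - {v}. card (nbrs G w \<inter> ?N))"
      using v fin by (simp add: sum.remove)
    also have "(\<Sum>w\<in>?V - {v}. card (nbrs G w \<inter> ?N)) \<le> (\<Sum>w\<in>?V - {v}. 1)"
      by (rule sum_mono) (use one in auto)
    finally show ?thesis using v fin by (simp add: deg_def)
  qed
  \<comment> \<open>At most one neighbour in \<open>?N\<close>, and at most
    \<open>card ?R - 1\<close> in \<open>?R\<close>.\<close>
  also have "(\<Sum>w\<in>?R. deg G w) \<le> (\<Sum>w\<in>?R. card ?R)"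
  proof (rule sum_mono)
    fix w assume w: "w \<in> ?R"
    have "nbrs G w \<subseteq> (nbrs G w \<inter> ?N) \<union> (?R - {w})"
      using w adj_verts[OF G] adj_neq[OF G] adj_sym[of G v w] by (auto simp: nbrs_def)
    then have "deg G w \<le> card ((nbrs G w \<inter> ?N) \<union> (?R - {w}))"
      unfolding deg_def using fin by (intro card_mono) auto
    also have "\<dots> \<le> card (nbrs G w \<inter> ?N) + card (?R - {w})" by (rule card_Un_le)
    also have "card (nbrs G w \<inter> ?N) \<le> 1" using one w by blast
    also have "card (?R - {w}) = card ?R - 1" using w fin by simp
    finally show "deg G w \<le> card ?R" using w fin card_gt_0_iff[of ?R] by fastforce
  qed
  finally have le: "2 * card (edges G) \<le> ?n div 2 + (?n div 2 + (?n - 1) + card ?R * card ?R)" using d by simp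
  show False
  proof (cases "even ?n")
    case True
    then obtain m where m: "?n = 2 * m" by (elim evenE)
    then have "card ?R = m - 1" using cR by simp
    moreover have "2 \<le> m" using n m by simp
    then obtain k where "m = 2 + k" using le_Suc_ex by blast
    ultimately show False using le e m square_div_4(1)[of m] by (simp add: algebra_simps)
  next
    case False
    then obtain m where m: "?n = 2 * m + 1" by (elim oddE)
    then have "card ?R = m" using cR by simp
    then have "2 * (m * m + m + 1) \<le> m + (m + 2 * m + m * m)" using le e m square_div_4(2)[of m] by simp
    then have "m * m + 2 \<le> 2 * m" by (simp add: algebra_simps)
    then have "int (m * m + 2) \<le> int (2 * m)" by (simp only: of_nat_le_iff)
    moreover have "0 \<le> (int m - 1) * (int m - 1)" by simp
    ultimately show False by (simp add: algebra_simps)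
  qed
qed

text \<open>The additive form of the bound \<open>n - 4 + q\<close>. For \<open>q \<ge> 2\<close> an
  edge of some 4-cycle is deleted, for \<open>q = 1\<close> a vertex of degree at most
  \<open>n div 2\<close>.\<close>

lemma num_four_cycles:
  assumes "simple_graph G" "4 \<le> card (verts G)" "(card (verts G))\<^sup>2 div 4 + 1 \<le> card (edges G)"
  shows "card (verts G) + card (edges G) \<le> num_cycles 4 G + 4 + (card (verts G))\<^sup>2 div 4"
  using assms
proof (induction "card (verts G) + card (edges G)" arbitrary: G rule: less_induct)
  case less
  note G = less.prems(1)
  let ?n = "card (verts G)" and ?e = "card (edges G)"
  show ?case
  proof (cases "?n\<^sup>2 div 4 + 2 \<le> ?e")
    case True
    have IH: "?n + ?e \<le> num_cycles 4 (edel G f) + 5 + ?n\<^sup>2 div 4" if "f \<in> edges G" for f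
    proof -
      have c: "card (edges (edel G f)) + 1 = ?e" by (rule card_edges_edel[OF G that])
      have "card (verts (edel G f)) + card (edges (edel G f)) \<le> num_cycles 4 (edel G f) + 4 + (card (verts (edel G f)))\<^sup>2 div 4"
        by (rule less.hyps) (use c True less.prems in \<open>simp_all only: verts_edel simple_edel\<close>)
      then show ?thesis using c by (simp only: verts_edel)
    qed
    have "edges G \<noteq> {}" using True by (metis add_is_0 card.empty le_zero_eq zero_neq_numeral)
    then obtain f where f: "f \<in> edges G" by blast
    have "1 \<le> num_cycles 4 (edel G f)" using IH[OF f] True less.prems(2) by linarith
    then have "1 \<le> num_cycles 4 G"
      using num_cycles_mono[OF G simple_edel[OF G], of f 4] by auto
    then obtain xs where xs: "cyc G xs" "length xs = 4" using num_cycles_obtain[OF G, of 4] by auto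
    have "xs \<noteq> []" using xs(2) by auto
    then have "cedges xs \<noteq> {}" by (simp add: cedges_eq)
    then obtain f' where f': "f' \<in> cedges xs" by blast
    then have "f' \<in> edges G" using xs by (auto simp: cyc_iff_cedges)
    then show ?thesis using IH[of f'] num_cycles_edel[OF G xs f'] by linarith
  next
    case False
    then have e: "?e = ?n\<^sup>2 div 4 + 1" using less.prems by simp
    obtain v where v: "v \<in> verts G" and d: "deg G v \<le> ?n div 2"
      using ex_low_vertex[OF G less.prems(2) e] by blast
    let ?G = "gdel G {v}"
    have c: "?n = Suc (card (verts ?G))"
      using v less.prems(2) card_verts_gdel_single[OF G v] by simp
    have ce: "card (edges ?G) + deg G v = ?e" by (rule card_edges_gdel[OF G])
    have sq: "?n\<^sup>2 div 4 = (card (verts ?G))\<^sup>2 div 4 + ?n div 2" unfolding c by (rule square_div_4_Suc)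
    have mono: "num_cycles 4 ?G \<le> num_cycles 4 G" by (rule num_cycles_gdel_le[OF G]) simp
    have IH: "card (verts ?G) + card (edges ?G) \<le> num_cycles 4 ?G + 4 + (card (verts ?G))\<^sup>2 div 4" if "5 \<le> ?n"
      by (rule less.hyps) (use c ce e sq d G that in auto)
    show ?thesis
    proof (cases "deg G v = ?n div 2")
      case True
      obtain xs where xs: "cyc G xs" "length xs = 4" "v \<in> set xs"
        using four_cycle_through[OF G v True] less.prems by auto
      have "num_cycles 4 ?G + 1 \<le> num_cycles 4 G" by (rule num_cycles_gdel[OF G xs(1,2)]) (use xs in auto)
      then show ?thesis using IH e sq c ce True less.prems(2) by (cases "5 \<le> ?n") auto
    next
      case False
      \<comment> \<open>On four vertices, deleting a vertex of degree at most one would leave at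
        least four edges on three vertices.\<close>
      have "5 \<le> ?n"
      proof (rule ccontr)
        assume "\<not> ?thesis"
        then have "?n = 4" using less.prems(2) by simp
        then have "card (verts ?G) = 3" "4 \<le> card (edges ?G)" using c ce e d False by auto
        then show False using card_edges_le_choose[of ?G] G by simp
      qed
      then show ?thesis using IH mono e sq c ce d False by simp
    qed
  qed
qed

section \<open>Triangles as vertex sets\<close>

definition tri :: "'a graph \<Rightarrow> 'a set set" where
  "tri G = {T. card T = 3 \<and> (\<forall>x\<in>T. \<forall>y\<in>T. x \<noteq> y \<longrightarrow> adj G x y)}"

lemma tri_subset: "simple_graph G \<Longrightarrow> tri G \<subseteq> Pow (verts G)"
proof
  fix T assume G: "simple_graph G" and T: "T \<in> tri G"
  have "x \<in> verts G" if x: "x \<in> T" for x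
  proof -
    have "T \<noteq> {x}" using T by (auto simp: tri_def)
    then obtain y where "y \<in> T" "x \<noteq> y" using x by blast
    then show ?thesis using T x adj_verts[OF G] by (auto simp: tri_def)
  qed
  then show "T \<in> Pow (verts G)" by blast
qed

lemma finite_tri: "simple_graph G \<Longrightarrow> finite (tri G)"
  using tri_subset finite_verts by (metis finite_Pow_iff finite_subset)

lemma card_tri_le:
  assumes G: "simple_graph G" shows "card (tri G) \<le> num_cycles 3 G"
proof -
  have "\<forall>T\<in>tri G. \<exists>xs. cyc G xs \<and> length xs = 3 \<and> set xs = T"
  proof
    fix T assume T: "T \<in> tri G"
    then obtain x y z where "T = {x, y, z}" "x \<noteq> y" "y \<noteq> z" "x \<noteq> z" by (auto simp: tri_def card_3_iff)
    then show "\<exists>xs. cyc G xs \<and> length xs = 3 \<and> set xs = T"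
      using T by (intro exI[of _ "[x, y, z]"]) (auto simp: tri_def cyc_def)
  qed
  then obtain f where f: "\<And>T. T \<in> tri G \<Longrightarrow> cyc G (f T) \<and> length (f T) = 3 \<and> set (f T) = T" by metis
  have "inj_on (\<lambda>T. cycle_of_list (f T)) (tri G)"
  proof (rule inj_onI)
    fix S T assume "S \<in> tri G" "T \<in> tri G" "cycle_of_list (f S) = cycle_of_list (f T)"
    moreover from this(3) have "set (f S) = set (f T)" by (simp add: cycle_of_list_def)
    ultimately show "S = T" using f by simp
  qed
  then have "card (tri G) = card (cycle_of_list ` f ` tri G)" by (simp add: card_image image_image)
  also have "\<dots> \<le> num_cycles 3 G" by (rule num_cycles_ge[OF G]) (use f in auto)
  finally show ?thesis .
qed

lemma tri_insert:
  assumes "simple_graph G" "e \<in> edges G" "e \<subseteq> nbrs G v"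
  shows "insert v e \<in> tri G" "v \<notin> e" "finite e"
proof -
  obtain x y where e: "e = {x, y}" "x \<noteq> y" "adj G x y" using edge_doubleton[OF assms(1,2)] by blast
  then have a: "adj G v x" "adj G v y" using assms(3) by (auto simp: nbrs_def)
  then have "v \<noteq> x" "v \<noteq> y" using adj_neq[OF assms(1)] by auto
  then show "v \<notin> e" "finite e" "insert v e \<in> tri G"
    using e a by (auto simp: tri_def adj_sym)
qed

lemma tri_gdel: "simple_graph G \<Longrightarrow> tri (gdel G {v}) = {T \<in> tri G. v \<notin> T}"
proof (intro set_eqI iffI)
  fix T assume G: "simple_graph G" and T: "T \<in> tri (gdel G {v})"
  then have "v \<notin> T" using tri_subset[of "gdel G {v}"] by auto
  then show "T \<in> {T \<in> tri G. v \<notin> T}" using T by (auto simp: tri_def)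
qed (auto simp: tri_def)

text \<open>Each edge between neighbours of \<open>v\<close> completes a triangle that the deletion
  of \<open>v\<close> destroys.\<close>

lemma card_tri_gdel:
  assumes G: "simple_graph G"
  shows "card (tri (gdel G {v})) + card {e \<in> edges G. e \<subseteq> nbrs G v} \<le> card (tri G)"
proof -
  let ?E = "{e \<in> edges G. e \<subseteq> nbrs G v}"
  have "inj_on (insert v) ?E"
    by (rule inj_onI) (use tri_insert(2)[OF G] in \<open>auto simp: insert_ident\<close>)
  then have "card ?E = card (insert v ` ?E)" by (simp add: card_image)
  also have "\<dots> \<le> card {T \<in> tri G. v \<in> T}"
    using finite_tri[OF G] tri_insert(1)[OF G] by (intro card_mono) auto
  finally have "card {T \<in> tri G. v \<notin> T} + card ?E \<le> card {T \<in> tri G. v \<notin> T} + card {T \<in> tri G. v \<in> T}" by simp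
  also have "\<dots> = card ({T \<in> tri G. v \<notin> T} \<union> {T \<in> tri G. v \<in> T})"
    using finite_tri[OF G] by (intro card_Un_disjoint[symmetric]) auto
  also have "{T \<in> tri G. v \<notin> T} \<union> {T \<in> tri G. v \<in> T} = tri G" by auto
  finally show ?thesis by (simp add: tri_gdel[OF G])
qed

lemma card_tri_edel:
  assumes G: "simple_graph G" and "T \<in> tri G" "f \<subseteq> T" "card f = 2"
  shows "card (tri (edel G f)) + 1 \<le> card (tri G)"
proof -
  obtain x y where "f = {x, y}" "x \<noteq> y" using assms(4) by (auto simp: card_2_iff)
  then have "T \<notin> tri (edel G f)" using assms(3) by (auto simp: tri_def adj_def)
  moreover have "tri (edel G f) \<subseteq> tri G" by (auto simp: tri_def adj_def)
  ultimately have "tri (edel G f) \<subset> tri G" using assms(2) by blast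
  then have "card (tri (edel G f)) < card (tri G)" by (rule psubset_card_mono[OF finite_tri[OF G]])
  then show ?thesis by simp
qed

lemma card_tri_edel_le: "simple_graph G \<Longrightarrow> card (tri (edel G f)) \<le> card (tri G)"
  by (rule card_mono[OF finite_tri]) (auto simp: tri_def adj_def)

text \<open>A triangle meets an independent set at most once, so it is counted for only one
  \<open>a\<close>.\<close>

lemma sum_tri_independent:
  assumes G: "simple_graph G" and N: "finite N" "\<And>a b. a \<in> N \<Longrightarrow> b \<in> N \<Longrightarrow> \<not> adj G a b"
  shows "(\<Sum>a\<in>N. card {e \<in> edges G. e \<subseteq> nbrs G a}) \<le> card (tri G)"
proof -
  let ?S = "SIGMA a:N. {e \<in> edges G. e \<subseteq> nbrs G a}"
  have dj: "insert a e \<inter> N = {a}" if "(a, e) \<in> ?S" for a e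
    using that N(2) by (fastforce simp: nbrs_def)
  have "inj_on (\<lambda>(a, e). insert a e) ?S"
  proof (rule inj_onI, clarsimp)
    fix a e b f assume h: "a \<in> N" "e \<in> edges G" "e \<subseteq> nbrs G a" "b \<in> N" "f \<in> edges G" "f \<subseteq> nbrs G b" "insert a e = insert b f"
    then have "a = b" using dj[of a e] dj[of b f] by auto
    then show "a = b \<and> e = f" using h tri_insert(2)[OF G] by (metis insert_ident)
  qed
  then have "card ?S = card ((\<lambda>(a, e). insert a e) ` ?S)" by (simp add: card_image)
  also have "\<dots> \<le> card (tri G)"
    using tri_insert(1)[OF G] by (intro card_mono finite_tri[OF G]) auto
  also have "card ?S = (\<Sum>a\<in>N. card {e \<in> edges G. e \<subseteq> nbrs G a})"
    using N(1) finite_edges[OF G] by (intro card_SigmaI) auto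
  finally show ?thesis by simp
qed

lemma sum_card_tri:
  assumes G: "simple_graph G"
  shows "(\<Sum>v\<in>verts G. card {T \<in> tri G. v \<in> T}) = 3 * card (tri G)"
proof -
  have "(\<Sum>v\<in>verts G. card {T \<in> tri G. v \<in> T}) = (\<Sum>T\<in>tri G. 3)"
  proof (rule sum_multicount_gen)
    show "\<forall>T\<in>tri G. card {v \<in> verts G. v \<in> T} = 3"
    proof
      fix T assume T: "T \<in> tri G"
      then have "{v \<in> verts G. v \<in> T} = T" using tri_subset[OF G] by auto
      then show "card {v \<in> verts G. v \<in> T} = 3" using T by (simp add: tri_def)
    qed
  qed (simp_all add: finite_verts finite_tri G)
  then show ?thesis by simp
qed

text \<open>The neighbours of \<open>v\<close> are independent and, by minimality of the degree, joined to almost all other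
  vertices, so that the edges avoiding them lie in many triangles.\<close>

lemma tri_of_independent_nbrs:
  assumes G: "simple_graph G" and v: "v \<in> verts G" and d: "deg G v = card (verts G) div 2"
    and min: "\<And>w. w \<in> verts G \<Longrightarrow> deg G v \<le> deg G w"
    and ind: "{e \<in> edges G. e \<subseteq> nbrs G v} = {}"
    and e: "(card (verts G))\<^sup>2 div 4 + q = card (edges G)"
    and nq: "q = 2 \<or> even (card (verts G))"
  shows "q * (card (verts G) div 2) \<le> card (tri G)"
proof -
  let ?V = "verts G" and ?N = "nbrs G v" and ?m = "card (verts G) div 2"
  let ?R = "?V - ?N" and ?GR = "gdel G ?N"
  have fin: "finite ?V" "finite ?N" using G by (simp_all add: finite_verts)
  have NV: "?N \<subseteq> ?V - {v}" by (rule nbrs_subset[OF G])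
  have ind': "\<not> adj G a b" if "a \<in> ?N" "b \<in> ?N" for a b
    using ind that unfolding adj_def by blast
  have sub: "nbrs G a \<subseteq> ?R" if "a \<in> ?N" for a
    using ind' that adj_verts[OF G] by (auto simp: nbrs_def)
  have cR: "card ?R = card ?V - ?m"
    using NV fin d by (subst card_Diff_subset) (auto simp: deg_def)
  have dl: "?m \<le> deg G a" "deg G a \<le> card ?R" if "a \<in> ?N" for a
  proof -
    have "a \<in> ?V" using that NV by blast
    then show "?m \<le> deg G a" using min d by metis
    show "deg G a \<le> card ?R" unfolding deg_def by (rule card_mono) (use fin sub[OF that] in auto)
  qed
  have eR: "card (edges G) \<le> card (edges ?GR) + (\<Sum>a\<in>?N. deg G a)"
    by (rule card_edges_gdel_ge[OF G fin(2)])
  have st: "(\<Sum>a\<in>?N. card {e \<in> edges G. e \<subseteq> nbrs G a}) \<le> card (tri G)"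
    by (rule sum_tri_independent[OF G fin(2) ind'])
  have full: "edges ?GR \<subseteq> {e \<in> edges G. e \<subseteq> nbrs G a}" if "nbrs G a = ?R" for a
    using that G by (auto simp: gdel_def simple_graph_def)
  have fullc: "card (edges ?GR) \<le> card {e \<in> edges G. e \<subseteq> nbrs G a}" if "a \<in> ?N" "deg G a = card ?R" for a
  proof -
    have "nbrs G a = ?R" using that sub fin by (intro card_subset_eq) (auto simp: deg_def)
    then show ?thesis by (intro card_mono full) (use finite_edges[OF G] in auto)
  qed
  have cN: "card ?N = ?m" using d by (simp add: deg_def)
  show ?thesis
  proof (cases "even (card ?V)")
    case True
    then obtain m where m: "card ?V = 2 * m" by (elim evenE)
    \<comment> \<open>For even order the minimum degree equals \<open>card ?R\<close>, so every
      neighbour of \<open>v\<close> is joined to all of \<open>?R\<close>.\<close>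
    have eq: "deg G a = card ?R" if "a \<in> ?N" for a using dl[OF that] cR m by simp
    then have "(\<Sum>a\<in>?N. deg G a) = m * m" using cN cR m by simp
    then have q: "q \<le> card (edges ?GR)" using eR e m square_div_4(1)[of m] by simp
    have "m * q = (\<Sum>a\<in>?N. q)" using cN m by simp
    also have "\<dots> \<le> (\<Sum>a\<in>?N. card {e \<in> edges G. e \<subseteq> nbrs G a})"
      by (rule sum_mono) (use fullc eq q in \<open>meson order.trans\<close>)
    finally show ?thesis using st m by (simp add: mult.commute)
  next
    case False
    then obtain m where m: "card ?V = 2 * m + 1" by (elim oddE)
    have q: "q = 2" using nq False by simp
    have cR': "card ?R = m + 1" "card ?N = m" using cR cN m by simp_all
    \<comment> \<open>The neighbours of \<open>v\<close> that miss exactly one vertex of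
      \<open>?R\<close>.\<close>
    define D where "D = {a \<in> ?N. deg G a = m}"
    have dg: "deg G a + (if a \<in> D then 1 else 0) = m + 1" if "a \<in> ?N" for a
      using dl[OF that] cR' m that by (auto simp: D_def)
    have indD: "(\<Sum>a\<in>?N. if a \<in> D then x else 0) = card D * x" for x :: nat
    proof -
      have "(\<Sum>a\<in>?N. if a \<in> D then x else 0) = (\<Sum>a\<in>?N \<inter> {a. a \<in> D}. x)" using fin by (simp add: sum.If_cases)
      moreover have "?N \<inter> {a. a \<in> D} = D" by (auto simp: D_def)
      ultimately show ?thesis by simp
    qed
    have "(\<Sum>a\<in>?N. deg G a) + card D = (\<Sum>a\<in>?N. deg G a + (if a \<in> D then 1 else 0))"
      using indD[of 1] by (simp add: sum.distrib)
    also have "\<dots> = (\<Sum>a\<in>?N. m + 1)" by (rule sum.cong) (use dg in auto)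
    finally have sd: "(\<Sum>a\<in>?N. deg G a) + card D = m * m + m" using cR' by simp
    \<comment> \<open>Each missing edge must be made up for by an edge inside
      \<open>?R\<close>.\<close>
    then have eR2: "card D + 2 \<le> card (edges ?GR)" using eR e q m square_div_4(2)[of m] by simp
    \<comment> \<open>A vertex in \<open>D\<close> misses some \<open>x\<close>, and so loses the
      edges of \<open>?GR\<close> at \<open>x\<close>. There are at most \<open>m - 1\<close> of
      them: \<open>v\<close> has no neighbour in \<open>?R\<close>, which leaves the vertices of
      \<open>?R\<close> other than \<open>v\<close> and \<open>x\<close>.\<close>
    have each: "card (edges ?GR) \<le> card {e \<in> edges G. e \<subseteq> nbrs G a} + (if a \<in> D then m - 1 else 0)"
      if a: "a \<in> ?N" for a
    proof (cases "a \<in> D")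
      case False
      then show ?thesis using fullc[OF a] dg[OF a] cR' by simp
    next
      case True
      have "card (?R - nbrs G a) = 1"
        using True cR' sub[OF a] fin finite_nbrs[OF G, of a]
        by (subst card_Diff_subset) (auto simp: D_def deg_def)
      then obtain x where x: "?R - nbrs G a = {x}" by (auto simp: card_1_singleton_iff)
      have xv: "x \<noteq> v"
        using x a adj_sym[of G v a] by (auto simp: nbrs_def)
      have "edges (gdel ?GR {x}) \<subseteq> {e \<in> edges G. e \<subseteq> nbrs G a}"
        using x G by (fastforce simp: gdel_def simple_graph_def)
      then have 1: "card (edges (gdel ?GR {x})) \<le> card {e \<in> edges G. e \<subseteq> nbrs G a}"
        by (intro card_mono) (use finite_edges[OF G] in auto)
      have 2: "card (edges (gdel ?GR {x})) + deg ?GR x = card (edges ?GR)"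
        by (rule card_edges_gdel) (use G in simp)
      have "nbrs ?GR x \<subseteq> ?R - {v, x}"
        using adj_verts[OF G] adj_neq[OF G] x by (auto simp: nbrs_def adj_sym)
      then have "deg ?GR x \<le> card (?R - {v, x})"
        unfolding deg_def by (intro card_mono) (use fin in auto)
      moreover have "card (?R - {v, x}) = m - 1"
      proof -
        have "v \<in> ?R" "x \<in> ?R" using v x adj_neq[OF G] by (auto simp: nbrs_def)
        then show ?thesis using xv cR' fin by (subst card_Diff_subset) auto
      qed
      ultimately show ?thesis using 1 2 True by simp
    qed
    have "m * card (edges ?GR) = (\<Sum>a\<in>?N. card (edges ?GR))" using cR' by simp
    also have "\<dots> \<le> (\<Sum>a\<in>?N. card {e \<in> edges G. e \<subseteq> nbrs G a} + (if a \<in> D then m - 1 else 0))"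
      by (rule sum_mono) (use each in auto)
    also have "\<dots> = (\<Sum>a\<in>?N. card {e \<in> edges G. e \<subseteq> nbrs G a}) + card D * (m - 1)"
      by (simp only: sum.distrib indD)
    finally have "m * card (edges ?GR) \<le> card (tri G) + card D * (m - 1)" using st by linarith
    moreover have "m * (card D + 2) \<le> m * card (edges ?GR)" by (rule mult_le_mono2[OF eR2])
    moreover have "card D * (m - 1) \<le> m * card D" by (simp add: mult.commute)
    ultimately have "m * 2 \<le> card (tri G)" by (simp add: algebra_simps)
    then show ?thesis using q m by simp
  qed
qed

text \<open>A neighbour of \<open>v\<close> has at least \<open>deg G v\<close> neighbours, of which
  at most \<open>card (verts G) - deg G v\<close> lie outside the neighbourhood of
  \<open>v\<close>.\<close>

lemma edges_in_nbrs_ge: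
  assumes G: "simple_graph G" and v: "v \<in> verts G" and min: "\<And>w. w \<in> verts G \<Longrightarrow> deg G v \<le> deg G w"
  shows "deg G v * (2 * deg G v - card (verts G)) \<le> 2 * card {e \<in> edges G. e \<subseteq> nbrs G v}"
proof -
  let ?N = "nbrs G v" and ?n = "card (verts G)"
  let ?GN = "gdel G (verts G - ?N)"
  have fin: "finite (verts G)" "finite ?N" using G by (simp_all add: finite_verts)
  have NV: "?N \<subseteq> verts G" using nbrs_subset[OF G] by blast
  have V: "verts ?GN = ?N" using NV by auto
  have "2 * deg G v - ?n \<le> deg ?GN a" if a: "a \<in> ?N" for a
  proof -
    have "nbrs ?GN a = nbrs G a - (verts G - ?N)" using a by (intro nbrs_gdel) simp
    then have "nbrs G a \<subseteq> nbrs ?GN a \<union> (verts G - ?N)" by blast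
    then have "deg G a \<le> card (nbrs ?GN a \<union> (verts G - ?N))"
      unfolding deg_def using fin G by (intro card_mono) auto
    also have "\<dots> \<le> deg ?GN a + card (verts G - ?N)" unfolding deg_def by (rule card_Un_le)
    also have "card (verts G - ?N) = ?n - deg G v" using NV fin by (simp add: card_Diff_subset deg_def)
    finally have "deg G v \<le> deg ?GN a + (?n - deg G v)" using min[of a] a NV by auto
    then show ?thesis using deg_less[OF G v] by linarith
  qed
  then have "(\<Sum>a\<in>?N. 2 * deg G v - ?n) \<le> (\<Sum>a\<in>?N. deg ?GN a)" by (rule sum_mono)
  also have "\<dots> = 2 * card (edges ?GN)" using handshake[of ?GN] G V by simp
  also have "edges ?GN \<subseteq> {e \<in> edges G. e \<subseteq> ?N}" using G by (auto simp: gdel_def simple_graph_def)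
  then have "card (edges ?GN) \<le> card {e \<in> edges G. e \<subseteq> ?N}"
    using finite_edges[OF G] by (intro card_mono) auto
  finally show ?thesis by (simp add: deg_def)
qed

text \<open>Both bounds go through one induction because a vertex or edge deletion may lead from one
  range of \<open>q\<close> to the other. For \<open>q = 1\<close> only the weaker bound is
  available, attained by a balanced complete bipartite graph with one added edge.\<close>

lemma num_triangles:
  assumes "simple_graph G" "(card (verts G))\<^sup>2 div 4 + q = card (edges G)"
  shows "1 \<le> q \<Longrightarrow> card (verts G) div 2 + q \<le> card (tri G) + 1"
    and "2 \<le> q \<Longrightarrow> card (verts G) + q \<le> card (tri G) + 3"
proof -
  have "(1 \<le> q \<longrightarrow> card (verts G) div 2 + q \<le> card (tri G) + 1)
      \<and> (2 \<le> q \<longrightarrow> card (verts G) + q \<le> card (tri G) + 3)"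
    using assms
  proof (induction "card (verts G) + card (edges G)" arbitrary: G q rule: less_induct)
    case less
    note G = less.prems(1)
    let ?n = "card (verts G)" and ?e = "card (edges G)"
    have n3: "3 \<le> ?n" if "1 \<le> q"
    proof (rule ccontr)
      assume "\<not> ?thesis"
      then have "?n = 0 \<or> ?n = 1 \<or> ?n = 2" by auto
      then show False using card_edges_le_choose[OF G] less.prems(2) that by (auto simp: power2_eq_square)
    qed
    have IHe: "(2 \<le> q \<longrightarrow> ?n div 2 + q \<le> card (tri (edel G f)) + 2) \<and> (3 \<le> q \<longrightarrow> ?n + q \<le> card (tri (edel G f)) + 4)"
      if f: "f \<in> edges G" "1 \<le> q" for f
    proof -
      have c: "card (edges (edel G f)) + 1 = ?e" by (rule card_edges_edel[OF G f(1)])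
      have "(1 \<le> q - 1 \<longrightarrow> card (verts (edel G f)) div 2 + (q - 1) \<le> card (tri (edel G f)) + 1)
        \<and> (2 \<le> q - 1 \<longrightarrow> card (verts (edel G f)) + (q - 1) \<le> card (tri (edel G f)) + 3)"
      proof (rule less.hyps)
        show "card (verts (edel G f)) + card (edges (edel G f)) < ?n + ?e" unfolding verts_edel using c by linarith
        show "(card (verts (edel G f)))\<^sup>2 div 4 + (q - 1) = card (edges (edel G f))"
          unfolding verts_edel using c less.prems(2) f(2) by linarith
      qed (use G in simp)
      then show ?thesis unfolding verts_edel by linarith
    qed
    \<comment> \<open>Deleting any edge leaves a triangle by induction, so some edge lies on
      one.\<close>
    have del: "\<exists>f\<in>edges G. card (tri (edel G f)) + 1 \<le> card (tri G)" if q: "2 \<le> q"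
    proof -
      have "edges G \<noteq> {}" using q less.prems(2) by (metis add_is_0 card.empty not_numeral_le_zero)
      then obtain f where f: "f \<in> edges G" by blast
      have "2 \<le> card (tri (edel G f)) + 1" using IHe[OF f] q n3 by linarith
      then have "0 < card (tri G)" using card_tri_edel_le[OF G, of f] by linarith
      then obtain T where T: "T \<in> tri G" by (metis card.empty equals0I less_irrefl)
      then obtain x y z where "T = {x, y, z}" "x \<noteq> y" by (auto simp: tri_def card_3_iff)
      then have "{x, y} \<in> edges G" "{x, y} \<subseteq> T" "card {x, y} = 2" using T by (auto simp: tri_def adj_def)
      then show ?thesis using card_tri_edel[OF G T] by blast
    qed
    show ?case
    proof (cases "q = 0 \<or> 3 \<le> q")
      case True
      then show ?thesis
      proof
        assume q: "3 \<le> q"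
        then obtain f where f: "f \<in> edges G" "card (tri (edel G f)) + 1 \<le> card (tri G)" using del by auto
        have "?n div 2 + q \<le> card (tri (edel G f)) + 2" "?n + q \<le> card (tri (edel G f)) + 4"
          using IHe[OF f(1)] q by auto
        then show ?thesis using f(2) by linarith
      qed auto
    next
      case False
      then have q: "q = 1 \<or> q = 2" by auto
      then have q1: "1 \<le> q" by auto
      note n3 = n3[OF q1]
      have ne: "verts G \<noteq> {}" using n3 by auto
      obtain v where v: "v \<in> verts G" "?n * deg G v \<le> 2 * ?e" "\<And>w. w \<in> verts G \<Longrightarrow> deg G v \<le> deg G w"
        using min_deg[OF G ne] by blast
      let ?G = "\<lambda>w. gdel G {w}"
      let ?E = "{e \<in> edges G. e \<subseteq> nbrs G v}"
      have c: "?n = Suc (card (verts (?G w)))" if "w \<in> verts G" for w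
        using that n3 card_verts_gdel_single[OF G that] by simp
      have ce: "card (edges (?G w)) + deg G w = ?e" for w by (rule card_edges_gdel[OF G])
      have sq: "?n\<^sup>2 div 4 = (card (verts (?G w)))\<^sup>2 div 4 + ?n div 2" if "w \<in> verts G" for w
        unfolding c[OF that] by (rule square_div_4_Suc)
      have tg: "card (tri (?G v)) + card ?E \<le> card (tri G)" by (rule card_tri_gdel[OF G])
      have IHw: "(1 \<le> q' \<longrightarrow> card (verts (?G w)) div 2 + q' \<le> card (tri (?G w)) + 1)
          \<and> (2 \<le> q' \<longrightarrow> card (verts (?G w)) + q' \<le> card (tri (?G w)) + 3)"
        if "q' + deg G w = q + ?n div 2" "w \<in> verts G" for q' w
      proof (rule less.hyps)
        show "card (verts (?G w)) + card (edges (?G w)) < ?n + ?e" using c[OF that(2)] ce[of w] by linarith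
        show "(card (verts (?G w)))\<^sup>2 div 4 + q' = card (edges (?G w))"
          using sq[OF that(2)] ce[of w] that(1) less.prems(2) by linarith
      qed (use G in simp)
      note IH = IHw[OF _ v(1)]
      note c = c[OF v(1)] c
      have c2: "?n \<le> 2 * (?n div 2) + 1" by simp
      show ?thesis
      proof (cases "deg G v \<le> ?n div 2")
        case True
        show ?thesis
        proof (cases "deg G v = ?n div 2")
          case False
          define q' where "q' = q + ?n div 2 - deg G v"
          have "q' + deg G v = q + ?n div 2" "q + 1 \<le> q'" using True False by (auto simp: q'_def)
          then show ?thesis using IH[of q'] tg c(1) q1 n3 q by linarith
        next
          case d: True
          show ?thesis
          proof (cases "?E = {}")
            case False
            then have "1 \<le> card ?E" using finite_edges[OF G] by (simp add: Suc_le_eq card_gt_0_iff)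
            then show ?thesis using IH[of q] tg c(1) q d by linarith
          next
            case True
            consider "q = 2 \<or> even ?n" | "q = 1" "odd ?n" using q by auto
            then show ?thesis
            proof cases
              case 1
              have "q * (?n div 2) \<le> card (tri G)"
                by (rule tri_of_independent_nbrs[OF G v(1) d v(3) True less.prems(2) 1])
              then show ?thesis using q c2 n3 by auto
            next
              \<comment> \<open>For odd \<open>?n\<close> the deletion of \<open>v\<close> leaves
                \<open>?n div 2\<close> unchanged, so nothing is lost.\<close>
              case 2
              then have "?n div 2 = card (verts (?G v)) div 2" using c(1) by presburger
              then show ?thesis using IH[of q] tg 2 d by linarith
            qed
          qed
        qed
      next
        case False
        then have "?n * (?n div 2 + 1) \<le> ?n * deg G v" by (intro mult_le_mono) auto
        then have le: "?n * (?n div 2 + 1) \<le> 2 * ?e" using v(2) by simp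
        have d: "?n \<le> 2 * (deg G v - 1) + 1" using False by linarith
        \<comment> \<open>A minimum degree above \<open>?n div 2\<close> is compatible with the
          number of edges only in these cases.\<close>
        have small: "?n = 3 \<and> q = 1 \<or> ?n = 4 \<and> q = 2 \<or> ?n = 5 \<and> q = 2 \<or> ?n = 7 \<and> q = 2"
        proof (cases "even ?n")
          case True
          then obtain m where m: "?n = 2 * m" by (elim evenE)
          then have "2 * (m * (m + 1)) \<le> 2 * (m * m + q)" using le less.prems(2) square_div_4(1)[of m] by simp
          then have "m \<le> q" by (simp add: algebra_simps)
          then show ?thesis using m q n3 by auto
        next
          case False
          then obtain m where m: "?n = 2 * m + 1" by (elim oddE)
          then have "(2 * m + 1) * (m + 1) \<le> 2 * (m * m + m + q)" using le less.prems(2) square_div_4(2)[of m] by simp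
          then have m': "m + 1 \<le> 2 * q" by (simp add: algebra_simps)
          have "\<not> (m = 1 \<and> q = 2)"
          proof
            assume "m = 1 \<and> q = 2"
            then have "?n = 3" "?e = 4" using m less.prems(2) by (simp_all add: power2_eq_square)
            then show False using card_edges_le_choose[OF G] by simp
          qed
          then have "m = 1 \<and> q = 1 \<or> m = 2 \<and> q = 2 \<or> m = 3 \<and> q = 2" using m' q n3 m by auto
          then show ?thesis using m by auto
        qed
        have e': "?e = ?n\<^sup>2 div 4 + q" using less.prems(2) by simp
        have dv: "deg G v = ?n div 2 + 1"
          using small v(2) False e' by (auto simp: power2_eq_square)
        have E: "(?n div 2 + 1) * (2 * (?n div 2 + 1) - ?n) \<le> 2 * card ?E"
          using edges_in_nbrs_ge[OF G v(1,3)] dv by simp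
        have IH1: "2 \<le> q \<longrightarrow> card (verts (?G v)) div 2 \<le> card (tri (?G v))"
          using IH[of "q - 1"] dv q by auto
        consider "?n = 3" "q = 1" | "?n = 4" "q = 2" | "?n = 5" "q = 2" | "?n = 7" "q = 2" using small by blast
        then show ?thesis
        proof cases
          case 1 then show ?thesis using E tg by simp
        next
          case 2 then show ?thesis using E tg IH1 c(1) by simp
        next
          case 3 then show ?thesis using E tg IH1 c(1) by simp
        next
          case 4
          have t5: "5 \<le> card (tri G)" using 4 E tg IH1 c(1) by simp
          \<comment> \<open>The graph would be 4-regular, and each \<open>G - w\<close> has six
            vertices and excess one, hence three triangles. With five triangles in all, every vertex
            lies on at most two of them, but \<open>3 * 5 > 7 * 2\<close>.\<close>
          have "6 \<le> card (tri G)"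
          proof (rule ccontr)
            assume "\<not> ?thesis"
            then have t: "card (tri G) = 5" using t5 by simp
            have dw: "deg G w = 4" if w: "w \<in> verts G" for w
            proof (rule ccontr)
              assume "deg G w \<noteq> 4"
              then have "4 < deg G w" using v(3)[OF w] dv 4 by simp
              then have "(\<Sum>w\<in>verts G. 4) < (\<Sum>w\<in>verts G. deg G w)"
                using finite_verts[OF G] v(3) dv 4 w by (intro sum_strict_mono_ex1) auto
              then show False using handshake[OF G] e' 4 by (simp add: power2_eq_square)
            qed
            have "card {T \<in> tri G. w \<in> T} \<le> 2" if w: "w \<in> verts G" for w
            proof -
              have c6: "card (verts (?G w)) = 6" using c(2)[OF w] 4 by linarith
              have "(1::nat) + deg G w = q + ?n div 2" using dw[OF w] 4 by simp
              from IHw[OF this w] have "3 \<le> card (tri (?G w))" unfolding c6 by simp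
              moreover have "card (tri G) = card {T \<in> tri G. w \<notin> T} + card {T \<in> tri G. w \<in> T}"
              proof -
                have "tri G = {T \<in> tri G. w \<notin> T} \<union> {T \<in> tri G. w \<in> T}" by blast
                also have "card \<dots> = card {T \<in> tri G. w \<notin> T} + card {T \<in> tri G. w \<in> T}"
                  using finite_tri[OF G] by (intro card_Un_disjoint) auto
                finally show ?thesis .
              qed
              ultimately show ?thesis using t tri_gdel[OF G, of w] by simp
            qed
            then have "(\<Sum>w\<in>verts G. card {T \<in> tri G. w \<in> T}) \<le> (\<Sum>w\<in>verts G. 2)" by (rule sum_mono)
            then show False using sum_card_tri[OF G] t 4 by simp
          qed
          then show ?thesis using 4 by simp
        qed
      qed
    qed
  qed
  then show "1 \<le> q \<Longrightarrow> card (verts G) div 2 + q \<le> card (tri G) + 1"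
    and "2 \<le> q \<Longrightarrow> card (verts G) + q \<le> card (tri G) + 3" by auto
qed

section \<open>Deleting vertices from a Hamilton cycle\<close>

lemma sum_ring:
  assumes "hamc G c"
  shows "(\<Sum>i\<in>{0..<int (card (verts G))}. f (c (i + s))) = (\<Sum>v\<in>verts G. f v)"
proof -
  let ?c = "\<lambda>i. c (i + s)"
  have r: "ring G (card (verts G)) ?c" and R: "range ?c = verts G"
    using assms ring_shift range_shift unfolding hamc_def by metis+
  have "inj_on ?c {0..<int (card (verts G))}" "?c ` {0..<int (card (verts G))} = verts G"
    using ring_inj[OF r, of "int (card (verts G))" 0] ring_range[OF r, of 0] R by simp_all
  then show ?thesis by (metis (no_types, lifting) sum.reindex_cong)
qed

text \<open>Ore's count with multiplicity: neighbours of the first vertex and successors of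
  neighbours of the last one share the same \<open>length ps - 1\<close> positions, and each
  coincidence allows the path to be closed by crossing over.\<close>

lemma path_crossings:
  assumes G: "simple_graph G" and p: "distinct ps" "set ps = verts G" "ps \<noteq> []"
  shows "deg G (hd ps) + deg G (last ps) \<le> (length ps - 1) +
    card {j \<in> {1..<length ps}. adj G (hd ps) (ps ! j) \<and> adj G (last ps) (ps ! (j - 1))}"
proof -
  let ?m = "length ps"
  let ?A = "{j \<in> {1..<?m}. adj G (hd ps) (ps ! j)}" and ?B = "{j \<in> {1..<?m}. adj G (last ps) (ps ! (j - 1))}"
  have hl: "hd ps = ps ! 0" "last ps = ps ! (?m - 1)" using p(3) by (simp_all add: hd_conv_nth last_conv_nth)
  have ix: "\<exists>i<?m. y = ps ! i" if "adj G x y" for x y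
    using adj_verts[OF G that] p(2) by (metis in_set_conv_nth)
  have fin: "finite ?A" "finite ?B" by simp_all
  have "nbrs G (hd ps) \<subseteq> (!) ps ` ?A"
  proof
    fix y assume "y \<in> nbrs G (hd ps)"
    then have a: "adj G (hd ps) y" by (simp add: nbrs_def)
    then obtain i where i: "i < ?m" "y = ps ! i" using ix by blast
    have "i \<noteq> 0" using a i hl adj_neq[OF G] by metis
    then show "y \<in> (!) ps ` ?A" using a i by auto
  qed
  then have A: "deg G (hd ps) \<le> card ?A"
    unfolding deg_def using fin by (meson surj_card_le)
  have "nbrs G (last ps) \<subseteq> (\<lambda>j. ps ! (j - 1)) ` ?B"
  proof
    fix y assume "y \<in> nbrs G (last ps)"
    then have a: "adj G (last ps) y" by (simp add: nbrs_def)
    then obtain i where i: "i < ?m" "y = ps ! i" using ix by blast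
    have "i \<noteq> ?m - 1" using a i hl adj_neq[OF G] by metis
    then have "Suc i \<in> ?B" "y = ps ! (Suc i - 1)" using a i by auto
    then show "y \<in> (\<lambda>j. ps ! (j - 1)) ` ?B" by blast
  qed
  then have B: "deg G (last ps) \<le> card ?B"
    unfolding deg_def using fin by (meson surj_card_le)
  have "card ?A + card ?B = card (?A \<union> ?B) + card (?A \<inter> ?B)" by (rule card_Un_Int) auto
  moreover have "card (?A \<union> ?B) \<le> card {1..<?m}" by (intro card_mono) auto
  moreover have "?A \<inter> ?B = {j \<in> {1..<?m}. adj G (hd ps) (ps ! j) \<and> adj G (last ps) (ps ! (j - 1))}" by auto
  ultimately show ?thesis using A B by simp
qed

lemma nth_take_rev_drop:
  assumes "i \<le> length ps" "k < length ps"
  shows "(take i ps @ rev (drop i ps)) ! k = (if k < i then ps ! k else ps ! (i + length ps - Suc k))"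
proof (cases "k < i")
  case False
  then have "(take i ps @ rev (drop i ps)) ! k = ps ! (i + (length ps - i - Suc (k - i)))"
    using assms by (simp add: nth_append rev_nth)
  moreover have "i + (length ps - i - Suc (k - i)) = i + length ps - Suc k" using False assms by simp
  ultimately show ?thesis using False by simp
qed (use assms in \<open>simp add: nth_append\<close>)

lemma cyc_of_crossing:
  assumes p: "distinct ps" "successively (adj G) ps" "3 \<le> length ps"
    and j: "1 \<le> j" "j < length ps" "adj G (hd ps) (ps ! j)" "adj G (last ps) (ps ! (j - 1))"
  shows "cyc G (take j ps @ rev (drop j ps))"
proof (rule cyc_append)
  have e: "ps = take j ps @ drop j ps" by simp
  show "successively (adj G) (take j ps)" "successively (adj G) (rev (drop j ps))"
    using p(2) e by (metis successively_append_iff successively_rev successively_adj_commute)+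
  show "set (take j ps) \<inter> set (rev (drop j ps)) = {}"
    using p(1) e by (metis distinct_append set_rev)
  have ne: "take j ps \<noteq> []" "drop j ps \<noteq> []" using j by auto
  then show "take j ps \<noteq> []" "rev (drop j ps) \<noteq> []" by auto
  have "take j ps = take (j - 1) ps @ [ps ! (j - 1)]"
    using j take_Suc_conv_app_nth[of "j - 1" ps] by simp
  then have "last (take j ps) = ps ! (j - 1)" by simp
  moreover have "hd (rev (drop j ps)) = last ps" using ne by (simp add: hd_rev)
  ultimately show "adj G (last (take j ps)) (hd (rev (drop j ps)))" using j(4) by (simp add: adj_sym)
  have "last (rev (drop j ps)) = ps ! j" using ne j by (simp add: last_rev hd_drop_conv_nth)
  moreover have "hd (take j ps) = hd ps" using j by (simp add: hd_take)
  ultimately show "adj G (last (rev (drop j ps))) (hd (take j ps))" using j(3) by (simp add: adj_sym)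
qed (use p in auto)

lemma hamiltonian_of_path:
  assumes G: "simple_graph G" and p: "distinct ps" "set ps = verts G" "successively (adj G) ps" "3 \<le> length ps"
    and d: "length ps \<le> deg G (hd ps) + deg G (last ps)"
  shows "hamiltonian G"
proof -
  have "ps \<noteq> []" using p by auto
  then have "1 \<le> card {j \<in> {1..<length ps}. adj G (hd ps) (ps ! j) \<and> adj G (last ps) (ps ! (j - 1))}"
    using path_crossings[OF G p(1,2)] d p(4) by simp
  then have "{j \<in> {1..<length ps}. adj G (hd ps) (ps ! j) \<and> adj G (last ps) (ps ! (j - 1))} \<noteq> {}"
    by (metis card.empty not_one_le_zero)
  then obtain j where "1 \<le> j" "j < length ps" "adj G (hd ps) (ps ! j)" "adj G (last ps) (ps ! (j - 1))" by auto
  from cyc_of_crossing[OF p(1,3,4) this] show ?thesis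
    by (rule hamiltonian_of_cyc[OF G]) (metis append_take_drop_id p(2) set_append set_rev)
qed

text \<open>There are at least three crossings. Those at \<open>1\<close> and at
  \<open>length ps - 1\<close> both mean that the ends of the path are adjacent and give the same
  cycle. A crossing \<open>j\<close> between them drops the path edge before \<open>j\<close>, which
  every other crossing keeps.\<close>

lemma two_cycles_of_path:
  assumes G: "simple_graph G" and p: "distinct ps" "set ps = verts G" "successively (adj G) ps" "3 \<le> length ps"
    and d: "length ps + 2 \<le> deg G (hd ps) + deg G (last ps)"
  shows "2 \<le> num_cycles (length ps) G"
proof -
  let ?m = "length ps"
  let ?J = "{j \<in> {1..<?m}. adj G (hd ps) (ps ! j) \<and> adj G (last ps) (ps ! (j - 1))}"
  let ?Z = "\<lambda>j. take j ps @ rev (drop j ps)"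
  have "ps \<noteq> []" using p by auto
  then have J3: "3 \<le> card ?J"
    using path_crossings[OF G p(1,2)] d p(4) by simp
  have "\<not> ?J \<subseteq> {1, ?m - 1}"
  proof
    assume "?J \<subseteq> {1, ?m - 1}"
    then have "card ?J \<le> card {1, ?m - 1}" by (intro card_mono) auto
    also have "\<dots> \<le> 2" by (simp add: card_insert_if)
    finally show False using J3 by simp
  qed
  then obtain j where j: "j \<in> ?J" "j \<noteq> 1" "j \<noteq> ?m - 1" by auto
  have "\<not> ?J \<subseteq> {j}"
  proof
    assume "?J \<subseteq> {j}"
    then have "card ?J \<le> card {j}" by (intro card_mono) auto
    then show False using J3 by simp
  qed
  then obtain i where i: "i \<in> ?J" "i \<noteq> j" by auto
  have c: "cyc G (?Z i)" "cyc G (?Z j)"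
    using cyc_of_crossing[OF p(1,3,4)] i j by auto
  have dZ: "distinct (?Z j)" using c(2) by (simp add: cyc_def)
  have jl: "1 < j" "j < ?m - 1" using j by auto
  have il: "1 \<le> i" "i < ?m" using i by auto
  have "?Z j ! (j - 1) = ps ! (j - 1)" "?Z j ! (?m - 1) = ps ! j"
    using jl by (simp_all add: nth_take_rev_drop)
  moreover have "{?Z j ! (j - 1), ?Z j ! (?m - 1)} \<notin> cedges (?Z j)"
  proof
    assume "{?Z j ! (j - 1), ?Z j ! (?m - 1)} \<in> cedges (?Z j)"
    moreover have "j - 1 < ?m - 1" "?m - 1 < length (?Z j)" using jl by auto
    ultimately show False using cedges_nth_iff[OF dZ, of "j - 1" "?m - 1"] jl by auto
  qed
  ultimately have "{ps ! (j - 1), ps ! j} \<notin> cedges (?Z j)" by (simp only: not_False_eq_True)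
  moreover have "{ps ! (j - 1), ps ! j} \<in> cedges (?Z i)"
  proof (cases "j < i")
    case True
    then have "?Z i ! (j - 1) = ps ! (j - 1)" "?Z i ! j = ps ! j" using jl il by (simp_all add: nth_take_rev_drop)
    moreover have "{?Z i ! (j - 1), ?Z i ! (Suc (j - 1) mod length (?Z i))} \<in> cedges (?Z i)"
      unfolding cycle_of_list_def using jl by (simp only: snd_conv mem_Collect_eq) (intro exI[of _ "j - 1"], simp)
    ultimately show ?thesis using jl by simp
  next
    case False
    then have ij: "i < j" using i by simp
    define k where "k = i + (?m - 1 - j)"
    have k: "k \<ge> i" "Suc k < ?m" using ij jl by (auto simp: k_def)
    have "?Z i ! k = ps ! j" "?Z i ! Suc k = ps ! (j - 1)"
    proof -
      have "i + ?m - Suc k = j" "i + ?m - Suc (Suc k) = j - 1" using ij jl by (auto simp: k_def)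
      then show "?Z i ! k = ps ! j" "?Z i ! Suc k = ps ! (j - 1)"
        using il k nth_take_rev_drop[of i ps k] nth_take_rev_drop[of i ps "Suc k"] by auto
    qed
    moreover have "{?Z i ! k, ?Z i ! (Suc k mod length (?Z i))} \<in> cedges (?Z i)"
      unfolding cycle_of_list_def using k by (simp only: snd_conv mem_Collect_eq) (intro exI[of _ k], simp)
    ultimately show ?thesis using k by (simp add: insert_commute)
  qed
  ultimately have "cycle_of_list (?Z i) \<noteq> cycle_of_list (?Z j)" by metis
  then show ?thesis by (intro num_cycles_two[OF G c]) auto
qed

lemma hamc_shift: "hamc G c \<Longrightarrow> hamc G (\<lambda>i. c (i + s))"
  unfolding hamc_def using ring_shift range_shift by metis

lemma hamc_reflect: "hamc G c \<Longrightarrow> hamc G (\<lambda>i. c (s - i))"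
  unfolding hamc_def using ring_reflect range_reflect by metis

lemma card_initial_seg:
  assumes "hamc G c" "0 \<le> j" "j \<le> int (card (verts G))"
  shows "card (c ` {0..<j}) = nat j"
proof -
  have r: "ring G (card (verts G)) c" using assms by (simp add: hamc_def)
  have "inj_on c {0..<j}" by (rule ring_inj[OF r]) (use assms in simp)
  then show ?thesis using assms by (simp add: card_image)
qed

lemma remaining_path:
  assumes h: "hamc G c" and j: "0 \<le> j" "j < int (card (verts G))"
  defines "G' \<equiv> gdel G (c ` {0..<j})" and "ps \<equiv> seg c j (int (card (verts G)) - 1)"
  shows "distinct ps" "set ps = verts G'" "successively (adj G') ps"
    "length ps = nat (int (card (verts G)) - j)" "hd ps = c j" "last ps = c (- 1)"
proof -
  let ?n = "card (verts G)"
  have r: "ring G ?n c" and R: "range c = verts G" using h by (auto simp: hamc_def)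
  show "distinct ps" unfolding ps_def by (rule distinct_seg[OF r]) (use j in simp)
  have dj: "c ` {0..<j} \<inter> c ` {j..int ?n - 1} = {}"
  proof -
    have "inj_on c {0..<int ?n}" using ring_inj[OF r, of "int ?n" 0] by simp
    then have "c ` ({0..<j} \<inter> {j..int ?n - 1}) = c ` {0..<j} \<inter> c ` {j..int ?n - 1}"
      using j by (intro inj_on_image_Int) auto
    then show ?thesis by auto
  qed
  have "{0..<0 + int ?n} = {0..<j} \<union> {j..int ?n - 1}" using j by auto
  then have V: "verts G = c ` {0..<j} \<union> c ` {j..int ?n - 1}"
    using ring_range[OF r, of 0] R by (metis image_Un)
  show S: "set ps = verts G'" using V dj by (auto simp: ps_def G'_def)
  have "successively (adj G) ps" unfolding ps_def by (rule successively_seg[OF r])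
  then show "successively (adj G') ps"
    unfolding successively_nth
  proof (intro allI impI)
    fix i assume a: "\<forall>i. Suc i < length ps \<longrightarrow> adj G (ps ! i) (ps ! Suc i)" "Suc i < length ps"
    then have "ps ! i \<in> verts G'" "ps ! Suc i \<in> verts G'" using S by (metis Suc_lessD nth_mem)+
    then show "adj G' (ps ! i) (ps ! Suc i)" using a by (simp add: G'_def)
  qed
  show "length ps = nat (int ?n - j)" by (simp add: ps_def)
  show "hd ps = c j" using j by (simp add: ps_def)
  have "c (int ?n - 1) = c (- 1)" using ring_period(1)[OF r, of "-1"] by simp
  then show "last ps = c (- 1)" using j by (simp add: ps_def)
qed

lemma hamiltonian_gdel_of_deg:
  assumes G: "simple_graph G" and h: "hamc G c" and j: "0 \<le> j" "j + 3 \<le> int (card (verts G))"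
    and d: "int (card (verts G)) \<le> j + int (deg (gdel G (c ` {0..<j})) (c j)) + int (deg (gdel G (c ` {0..<j})) (c (- 1)))"
  shows "hamiltonian (gdel G (c ` {0..<j}))"
proof -
  have j': "j < int (card (verts G))" using j by simp
  note P = remaining_path[OF h j(1) j']
  show ?thesis
  proof (rule hamiltonian_of_path[OF simple_gdel[OF G] P(1-3)], unfold P(4-6) nat_le_iff)
    show "3 \<le> nat (int (card (verts G)) - j)" using j by linarith
  qed (use d in simp)
qed

lemma hamiltonian_gdel_of_chord:
  assumes G: "simple_graph G" and h: "hamc G c" and j: "0 \<le> j" "j + 3 \<le> int (card (verts G))"
    and a: "adj G (c (- 1)) (c j)"
  shows "hamiltonian (gdel G (c ` {0..<j}))"
proof -
  let ?n = "card (verts G)" and ?G = "gdel G (c ` {0..<j})"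
  let ?ps = "seg c j (int ?n - 1)"
  have j': "j < int ?n" using j by simp
  note P = remaining_path[OF h j(1) j']
  have "hd ?ps \<in> set ?ps" "last ?ps \<in> set ?ps" using j by (auto simp del: hd_seg last_seg set_seg)
  then have "c j \<in> verts ?G" "c (- 1) \<in> verts ?G" using P by auto
  then have "adj ?G (c (- 1)) (c j)" using a by simp
  then have "cyc ?G ?ps" unfolding cyc_def using P j by simp
  then show ?thesis by (rule hamiltonian_of_cyc[OF simple_gdel[OF G] _ P(2)])
qed

text \<open>For any offsets the sum is \<open>4 * card (edges G)\<close> minus the square of the
  order. It is used with the two neighbours of a position and with the two ends of a ring
  edge.\<close>

lemma deg_sum_excess:
  assumes G: "simple_graph G" and h: "hamc G c" and e: "(card (verts G))\<^sup>2 div 4 + 1 \<le> card (edges G)"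
  shows "3 \<le> (\<Sum>i\<in>{0..<int (card (verts G))}. int (deg G (c (i + s))) + int (deg G (c (i + t))) - int (card (verts G)))"
proof -
  let ?n = "card (verts G)"
  have a: "(\<Sum>i\<in>{0..<int ?n}. int (deg G (c (i + s)))) = 2 * int (card (edges G))" for s
    using sum_ring[OF h, of "\<lambda>v. int (deg G v)" s] handshake[OF G] by (metis of_nat_mult of_nat_numeral of_nat_sum)
  have "(\<Sum>i\<in>{0..<int ?n}. int (deg G (c (i + s))) + int (deg G (c (i + t))) - int ?n) = 4 * int (card (edges G)) - int ?n * int ?n"
    by (simp add: sum.distrib sum_subtractf a)
  moreover have "?n\<^sup>2 \<le> 4 * (?n\<^sup>2 div 4) + 1"
  proof (cases "even ?n")
    case True
    then show ?thesis by (elim evenE) (simp only: square_div_4(1), simp add: power2_eq_square)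
  next
    case False
    then show ?thesis by (elim oddE) (simp only: square_div_4(2), simp add: power2_eq_square algebra_simps)
  qed
  then have "int ?n * int ?n \<le> 4 * int (?n\<^sup>2 div 4) + 1"
    by (metis (mono_tags) of_nat_1 of_nat_add of_nat_le_iff of_nat_mult of_nat_numeral power2_eq_square)
  ultimately show ?thesis using e by linarith
qed

lemma cyc_mono: "edges H \<subseteq> edges G \<Longrightarrow> cyc H xs \<Longrightarrow> cyc G xs"
  by (auto simp: cyc_iff_cedges)

lemma cyc_gdel: "cyc (gdel G W) xs \<Longrightarrow> cyc G xs"
  by (rule cyc_mono[OF edges_gdel_subset])

lemma ring_gdel: "ring (gdel G W) M c \<Longrightarrow> ring G M c"
  by (auto simp: ring_def)

lemma hamilton_cycle:
  assumes "simple_graph G" "hamiltonian G"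
  obtains xs where "cyc G xs" "set xs = verts G" "length xs = card (verts G)"
proof -
  obtain c where "hamc G c" using assms hamiltonian_iff by blast
  then have r: "ring G (card (verts G)) c" and R: "range c = verts G" by (auto simp: hamc_def)
  have "set (seg c 0 (0 + int (card (verts G)) - 1)) = verts G"
    using ring_range[OF r, of 0] R by (simp add: atLeastLessThanPlusOne_atLeastAtMost_int[symmetric])
  then show ?thesis using that cyc_of_ring[OF r, of 0] by blast
qed

text \<open>The Hamilton cycle minus \<open>c i\<close> is a path whose two ends have each lost the
  neighbour \<open>c i\<close>, whence the \<open>2\<close>.\<close>

lemma path_gdel_vertex:
  assumes G: "simple_graph G" and h: "hamc G c" and n: "4 \<le> card (verts G)"
  obtains ps where "distinct ps" "set ps = verts (gdel G {c i})" "successively (adj (gdel G {c i})) ps"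
    "length ps = card (verts G) - 1"
    "deg G (c (i - 1)) + deg G (c (i + 1)) = deg (gdel G {c i}) (hd ps) + deg (gdel G {c i}) (last ps) + 2"
proof -
  let ?n = "card (verts G)"
  define b where "b = (\<lambda>x. c (x + i))"
  have hb: "hamc G b" unfolding b_def by (rule hamc_shift[OF h])
  have r: "ring G ?n c" using h by (simp add: hamc_def)
  have "b ` {0..<1} = {c i}"
  proof -
    have "{0..<1::int} = {0}" by auto
    then show ?thesis by (simp add: b_def)
  qed
  note P = remaining_path[OF hb, of 1, unfolded this]
  have d: "deg (gdel G {c i}) (c j) + 1 = deg G (c j)" if "j = i - 1 \<or> j = i + 1" for j
  proof -
    have "adj G (c j) (c i)" using that ring_adj[OF r, of "i - 1"] ring_adj[OF r, of i] by (auto simp: adj_sym)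
    moreover from this have "c j \<noteq> c i" "0 < deg G (c j)"
      using adj_neq[OF G] finite_nbrs[OF G, of "c j"] by (auto simp: deg_def card_gt_0_iff nbrs_def)
    ultimately show ?thesis using deg_gdel_single[OF G, of "c j" "c i"] by simp
  qed
  show ?thesis
  proof (rule that[OF P(1-3)])
    show "length (seg b 1 (int ?n - 1)) = ?n - 1" using n by simp
    show "deg G (c (i - 1)) + deg G (c (i + 1)) = deg (gdel G {c i}) (hd (seg b 1 (int ?n - 1))) + deg (gdel G {c i}) (last (seg b 1 (int ?n - 1))) + 2"
      using P(5,6) n d[of "i - 1"] d[of "i + 1"] by (simp add: b_def add.commute)
  qed (use n in auto)
qed

lemma hamiltonian_gdel_vertex:
  assumes G: "simple_graph G" and h: "hamc G c" and n: "4 \<le> card (verts G)"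
    and d: "card (verts G) + 1 \<le> deg G (c (i - 1)) + deg G (c (i + 1))"
  shows "hamiltonian (gdel G {c i})"
proof -
  obtain ps where P: "distinct ps" "set ps = verts (gdel G {c i})" "successively (adj (gdel G {c i})) ps"
    "length ps = card (verts G) - 1"
    "deg G (c (i - 1)) + deg G (c (i + 1)) = deg (gdel G {c i}) (hd ps) + deg (gdel G {c i}) (last ps) + 2"
    by (rule path_gdel_vertex[OF G h n])
  show ?thesis by (rule hamiltonian_of_path[OF simple_gdel[OF G] P(1-3)]) (use P n d in auto)
qed

lemma deg_sum_ge:
  assumes G: "simple_graph G" and h: "hamc G c" and e: "(card (verts G))\<^sup>2 div 4 + 1 \<le> card (edges G)"
  obtains i where "card (verts G) + 1 \<le> deg G (c (i - 1)) + deg G (c (i + 1))"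
proof (rule ccontr)
  assume no: "\<not> thesis"
  have "(\<Sum>i\<in>{0..<int (card (verts G))}. int (deg G (c (i + (- 1)))) + int (deg G (c (i + 1))) - int (card (verts G))) \<le> 0"
  proof (rule sum_nonpos)
    fix i
    have "\<not> card (verts G) + 1 \<le> deg G (c (i - 1)) + deg G (c (i + 1))" using no that by blast
    then show "int (deg G (c (i + (- 1)))) + int (deg G (c (i + 1))) - int (card (verts G)) \<le> 0" by simp
  qed
  then show False using deg_sum_excess[OF G h e, of "-1" 1] by simp
qed

text \<open>The total excess is at least three. Either two positions have positive excess, and the
  cycles obtained miss different vertices, or one position has excess at least three, enough for
  \<open>two_cycles_of_path\<close>.\<close>

lemma two_almost_hamilton_cycles:
  assumes G: "simple_graph G" and h: "hamc G c" and n: "4 \<le> card (verts G)"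
    and e: "(card (verts G))\<^sup>2 div 4 + 1 \<le> card (edges G)"
  shows "2 \<le> num_cycles (card (verts G) - 1) G"
proof -
  let ?n = "card (verts G)"
  have r: "ring G ?n c" and R: "range c = verts G" using h by (auto simp: hamc_def)
  define f where "f i = int (deg G (c (i + (- 1)))) + int (deg G (c (i + 1))) - int ?n" for i
  have s: "3 \<le> (\<Sum>i\<in>{0..<int ?n}. f i)"
    unfolding f_def by (rule deg_sum_excess[OF G h e])
  obtain i where i: "i \<in> {0..<int ?n}" "0 < f i"
  proof (rule ccontr)
    assume "\<not> thesis"
    then have "(\<Sum>i\<in>{0..<int ?n}. f i) \<le> 0" using that by (intro sum_nonpos) (meson linorder_not_less)
    then show False using s by simp
  qed
  show ?thesis
  proof (cases "\<exists>j\<in>{0..<int ?n}. j \<noteq> i \<and> 0 < f j")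
    case True
    then obtain j where j: "j \<in> {0..<int ?n}" "j \<noteq> i" "0 < f j" by blast
    have cij: "c i \<noteq> c j" using ring_inj[OF r, of "int ?n" 0] i j by (auto dest: inj_onD)
    have ham: "hamiltonian (gdel G {c k})" if "0 < f k" for k
      by (rule hamiltonian_gdel_vertex[OF G h n]) (use that in \<open>simp add: f_def\<close>)
    have len: "card (verts (gdel G {c k})) = ?n - 1" for k
      by (rule card_verts_gdel_single[OF G]) (use R in auto)
    obtain xs where xs: "cyc (gdel G {c i}) xs" "set xs = verts (gdel G {c i})" "length xs = ?n - 1"
      using hamilton_cycle[OF simple_gdel[OF G] ham[OF i(2)]] unfolding len by blast
    obtain ys where ys: "cyc (gdel G {c j}) ys" "set ys = verts (gdel G {c j})" "length ys = ?n - 1"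
      using hamilton_cycle[OF simple_gdel[OF G] ham[OF j(3)]] unfolding len by blast
    have "c i \<in> set ys" "c i \<notin> set xs" using xs(2) ys(2) cij R by auto
    then have "set xs \<noteq> set ys" by blast
    then have "cycle_of_list xs \<noteq> cycle_of_list ys" by (simp add: cycle_of_list_def)
    then show ?thesis using num_cycles_two[OF G cyc_gdel[OF xs(1)] cyc_gdel[OF ys(1)] xs(3) ys(3)] by blast
  next
    case False
    then have "(\<Sum>j\<in>{0..<int ?n} - {i}. f j) \<le> 0" by (intro sum_nonpos) force
    moreover have "(\<Sum>j\<in>{0..<int ?n}. f j) = f i + (\<Sum>j\<in>{0..<int ?n} - {i}. f j)"
      using i by (intro sum.remove) auto
    ultimately have "3 \<le> f i" using s by simp
    then have d: "?n + 3 \<le> deg G (c (i - 1)) + deg G (c (i + 1))" by (simp add: f_def)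
    obtain ps where P: "distinct ps" "set ps = verts (gdel G {c i})" "successively (adj (gdel G {c i})) ps"
      "length ps = ?n - 1"
      "deg G (c (i - 1)) + deg G (c (i + 1)) = deg (gdel G {c i}) (hd ps) + deg (gdel G {c i}) (last ps) + 2"
      by (rule path_gdel_vertex[OF G h n])
    have "2 \<le> num_cycles (length ps) (gdel G {c i})"
      by (rule two_cycles_of_path[OF simple_gdel[OF G] P(1-3)]) (use P n d in auto)
    moreover have "3 \<le> ?n - 1" using n by linarith
    ultimately show ?thesis using num_cycles_gdel_le[OF G, of "?n - 1" "{c i}"] P(4) by simp
  qed
qed

text \<open>A set of more than half of the positions meets its translate by
  \<open>l - 2\<close>.\<close>

lemma hits_of_many_nbrs:
  assumes r: "ring G M c" and v: "v \<notin> range c" and l: "5 \<le> l" "l \<le> M"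
    and A: "M < 2 * card {x \<in> range c. adj G v x}"
  shows "hits G l {v}"
proof (rule ccontr)
  assume no: "\<not> hits G l {v}"
  define p where "p = int l - 2"
  define a where "a i = adj G v (c i)" for i
  have per: "a (i + int M) = a i" for i using ring_period(1)[OF r, of i] by (simp add: a_def)
  have cA: "M < 2 * cnt M a" using A unfolding a_def cnt_ring[OF r] .
  have noA: "\<not> (a i \<and> a (i + p))" for i
    using not_hits_chords(1)[OF r v l no, of i] by (simp add: a_def p_def)
  have e: "(\<lambda>i. a i \<and> a (i + p)) = (\<lambda>i. False)" using noA by auto
  have "cnt M (\<lambda>i. a (i + p)) = cnt M a" by (rule cnt_shift) (rule per)
  then have "2 * cnt M a = cnt M (\<lambda>i. a i \<or> a (i + p))"
    using cnt_disj[of M a "\<lambda>i. a (i + p)"] unfolding e by simp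
  also have "\<dots> \<le> M" using cnt_not[of M "\<lambda>i. a i \<or> a (i + p)"] by simp
  finally show False using cA by simp
qed

text \<open>The assumption \<open>IH\<close> is the induction hypothesis of the lemma \<open>num_long_cycles\<close>.\<close>

locale critical_graph =
  fixes G :: "'a graph" and l n :: nat
  assumes G: "simple_graph G" and n: "card (verts G) = n"
    and e: "card (edges G) = n\<^sup>2 div 4 + 1"
    and l: "5 \<le> l" "l + 2 \<le> n"
    and IH: "\<And>H. simple_graph H \<Longrightarrow> hamiltonian H \<Longrightarrow> card (verts H) < n \<Longrightarrow> l \<le> card (verts H) \<Longrightarrow>
      (card (verts H :: 'a set))\<^sup>2 div 4 + 1 \<le> card (edges H) \<Longrightarrow>
      card (verts H) + card (edges H) \<le> num_cycles l H + l + (card (verts H))\<^sup>2 div 4"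
begin

text \<open>The induction hypothesis yields \<open>m - l + q\<close> cycles avoiding
  \<open>W\<close>. This suffices if \<open>q\<close> exceeds \<open>card W\<close>; if they are
  equal, one cycle meeting \<open>W\<close> makes up the difference.\<close>

lemma gdel_enough:
  assumes W: "W \<noteq> {}" "W \<subseteq> verts G" and h: "hamiltonian (gdel G W)" and m: "n - card W = m" "l \<le> m"
    and q: "m\<^sup>2 div 4 + q = card (edges (gdel G W))" "1 \<le> q"
    and enough: "card W + 1 \<le> q \<or> card W \<le> q \<and> hits G l W"
  shows "n + 1 \<le> num_cycles l G + l"
proof -
  have fin: "finite (verts G)" by (rule finite_verts[OF G])
  have cW: "card W \<le> n" "0 < card W" using W fin card_mono[OF fin W(2)] n finite_subset by (auto simp: card_gt_0_iff)
  have cV: "card (verts (gdel G W)) = m" using W fin m n finite_subset[OF W(2) fin] by (simp add: card_Diff_subset)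
  have I: "m + q \<le> num_cycles l (gdel G W) + l"
  proof -
    have "m < n" using cW m by linarith
    moreover have "m\<^sup>2 div 4 + 1 \<le> card (edges (gdel G W))" using q by linarith
    ultimately have "m + card (edges (gdel G W)) \<le> num_cycles l (gdel G W) + l + m\<^sup>2 div 4"
      using IH[OF simple_gdel[OF G] h, unfolded cV] m by blast
    then show ?thesis using q by linarith
  qed
  show ?thesis
  proof (cases "card W + 1 \<le> q")
    case True
    then show ?thesis using I num_cycles_gdel_le[OF G, of l W] l m cW by simp
  next
    case False
    then obtain xs where "cyc G xs" "length xs = l" "set xs \<inter> W \<noteq> {}" "card W \<le> q"
      using enough by (auto simp: hits_def)
    then show ?thesis using I num_cycles_gdel[OF G, of xs l W] m cW by simp
  qed
qed

text \<open>Below degree \<open>n div 2\<close> the excess grows and \<open>gdel_enough\<close>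
  applies at once. At degree \<open>n div 2\<close> an \<open>l\<close>-cycle through
  \<open>v\<close> is missing. For odd \<open>n\<close> the neighbours of \<open>v\<close> fill just
  half of the ring; a second vertex \<open>?u\<close> is then removed to pass to a ring of odd
  length.\<close>

lemma low_removable:
  assumes v: "v \<in> verts G" and h: "hamiltonian (gdel G {v})" and d: "deg G v \<le> n div 2"
  shows "n + 1 \<le> num_cycles l G + l"
proof -
  let ?G = "gdel G {v}"
  define N where "N = n - 1"
  have nN: "n = Suc N" using l by (simp add: N_def)
  have cV: "card (verts ?G) = N" using card_verts_gdel_single[OF G v] n nN by simp
  have sq: "n\<^sup>2 div 4 = N\<^sup>2 div 4 + n div 2" unfolding nN by (rule square_div_4_Suc)
  have ce: "card (edges ?G) + deg G v = card (edges G)" by (rule card_edges_gdel[OF G])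
  define q where "q = 1 + n div 2 - deg G v"
  have q: "N\<^sup>2 div 4 + q = card (edges ?G)" using sq ce e d unfolding q_def by linarith
  note enough = gdel_enough[OF _ _ h, of N q, OF _ _ _ _ q]
  show ?thesis
  proof (cases "deg G v = n div 2")
    case False
    then have "2 \<le> q" using d by (simp add: q_def)
    then show ?thesis by (intro enough) (use v l nN in auto)
  next
    case dv: True
    then have q1: "q = 1" by (simp add: q_def)
    obtain c where c: "hamc ?G c" using h hamiltonian_iff[OF simple_gdel[OF G]] by blast
    have rG: "ring ?G N c" and R: "range c = verts G - {v}" using c cV by (auto simp: hamc_def)
    note r = ring_gdel[OF rG]
    have A: "{x \<in> range c. adj G v x} = nbrs G v"
      using R adj_verts[OF G] adj_irrefl[OF G] by (auto simp: nbrs_def)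
    have "n + 1 \<le> num_cycles l G + l" if "hits G l {v}"
      using enough v l nN q1 that by simp
    \<comment> \<open>For even \<open>n\<close>, \<open>n div 2\<close> is more than half of
      \<open>N = n - 1\<close>.\<close>
    moreover have "hits G l {v}" if "even n"
    proof (rule hits_of_many_nbrs[OF r])
      show "N < 2 * card {x \<in> range c. adj G v x}" using dv that nN unfolding A deg_def by auto
    qed (use R l nN in auto)
    moreover have "n + 1 \<le> num_cycles l G + l \<or> hits G l {v}" if odd: "odd n"
    proof -
      define M where "M = n - 2"
      have M: "N = Suc M" "n = M + 2" "odd M" "l \<le> M" using l odd by (auto simp: M_def N_def)
      have eN: "(card (verts ?G))\<^sup>2 div 4 + 1 \<le> card (edges ?G)" using cV q q1 by simp
      obtain i where i: "N + 1 \<le> deg ?G (c (i - 1)) + deg ?G (c (i + 1))"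
        using deg_sum_ge[OF simple_gdel[OF G] c eN] cV by auto
      let ?u = "c i"
      have hu: "hamiltonian (gdel ?G {?u})"
        by (rule hamiltonian_gdel_vertex[OF simple_gdel[OF G] c]) (use i cV M l in auto)
      have u: "?u \<in> verts G" "?u \<noteq> v" using R by auto
      have GG: "gdel ?G {?u} = gdel G {v, ?u}" by (simp add: gdel_gdel insert_commute)
      let ?H = "gdel G {v, ?u}"
      have cH: "card (verts ?H) = M"
        using card_verts_gdel_single[OF simple_gdel[OF G], of ?u "{v}"] u cV M unfolding GG by simp
      obtain b where b: "hamc ?H b" using hu hamiltonian_iff[OF simple_gdel[OF G]] unfolding GG by blast
      have rH: "ring ?H M b" and RH: "range b = verts G - {v, ?u}" using b cH by (auto simp: hamc_def)
      note rb = ring_gdel[OF rH]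
      have sqN: "N\<^sup>2 div 4 = M\<^sup>2 div 4 + N div 2" unfolding M(1) by (rule square_div_4_Suc)
      have ceH: "card (edges ?H) + deg ?G ?u = card (edges ?G)"
        using card_edges_gdel[OF simple_gdel[OF G], of "{v}" ?u] unfolding GG .
      have EH: "edges ?H = {e \<in> edges G. e \<subseteq> range b}" using G RH by (auto simp: gdel_def simple_graph_def)
      have BB: "{x \<in> range b. adj G ?u x} = nbrs ?G ?u"
        using RH u adj_verts[OF G] adj_irrefl[OF G] by (auto simp: nbrs_def)
      show ?thesis
      proof (cases "deg ?G ?u + 2 \<le> N div 2")
        \<comment> \<open>So small a degree of \<open>?u\<close> raises the excess to at least
          three, which pays for both vertices.\<close>
        case True
        define q' where "q' = 1 + N div 2 - deg ?G ?u"
        have "M\<^sup>2 div 4 + q' = card (edges ?H)" using sqN ceH q q1 True by (simp add: q'_def)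
        moreover have "card {v, ?u} = 2" using u by simp
        moreover have "3 \<le> q'" unfolding q'_def using True by linarith
        ultimately have "n + 1 \<le> num_cycles l G + l"
          using M u v hu unfolding GG by (intro gdel_enough[of "{v, ?u}" M q']) auto
        then show ?thesis by blast
      next
        case False
        have "hits G l {v}"
        proof (cases "adj G ?u v")
          case False
          have "{x \<in> range b. adj G v x} = nbrs G v"
            using RH u adj_verts[OF G] adj_irrefl[OF G] False adj_sym[of G v ?u] by (auto simp: nbrs_def)
          then have "card {x \<in> range b. adj G v x} = deg G v" by (simp add: deg_def)
          then show ?thesis
            using hits_of_many_nbrs[OF rb _ l(1) M(4)] RH dv M by auto
        next
          case True
          have "{x \<in> range b. adj G v x} = nbrs G v - {?u}"
            using RH u adj_verts[OF G] adj_irrefl[OF G] by (auto simp: nbrs_def)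
          moreover have "?u \<in> nbrs G v" using True by (simp add: nbrs_def adj_sym)
          ultimately have cA: "card {x \<in> range b. adj G v x} = deg G v - 1"
            using finite_nbrs[OF G, of v] by (simp add: deg_def)
          have cB: "card {x \<in> range b. adj G ?u x} = deg ?G ?u" unfolding BB deg_def ..
          show ?thesis
          proof (rule hits_pair_odd[OF G rb _ _ True M(3) l(1) M(4)])
            show "v \<notin> range b" "?u \<notin> range b" using RH by auto
            show "M div 2 \<le> card {x \<in> range b. adj G v x}" using cA dv M by auto
            show "M div 2 \<le> card {x \<in> range b. adj G ?u x}" using cB False M by (auto elim!: oddE)
            \<comment> \<open>Either \<open>?u\<close> has more than \<open>M div 2\<close>
              neighbours on the ring, or its degree is exactly that and two surplus edges
              remain.\<close>
            show "M div 2 < card {x \<in> range b. adj G ?u x} \<or> M\<^sup>2 div 4 + 2 \<le> card {e \<in> edges G. e \<subseteq> range b}"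
              using cB False sqN ceH q q1 M unfolding EH[symmetric] by (auto elim!: oddE)
          qed
        qed
        then show ?thesis by blast
      qed
    qed
    ultimately show ?thesis by blast
  qed
qed

end

section \<open>Runs of low vertices on the Hamilton cycle\<close>

lemma deg_le_gdel:
  assumes G: "simple_graph G" and "v \<notin> W" "nbrs G v \<inter> W \<subseteq> X" "finite X"
  shows "deg G v \<le> deg (gdel G W) v + card X"
proof -
  have "nbrs G v \<subseteq> nbrs (gdel G W) v \<union> X" using assms(2,3) by (auto simp: nbrs_gdel)
  then have "deg G v \<le> card (nbrs (gdel G W) v \<union> X)"
    unfolding deg_def using G assms(4) by (intro card_mono) auto
  also have "\<dots> \<le> deg (gdel G W) v + card X" unfolding deg_def by (rule card_Un_le)
  finally show ?thesis .
qed

lemma first_after: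
  fixes P :: "int \<Rightarrow> bool"
  assumes "P j" "i \<le> j"
  obtains k where "i \<le> k" "k \<le> j" "P k" "\<And>m. i \<le> m \<Longrightarrow> m < k \<Longrightarrow> \<not> P m"
proof -
  define m where "m = (LEAST m. P (i + int m))"
  have "P (i + int (nat (j - i)))" using assms by simp
  then have m: "P (i + int m)" "m \<le> nat (j - i)" unfolding m_def by (rule LeastI, rule Least_le)
  have "\<not> P x" if "i \<le> x" "x < i + int m" for x
  proof
    assume "P x"
    then have "P (i + int (nat (x - i)))" using that by simp
    then have "m \<le> nat (x - i)" unfolding m_def by (rule Least_le)
    then show False using that by simp
  qed
  then show ?thesis using that[of "i + int m"] m assms by auto
qed

context critical_graph
begin

abbreviation low :: "'a \<Rightarrow> bool" where
  "low v \<equiv> deg G v \<le> n div 2"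

lemma n7: "7 \<le> n" using l by simp

text \<open>If no low vertex can be removed, then some initial part of a run of low vertices can: otherwise
  Ore's argument applies to the two high vertices bounding the run.\<close>

lemma removable_low_run:
  assumes h: "hamc G c" and stuck: "\<And>v. v \<in> verts G \<Longrightarrow> hamiltonian (gdel G {v}) \<Longrightarrow> \<not> low v"
  shows "\<exists>c s. hamc G c \<and> 1 \<le> s \<and> s + 3 \<le> int n \<and> \<not> low (c (- 1)) \<and> (\<forall>i. 0 \<le> i \<and> i < s \<longrightarrow> low (c i))
    \<and> hamiltonian (gdel G (c ` {0..<s}))"
proof -
  \<comment> \<open>The vertex between two vertices of large degree sum is removable and therefore
    high, and one of these two is high as well. Two adjacent high vertices make the bounds of the
    run distinct.\<close>
  have "\<exists>c. hamc G c \<and> \<not> low (c 0) \<and> \<not> low (c 1)"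
  proof -
    obtain i where i: "n + 1 \<le> deg G (c (i - 1)) + deg G (c (i + 1))"
      using deg_sum_ge[OF G h] n e by auto
    have "hamiltonian (gdel G {c i})"
      by (rule hamiltonian_gdel_vertex[OF G h]) (use i n n7 in auto)
    then have hi: "\<not> low (c i)" using stuck h by (auto simp: hamc_def)
    have "\<not> low (c (i - 1)) \<or> \<not> low (c (i + 1))" using i by linarith
    then show ?thesis
    proof
      assume "\<not> low (c (i + 1))"
      then show ?thesis using hamc_shift[OF h, of i] hi by (intro exI[of _ "\<lambda>x. c (x + i)"]) (simp add: add.commute)
    next
      assume "\<not> low (c (i - 1))"
      then show ?thesis using hamc_reflect[OF h, of i] hi by (intro exI[of _ "\<lambda>x. c (i - x)"]) simp
    qed
  qed
  then obtain c1 where c1: "hamc G c1" "\<not> low (c1 0)" "\<not> low (c1 1)" by blast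
  have r1: "ring G n c1" and R1: "range c1 = verts G" using c1 n by (auto simp: hamc_def)
  obtain v where v: "v \<in> verts G" "low v" using ex_low_vertex[OF G] n n7 e by auto
  then have "v \<in> c1 ` {1..<1 + int n}" using ring_range[OF r1, of 1] R1 by simp
  then obtain j where j: "low (c1 j)" "1 \<le> j" "j < 1 + int n" using v by auto
  obtain a where a: "1 \<le> a" "a \<le> j" "low (c1 a)" "\<And>m. 1 \<le> m \<Longrightarrow> m < a \<Longrightarrow> \<not> low (c1 m)"
    using first_after[of "\<lambda>i. low (c1 i)" j 1] j by blast
  have "a \<noteq> 1" using a c1 by auto
  moreover have "a < int n"
  proof -
    have "c1 (int n) = c1 0" using ring_period(1)[OF r1, of 0] by simp
    then have "a \<noteq> int n" using a(3) c1(2) by auto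
    then show ?thesis using a j by simp
  qed
  ultimately have a2: "2 \<le> a" "a < int n" using a(1) by auto
  have cn: "c1 (int n) = c1 0" using ring_period(1)[OF r1, of 0] by simp
  obtain b where b: "a \<le> b" "b \<le> int n" "\<not> low (c1 b)" "\<And>m. a \<le> m \<Longrightarrow> m < b \<Longrightarrow> low (c1 m)"
    using first_after[of "\<lambda>i. \<not> low (c1 i)" "int n" a] a2 cn c1(2) by auto
  define c where "c = (\<lambda>x. c1 (x + a))"
  define s where "s = b - a"
  have c: "hamc G c" unfolding c_def by (rule hamc_shift[OF c1(1)])
  have r: "ring G n c" and R: "range c = verts G" using c n by (auto simp: hamc_def)
  have s: "1 \<le> s" "s \<le> int n - 2" using b a a2 unfolding s_def by (cases "b = a"; auto)+
  have hx: "\<not> low (c (- 1))" using a(4)[of "a - 1"] a2 by (simp add: c_def)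
  have hy: "\<not> low (c s)" using b(3) by (simp add: c_def s_def)
  have lw: "low (c i)" if "0 \<le> i" "i < s" for i using b(4)[of "i + a"] that by (simp add: c_def s_def)
  show ?thesis
  proof (cases "\<exists>j. 1 \<le> j \<and> j < s \<and> adj G (c (- 1)) (c j)")
    \<comment> \<open>A chord from the left bound to \<open>c j\<close> closes the Hamilton cycle
      without the run vertices before \<open>c j\<close>.\<close>
    case True
    then obtain j where j: "1 \<le> j" "j < s" "adj G (c (- 1)) (c j)" by blast
    have "hamiltonian (gdel G (c ` {0..<j}))"
      by (rule hamiltonian_gdel_of_chord[OF G c]) (use j s n in auto)
    then show ?thesis using c j s hx lw by (intro exI[of _ c] exI[of _ j]) auto
  next
    case nx: False
    show ?thesis
    proof (cases "\<exists>j. 0 \<le> j \<and> j < s - 1 \<and> adj G (c s) (c j)")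
      \<comment> \<open>The mirror image, with the run read from its other end.\<close>
      case True
      then obtain j where j: "0 \<le> j" "j < s - 1" "adj G (c s) (c j)" by blast
      define b where "b = (\<lambda>x. c (s - 1 - x))"
      have hb: "hamc G b" unfolding b_def by (rule hamc_reflect[OF c])
      have "hamiltonian (gdel G (b ` {0..<s - 1 - j}))"
        by (rule hamiltonian_gdel_of_chord[OF G hb]) (use j s n in \<open>auto simp: b_def\<close>)
      moreover have "\<not> low (b (- 1))" "\<And>i. 0 \<le> i \<Longrightarrow> i < s - 1 - j \<Longrightarrow> low (b i)" using hy lw j by (auto simp: b_def)
      ultimately show ?thesis using hb j s by (intro exI[of _ b] exI[of _ "s - 1 - j"]) auto
    next
      \<comment> \<open>Each bound now has only one neighbour in the run, so its degree stays at
        least \<open>n div 2\<close>; at least one deleted vertex makes up for the rounding in Ore's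
        condition.\<close>
      case ny: False
      let ?W = "c ` {0..<s}" and ?H = "gdel G (c ` {0..<s})"
      have cm: "c (- 1) = c (int n - 1)" using ring_period(1)[OF r, of "-1"] by simp
      have out: "c i \<notin> ?W" if "s \<le> i" "i < int n" for i
      proof
        assume "c i \<in> ?W"
        then obtain j where j: "c i = c j" "0 \<le> j" "j < s" by auto
        then have "i = j" using that s by (intro inj_onD[OF ring_inj[OF r, of "int n" 0]]) auto
        then show False using j that by simp
      qed
      have x: "c (- 1) \<notin> ?W" using out[of "int n - 1"] s cm by simp
      have y: "c s \<notin> ?W" using out[of s] s by simp
      have "nbrs G (c (- 1)) \<inter> ?W \<subseteq> {c 0}"
      proof
        fix z assume "z \<in> nbrs G (c (- 1)) \<inter> ?W"
        then obtain i where "z = c i" "0 \<le> i" "i < s" "adj G (c (- 1)) (c i)" by (auto simp: nbrs_def)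
        then show "z \<in> {c 0}" using nx by (cases "i = 0") auto
      qed
      then have dx: "deg G (c (- 1)) \<le> deg ?H (c (- 1)) + 1"
        using deg_le_gdel[OF G x, of "{c 0}"] by simp
      have "nbrs G (c s) \<inter> ?W \<subseteq> {c (s - 1)}"
      proof
        fix z assume "z \<in> nbrs G (c s) \<inter> ?W"
        then obtain i where "z = c i" "0 \<le> i" "i < s" "adj G (c s) (c i)" by (auto simp: nbrs_def)
        then show "z \<in> {c (s - 1)}" using ny by (cases "i = s - 1") auto
      qed
      then have dy: "deg G (c s) \<le> deg ?H (c s) + 1"
        using deg_le_gdel[OF G y, of "{c (s - 1)}"] by simp
      have cH: "card (verts ?H) = n - nat s"
      proof -
        have "?W \<subseteq> verts G" using R by auto
        then show ?thesis using card_initial_seg[OF c, of s] s n by (simp add: card_Diff_subset)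
      qed
      have "c (- 1) \<in> verts ?H" using x R rangeI[of c "- 1"] by simp
      then have "deg ?H (c (- 1)) < n - nat s" using deg_less[OF simple_gdel[OF G]] cH by metis
      then have s3: "s + 3 \<le> int n" using dx hx n7 by linarith
      have "hamiltonian ?H"
        by (rule hamiltonian_gdel_of_deg[OF G c]) (use s s3 n dx dy hx hy in linarith)+
      then show ?thesis using c s s3 hx lw by (intro exI[of _ c] exI[of _ s]) auto
    qed
  qed
qed

text \<open>For a shortest removable initial part, Ore's condition fails at every earlier stage;
  each failure is used later as a degree bound.\<close>

lemma minimal_removable_low_run:
  assumes h: "hamc G c" and stuck: "\<And>v. v \<in> verts G \<Longrightarrow> hamiltonian (gdel G {v}) \<Longrightarrow> \<not> low v"
  obtains c k where "hamc G c" "2 \<le> k" "k + 3 \<le> n" "\<not> low (c (- 1))" "\<And>i. i < k \<Longrightarrow> low (c (int i))"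
    "hamiltonian (gdel G (c ` {0..<int k}))" "\<And>j. 1 \<le> j \<Longrightarrow> j < k \<Longrightarrow> \<not> hamiltonian (gdel G (c ` {0..<int j}))"
proof -
  obtain c s where c: "hamc G c" "1 \<le> s" "s + 3 \<le> int n" "\<not> low (c (- 1))" "\<forall>i. 0 \<le> i \<and> i < s \<longrightarrow> low (c i)"
    "hamiltonian (gdel G (c ` {0..<s}))"
    using removable_low_run[OF h stuck] by blast
  let ?P = "\<lambda>k. 1 \<le> k \<and> hamiltonian (gdel G (c ` {0..<int k}))"
  define k where "k = (LEAST k. ?P k)"
  have "?P (nat s)" using c by simp
  then have k: "?P k" "k \<le> nat s" unfolding k_def by (rule LeastI, rule Least_le)
  have less: "\<not> hamiltonian (gdel G (c ` {0..<int j}))" if "1 \<le> j" "j < k" for j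
    using not_less_Least[of j ?P] that unfolding k_def by blast
  have "k \<noteq> 1"
  proof
    assume "k = 1"
    moreover have "c ` {0..<int 1} = {c 0}"
    proof -
      have "{0..<int 1} = {0}" by auto
      then show ?thesis by simp
    qed
    ultimately have "hamiltonian (gdel G {c 0})" using k by metis
    moreover have "c 0 \<in> verts G" using c(1) by (auto simp: hamc_def)
    ultimately show False using stuck c by auto
  qed
  then show ?thesis using that[of c k] c k less by auto
qed

text \<open>If \<open>l \<le> n - k\<close>, the run is deleted vertex by vertex and the gain in
  excess is tracked; only for \<open>k = 2\<close>, or \<open>k = 3\<close> with \<open>n\<close>
  odd, can it be one short. If \<open>l > n - k\<close>, the small degree sums in the run give
  \<open>k \<ge> n - l + 1\<close> cycles through \<open>sum_excess_le\<close>.\<close>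

lemma stuck_case:
  assumes h: "hamc G c0" and stuck: "\<And>v. v \<in> verts G \<Longrightarrow> hamiltonian (gdel G {v}) \<Longrightarrow> \<not> low v"
  shows "n + 1 \<le> num_cycles l G + l"
proof -
  obtain c k where c: "hamc G c" and k: "2 \<le> k" "k + 3 \<le> n" and hx: "\<not> low (c (- 1))"
    and lw: "\<And>i. i < k \<Longrightarrow> low (c (int i))" and ham: "hamiltonian (gdel G (c ` {0..<int k}))"
    and nham: "\<And>j. 1 \<le> j \<Longrightarrow> j < k \<Longrightarrow> \<not> hamiltonian (gdel G (c ` {0..<int j}))"
    using minimal_removable_low_run[OF h stuck] by blast
  have r: "ring G n c" and R: "range c = verts G" using c n by (auto simp: hamc_def)
  define W where "W j = c ` {0..<int j}" for j
  \<comment> \<open>The degree of the \<open>j\<close>-th vertex of the run at the moment of its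
    deletion, when the earlier ones are gone.\<close>
  define \<delta> where "\<delta> j = deg (gdel G (W j)) (c (int j))" for j
  define dx where "dx = deg G (c (- 1))"
  have dx: "n div 2 + 1 \<le> dx" using hx by (simp add: dx_def)
  have cV: "c i \<in> verts G" for i using R by auto
  have WV: "W j \<subseteq> verts G" for j using R by (auto simp: W_def)
  have finW: "finite (W j)" for j by (simp add: W_def)
  have out: "c i \<notin> W j" if "int j \<le> i" "i < int n" for i j
  proof
    assume "c i \<in> W j"
    then obtain m where m: "c i = c m" "0 \<le> m" "m < int j" by (auto simp: W_def)
    then have "i = m" using that by (intro inj_onD[OF ring_inj[OF r, of "int n" 0]]) auto
    then show False using m that by simp
  qed
  have cm: "c (- 1) = c (int n - 1)" using ring_period(1)[OF r, of "-1"] by simp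
  have WS: "W (Suc j) = insert (c (int j)) (W j)" for j
  proof -
    have "{0..<int (Suc j)} = insert (int j) {0..<int j}" by auto
    then show ?thesis by (simp add: W_def)
  qed
  have cW: "card (W j) = j" if "j \<le> n" for j
    using card_initial_seg[OF c, of "int j"] that n by (simp add: W_def)
  have skip: "\<not> adj G (c (- 1)) (c (int j))" if "1 \<le> j" "j < k" for j
    using hamiltonian_gdel_of_chord[OF G c, of "int j"] nham[OF that] that k n by auto
  \<comment> \<open>A chord bypassing \<open>c (i + 1)\<close> would make this low vertex removable
    by itself.\<close>
  have skip2: "\<not> adj G (c i) (c (i + 2))" if "0 \<le> i" "i + 1 < int k" for i
  proof
    assume a: "adj G (c i) (c (i + 2))"
    define b where "b = (\<lambda>x. c (x + (i + 1)))"
    have hb: "hamc G b" unfolding b_def by (rule hamc_shift[OF c])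
    have "hamiltonian (gdel G (b ` {0..<1}))"
      by (rule hamiltonian_gdel_of_chord[OF G hb]) (use a n n7 in \<open>auto simp: b_def add.commute\<close>)
    moreover have "b ` {0..<1} = {c (i + 1)}"
    proof -
      have "{0..<1::int} = {0}" by auto
      then show ?thesis by (simp add: b_def)
    qed
    ultimately have "\<not> low (c (i + 1))" using stuck[OF cV] by simp
    moreover have "nat (i + 1) < k" "int (nat (i + 1)) = i + 1" using that by linarith+
    ultimately show False using lw[of "nat (i + 1)"] by simp
  qed
  \<comment> \<open>Ore's condition fails after \<open>j\<close> deletions, and by
    \<open>skip\<close> the left bound has lost at most its neighbour \<open>c 0\<close>.\<close>
  have \<delta>le: "\<delta> j + dx + j \<le> n" if j: "1 \<le> j" "j < k" for j
  proof -
    have x: "c (- 1) \<notin> W j" using out[of j "int n - 1"] j k cm by simp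
    have "nbrs G (c (- 1)) \<inter> W j \<subseteq> {c 0}"
    proof
      fix z assume "z \<in> nbrs G (c (- 1)) \<inter> W j"
      then obtain i where i: "z = c i" "0 \<le> i" "i < int j" "adj G (c (- 1)) (c i)" by (auto simp: nbrs_def W_def)
      have "i = 0"
      proof (rule ccontr)
        assume "i \<noteq> 0"
        then have "1 \<le> nat i" "nat i < k" "int (nat i) = i" using i j by linarith+
        then show False using skip[of "nat i"] i by simp
      qed
      then show "z \<in> {c 0}" using i by simp
    qed
    then have "dx \<le> deg (gdel G (W j)) (c (- 1)) + 1"
      using deg_le_gdel[OF G x, of "{c 0}"] by (simp add: dx_def)
    moreover have "\<not> int n \<le> int j + int (\<delta> j) + int (deg (gdel G (W j)) (c (- 1)))"
      using hamiltonian_gdel_of_deg[OF G c, of "int j"] nham[OF j] j k n unfolding \<delta>_def W_def by auto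
    ultimately show ?thesis by linarith
  qed
  have W0: "W 0 = {}" "W 1 = {c 0}" "W (Suc 0) = {c 0}" using WS[of 0] by (simp_all add: W_def)
  have \<delta>0: "\<delta> 0 = deg G (c 0)" by (simp add: \<delta>_def W0 deg_def nbrs_gdel)
  have \<delta>0le: "\<delta> 0 \<le> n div 2" using lw[of 0] k \<delta>0 by simp
  have sumE: "card (edges (gdel G (W j))) + (\<Sum>i<j. \<delta> i) = card (edges G)" for j
  proof (induction j)
    case 0
    have "edges (gdel G (W 0)) = edges G" by (auto simp: gdel_def W0)
    then show ?case by simp
  next
    case (Suc j)
    have "gdel G (W (Suc j)) = gdel (gdel G (W j)) {c (int j)}" by (simp add: gdel_gdel WS)
    then show ?case
      using Suc card_edges_gdel[OF simple_gdel[OF G], of "W j" "c (int j)"] by (simp add: \<delta>_def)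
  qed
  have sumS: "(n - j)\<^sup>2 div 4 + (\<Sum>i<j. (n - i) div 2) = n\<^sup>2 div 4" if "j \<le> n" for j
    using that
  proof (induction j)
    case (Suc j)
    then have "n - j = Suc (n - Suc j)" by simp
    then have "(n - j)\<^sup>2 div 4 = (n - Suc j)\<^sup>2 div 4 + (n - j) div 2" using square_div_4_Suc[of "n - Suc j"] by simp
    then show ?case using Suc by simp
  qed simp
  let ?H = "gdel G (W k)"
  \<comment> \<open>The gain in excess at the deletion of the \<open>i\<close>-th vertex.\<close>
  define t where "t i = int ((n - i) div 2) - int (\<delta> i)" for i
  define q where "q = card (edges ?H) - (n - k)\<^sup>2 div 4"
  have qt: "int (card (edges ?H)) - int ((n - k)\<^sup>2 div 4) = 1 + (\<Sum>i<k. t i)"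
  proof -
    define A where "A = (\<Sum>i<k. (n - i) div 2)"
    define B where "B = (\<Sum>i<k. \<delta> i)"
    have "(\<Sum>i<k. t i) = int A - int B"
      by (simp add: t_def sum_subtractf A_def B_def)
    moreover have "card (edges ?H) + B = card (edges G)" unfolding B_def by (rule sumE)
    moreover have "(n - k)\<^sup>2 div 4 + A = n\<^sup>2 div 4" unfolding A_def by (rule sumS) (use k in simp)
    ultimately show ?thesis using e by linarith
  qed
  have t0: "0 \<le> t 0" using \<delta>0le by (simp add: t_def)
  have t1: "1 \<le> t i" if "1 \<le> i" "i < k" for i
    using \<delta>le[OF that] dx that k unfolding t_def by linarith
  have t2: "2 \<le> t i" if "2 \<le> i" "i < k" "3 \<le> i \<or> even n" for i
  proof -
    have "\<delta> i + dx + i \<le> n" using \<delta>le that by simp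
    then have "\<delta> i + 2 \<le> (n - i) div 2" using dx that k by (elim disjE) presburger+
    then show ?thesis by (simp add: t_def)
  qed
  have cHv: "card (verts ?H) = n - k" using cW[of k] k finW WV n by (simp add: card_Diff_subset)
  show ?thesis
  proof (cases "l \<le> n - k")
    case True
    have S2: "(\<Sum>i<k. t i) = t 0 + t 1 + (\<Sum>i\<in>{2..<k}. t i)"
    proof -
      have "{..<k} = insert 0 (insert 1 {2..<k})" using k by auto
      then show ?thesis by simp
    qed
    have low_q: "int k \<le> 1 + (\<Sum>i<k. t i)"
    proof -
      have "(\<Sum>i\<in>{2..<k}. 1) \<le> (\<Sum>i\<in>{2..<k}. t i)" by (rule sum_mono) (use t1 in auto)
      then show ?thesis using S2 t0 t1[of 1] k by simp
    qed
    \<comment> \<open>The gains are at least 0, then 1, then mostly 2, so only short runs can stop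
      at excess \<open>k\<close>.\<close>
    have cases: "int k + 1 \<le> 1 + (\<Sum>i<k. t i) \<or> (k = 2 \<or> k = 3 \<and> odd n) \<and> t 0 = 0 \<and> t 1 = 1 \<and> 1 + (\<Sum>i<k. t i) = int k"
    proof -
      consider "k = 2" | "k = 3" | "4 \<le> k" using k by linarith
      then show ?thesis
      proof cases
        case 1
        then show ?thesis using S2 t0 t1[of 1] by auto
      next
        case 2
        then have "{2..<k} = {2}" by auto
        then have "(\<Sum>i<k. t i) = t 0 + t 1 + t 2" using S2 by simp
        then show ?thesis using t0 t1[of 1] t1[of 2] t2[of 2] 2 by auto
      next
        case 3
        have "{2..<k} = insert 2 (insert 3 {4..<k})" using 3 by auto
        then have "(\<Sum>i<k. t i) = t 0 + t 1 + t 2 + t 3 + (\<Sum>i\<in>{4..<k}. t i)" using S2 by simp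
        moreover have "(\<Sum>i\<in>{4..<k}. 1) \<le> (\<Sum>i\<in>{4..<k}. t i)" by (rule sum_mono) (use t1 in auto)
        ultimately show ?thesis using t0 t1[of 1] t1[of 2] t2[of 3] 3 by simp
      qed
    qed
    have q: "(n - k)\<^sup>2 div 4 + q = card (edges ?H)" "int q = 1 + (\<Sum>i<k. t i)"
      using qt low_q unfolding q_def by linarith+
    have W: "W k \<noteq> {}" "W k \<subseteq> verts G" "n - card (W k) = n - k" "hamiltonian ?H"
      using cW[of k] k WV ham by (auto simp: W_def)
    have q1: "1 \<le> q" using q(2) low_q k by linarith
    note enough = gdel_enough[OF W(1,2,4,3) True q(1) q1]
    show ?thesis
    proof (cases "k + 1 \<le> q")
      case True
      then show ?thesis using enough cW[of k] k by simp
    next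
      case False
      \<comment> \<open>Equality determines the degrees of \<open>c 0\<close> and
        \<open>c 1\<close>. The missing \<open>l\<close>-cycle is sought through \<open>c 0\<close>,
        with \<open>c 0\<close> and \<open>c 1\<close> as the pair outside a ring on the remaining
        vertices.\<close>
      then have K: "k = 2 \<or> k = 3 \<and> odd n" "t 0 = 0" "t 1 = 1" "q = k" using cases q(2) by linarith+
      have d0: "deg G (c 0) = n div 2" using K(2) \<delta>0 by (simp add: t_def)
      have d1: "\<delta> 1 + 1 = (n - 1) div 2" using K(3) by (simp add: t_def)
      obtain b where b: "hamc ?H b" using W(4) hamiltonian_iff[OF simple_gdel[OF G]] by blast
      have rH: "ring ?H (n - k) b" and RH: "range b = verts G - W k" using b cHv by (auto simp: hamc_def)
      note rb = ring_gdel[OF rH]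
      have EH: "edges ?H = {e \<in> edges G. e \<subseteq> range b}" using G RH by (auto simp: gdel_def simple_graph_def)
      have W2: "W 2 = {c 0, c 1}" using WS[of 1] W0 by (simp add: numeral_2_eq_2 insert_commute)
      have W3: "W 3 = {c 0, c 1, c 2}" using WS[of 2] W2 by (simp add: numeral_3_eq_3 insert_commute)
      have a01: "adj G (c 0) (c 1)" and a12: "adj G (c 1) (c 2)" using ring_adj[OF r, of 0] ring_adj[OF r, of 1] by simp_all
      have neq: "c 0 \<noteq> c 1" "c 1 \<noteq> c 2" "c 0 \<noteq> c 2" using ring_neq[OF r, of 0 1] ring_neq[OF r, of 1 2] ring_neq[OF r, of 0 2] n7 by simp_all
      \<comment> \<open>For \<open>k = 3\<close> the deleted \<open>c 2\<close> must not cost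
        \<open>c 0\<close> a second neighbour.\<close>
      have n02: "\<not> adj G (c 0) (c 2)" if "k = 3" using skip2[of 0] that by simp
      have vW: "c 0 \<in> W k" "c 1 \<in> W k" using K(1) W2 W3 by auto
      have "nbrs G (c 0) \<inter> W k = {c 1}" using K(1) W2 W3 a01 n02 G by (auto simp: nbrs_def)
      then have "{x \<in> range b. adj G (c 0) x} = nbrs G (c 0) - {c 1}" "c 1 \<in> nbrs G (c 0)"
        using RH adj_verts[OF G] by (auto simp: nbrs_def)
      then have cA: "card {x \<in> range b. adj G (c 0) x} = n div 2 - 1"
        using finite_nbrs[OF G, of "c 0"] d0 by (simp add: deg_def)
      have \<delta>1: "\<delta> 1 = card (nbrs G (c 1) - {c 0})"
        using neq by (simp add: \<delta>_def W0 deg_def nbrs_gdel)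
      have cB: "card {x \<in> range b. adj G (c 1) x} = (if k = 2 then \<delta> 1 else \<delta> 1 - 1)"
      proof (cases "k = 2")
        case True
        then have "{x \<in> range b. adj G (c 1) x} = nbrs G (c 1) - {c 0}"
          using RH W2 adj_verts[OF G] G by (auto simp: nbrs_def)
        then show ?thesis using \<delta>1 True by simp
      next
        case False
        then have k3: "k = 3" using K by simp
        then have "{x \<in> range b. adj G (c 1) x} = nbrs G (c 1) - {c 0} - {c 2}"
          using RH W3 adj_verts[OF G] G by (auto simp: nbrs_def)
        moreover have "c 2 \<in> nbrs G (c 1) - {c 0}" using a12 neq by (auto simp: nbrs_def)
        ultimately show ?thesis using \<delta>1 False finite_nbrs[OF G, of "c 1"] by simp
      qed
      have vr: "c 0 \<notin> range b" "c 1 \<notin> range b" using RH vW by auto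
      have a10: "adj G (c 1) (c 0)" using a01 adj_sym by metis
      have "hits G l {c 0}"
      proof (cases "even (n - k)")
        case ev: True
        then obtain m where m: "n - k = 2 * m" by (elim evenE)
        then have nm: "n = 2 * m + k" using k by linarith
        have n2: "n div 2 = m + 1" using K(1) nm by (elim disjE conjE) (simp_all, presburger?)
        show ?thesis
        proof (rule hits_pair_even[OF G rb vr a10 ev l(1) True])
          show "(n - k) div 2 \<le> card {x \<in> range b. adj G (c 0) x}" using cA m n2 by simp
          show "(n - k) div 2 \<le> card {x \<in> range b. adj G (c 1) x} + 1"
            using cB d1 K(1) m k by (auto split: if_splits)
          show "((n - k) div 2)\<^sup>2 < card {e \<in> edges G. e \<subseteq> range b}"
            using q(1) q1 square_div_4(1)[of m] m unfolding EH[symmetric] by (simp add: power2_eq_square)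
        qed
      next
        case od: False
        then have k2: "k = 2" "odd n" using K(1) k by auto
        show ?thesis
        proof (rule hits_pair_odd[OF G rb vr a10 od l(1) True])
          show "(n - k) div 2 \<le> card {x \<in> range b. adj G (c 0) x}" using cA k2 by presburger
          show "(n - k) div 2 \<le> card {x \<in> range b. adj G (c 1) x}" using cB d1 k2 by presburger
          show "(n - k) div 2 < card {x \<in> range b. adj G (c 1) x} \<or> (n - k)\<^sup>2 div 4 + 2 \<le> card {e \<in> edges G. e \<subseteq> range b}"
            using q(1) K(4) k2 unfolding EH[symmetric] by simp
        qed
      qed
      then have "hits G l (W k)" using vW by (auto simp: hits_def)
      then show ?thesis using enough cW[of k] k K(4) by simp
    qed
  next
    case False
    then have k3: "3 \<le> k" using l by simp
    define f where "f i = int (deg G (c i)) + int (deg G (c (i + 1))) - int n" for i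
    \<comment> \<open>A lower bound for what truncated subtraction adds on the edges inside the run.
      It sums to \<open>2 * int k - 3\<close>, and with the total excess of at least 3 this gives
      \<open>2 * int k\<close>.\<close>
    define g where "g i = (if i = 0 then 1 else if i < int k - 1 then 2 else 0 :: int)" for i :: int
    have d1: "deg G (c 1) + dx \<le> n"
    proof -
      have "c 1 \<notin> W 1" using out[of 1 1] n7 by simp
      then have "deg G (c 1) \<le> \<delta> 1 + 1"
        using deg_le_gdel[OF G, of "c 1" "W 1" "{c 0}"] by (simp add: \<delta>_def W0)
      then show ?thesis using \<delta>le[of 1] k by simp
    qed
    \<comment> \<open>Among the \<open>i\<close> earlier vertices of the run,
      \<open>c (i - 2)\<close> is not a neighbour, by \<open>skip2\<close>.\<close>
    have di: "deg G (c (int i)) + dx + 1 \<le> n" if i: "2 \<le> i" "i < k" for i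
    proof -
      let ?X = "c ` ({0..<int i} - {int i - 2})"
      have o: "c (int i) \<notin> W i" using out[of i "int i"] i k by simp
      have "\<not> adj G (c (int i)) (c (int i - 2))"
        using skip2[of "int i - 2"] i adj_sym[of G "c (int i)"] by simp
      then have "nbrs G (c (int i)) \<inter> W i \<subseteq> ?X" unfolding W_def nbrs_def by auto
      then have "deg G (c (int i)) \<le> \<delta> i + card ?X"
        using deg_le_gdel[OF G o, of ?X] by (simp add: \<delta>_def)
      also have "card ?X \<le> card ({0..<int i} - {int i - 2})" by (rule card_image_le) simp
      also have "card ({0..<int i} - {int i - 2}) = i - 1" using i by (subst card_Diff_singleton) auto
      finally show ?thesis using \<delta>le[of i] i by simp
    qed
    have fg: "f i + g i \<le> 0" if i: "0 \<le> i" "i < int k - 1" for i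
    proof -
      consider "i = 0" | "i = 1" | "2 \<le> i" using i by linarith
      then show ?thesis
      proof cases
        case 1
        then show ?thesis using d1 \<delta>0le \<delta>0 dx by (simp add: f_def g_def)
      next
        case 2
        then show ?thesis using d1 di[of 2] dx k3 i by (simp add: f_def g_def)
      next
        case 3
        have "deg G (c i) + dx + 1 \<le> n" "deg G (c (i + 1)) + dx + 1 \<le> n"
          using di[of "nat i"] di[of "nat (i + 1)"] 3 i by simp_all
        then show ?thesis using dx 3 i by (simp add: f_def g_def)
      qed
    qed
    have "(\<Sum>i\<in>{0..<int n}. f i + g i) \<le> (\<Sum>i\<in>{0..<int n}. int (deg G (c i) + deg G (c (i + 1)) - n))"
    proof (rule sum_mono)
      fix i assume "i \<in> {0..<int n}"
      then show "f i + g i \<le> int (deg G (c i) + deg G (c (i + 1)) - n)"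
        using fg[of i] k3 by (cases "i < int k - 1") (auto simp: f_def g_def)
    qed
    also have "\<dots> = int (\<Sum>i\<in>{0..<int n}. deg G (c i) + deg G (c (i + 1)) - n)" by (simp only: of_nat_sum)
    also have "\<dots> \<le> int (2 * num_cycles l G)"
      using sum_excess_le[OF G c l(1)] l n by (simp only: of_nat_le_iff)
    finally have le: "(\<Sum>i\<in>{0..<int n}. f i + g i) \<le> 2 * int (num_cycles l G)" by simp
    have "3 \<le> (\<Sum>i\<in>{0..<int n}. f i)"
      using deg_sum_excess[OF G c, of 0 1] e n by (simp add: f_def)
    moreover have "(\<Sum>i\<in>{0..<int n}. g i) = 2 * int k - 3"
    proof -
      have "(\<Sum>i\<in>{0..<int n}. g i) = (\<Sum>i\<in>insert 0 {1..<int k - 1}. g i)"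
        by (rule sum.mono_neutral_right) (use k k3 in \<open>auto simp: g_def\<close>)
      also have "\<dots> = 1 + (\<Sum>i\<in>{1..<int k - 1}. g i)" by (simp add: g_def)
      also have "(\<Sum>i\<in>{1..<int k - 1}. g i) = (\<Sum>i\<in>{1..<int k - 1}. 2)"
        by (rule sum.cong) (auto simp: g_def)
      finally show ?thesis using k3 by simp
    qed
    ultimately have "2 * int k \<le> (\<Sum>i\<in>{0..<int n}. f i + g i)" by (simp add: sum.distrib)
    then have "int k \<le> int (num_cycles l G)" using le by linarith
    then show ?thesis using False k by linarith
  qed
qed

lemma enough_cycles:
  assumes "hamiltonian G" shows "n + 1 \<le> num_cycles l G + l"
proof -
  obtain c where c: "hamc G c" using assms hamiltonian_iff[OF G] by blast
  show ?thesis
  proof (cases "\<exists>v\<in>verts G. hamiltonian (gdel G {v}) \<and> low v")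
    case True
    then show ?thesis using low_removable by blast
  next
    case False
    then show ?thesis using stuck_case[OF c] by blast
  qed
qed

end

section \<open>Cycles of length at least five\<close>

text \<open>At a vertex of \<open>zs\<close> both of its edges are among the two edges of
  \<open>xs\<close> there, so a walk along \<open>xs\<close> never leaves \<open>zs\<close>.
  Consequently a cycle other than a given Hamilton cycle has an edge off it, which can be
  deleted.\<close>

lemma cycle_subset_cycle:
  assumes xs: "distinct xs" "3 \<le> length xs" and zs: "distinct zs" "3 \<le> length zs"
    and sub: "cedges zs \<subseteq> cedges xs"
  shows "cycle_of_list zs = cycle_of_list xs"
proof -
  let ?n = "length xs"
  let ?Z = "cycle_of_list zs"
  have "cyc ?Z zs" using zs by (simp add: cyc_iff_cedges)
  then obtain z where z: "ring ?Z (length zs) z" "range z = set zs" by (metis ring_of_cyc)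
  have nx: "Suc i mod ?n < ?n" for i using xs(2) by (intro mod_less_divisor) linarith
  have inj: "j = j'" if "j < ?n" "j' < ?n" "Suc j mod ?n = Suc j' mod ?n" for j j'
    using that by (cases "Suc j = ?n"; cases "Suc j' = ?n") auto
  have fwd: "{xs ! i, xs ! (Suc i mod ?n)} \<in> cedges zs" if i: "i < ?n" "xs ! i \<in> set zs" for i
  proof (rule ccontr)
    assume no: "{xs ! i, xs ! (Suc i mod ?n)} \<notin> cedges zs"
    obtain a where a: "xs ! i = z a" using i z(2) by auto
    have "\<exists>j<?n. Suc j mod ?n = i \<and> w = xs ! j" if w: "{xs ! i, w} \<in> cedges zs" for w
    proof -
      have "{xs ! i, w} \<in> cedges xs" using w sub by blast
      then obtain j where j: "j < ?n" "{xs ! i, w} = {xs ! j, xs ! (Suc j mod ?n)}"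
        unfolding cycle_of_list_def by auto
      then have "(xs ! i = xs ! j \<and> w = xs ! (Suc j mod ?n)) \<or> (xs ! i = xs ! (Suc j mod ?n) \<and> w = xs ! j)"
        by (auto simp: doubleton_eq_iff)
      moreover have "\<not> (xs ! i = xs ! j \<and> w = xs ! (Suc j mod ?n))"
        using no w i j(1) xs(1) by (auto simp: nth_eq_iff_index_eq)
      ultimately show ?thesis using j(1) i(1) nx xs(1) by (auto simp: nth_eq_iff_index_eq)
    qed
    moreover have "{xs ! i, z (a + 1)} \<in> cedges zs" "{xs ! i, z (a - 1)} \<in> cedges zs"
      using ring_adj[OF z(1), of a] ring_adj'[OF z(1), of a] unfolding a adj_def by simp_all
    ultimately have "z (a + 1) = z (a - 1)" using inj by metis
    moreover have "z (a - 1) \<noteq> z (a + 1)" using zs(2) by (intro ring_neq[OF z(1)]) auto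
    ultimately show False by simp
  qed
  have mem: "x \<in> set zs" if "{x, y} \<in> cedges zs" for x y
  proof -
    have "edges ?Z = cedges zs" by simp
    then show ?thesis
      using that cyc_set[OF simple_cycle[OF zs(2,1)] \<open>cyc ?Z zs\<close>] simple_cycle[OF zs(2,1)]
      by (auto simp: simple_graph_def cycle_of_list_def)
  qed
  have "zs \<noteq> []" using zs(2) by auto
  have "hd zs \<in> set xs"
  proof -
    have "{zs ! 0, zs ! (Suc 0 mod length zs)} \<in> cedges zs" using \<open>zs \<noteq> []\<close> by (auto simp: cycle_of_list_def)
    then have "{zs ! 0, zs ! (Suc 0 mod length zs)} \<in> cedges xs" using sub by blast
    moreover have "e \<subseteq> set xs" if "e \<in> cedges xs" for e
      using that nx by (auto simp: cycle_of_list_def)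
    ultimately show ?thesis using \<open>zs \<noteq> []\<close> by (auto simp: hd_conv_nth)
  qed
  then obtain s where s: "s < ?n" "xs ! s \<in> set zs" using \<open>zs \<noteq> []\<close> by (metis hd_in_set in_set_conv_nth)
  have step: "xs ! ((s + t) mod ?n) \<in> set zs" for t
  proof (induction t)
    case (Suc t)
    have "(s + t) mod ?n < ?n" using s by (intro mod_less_divisor) linarith
    from fwd[OF this Suc] have "xs ! (Suc ((s + t) mod ?n) mod ?n) \<in> set zs"
      using mem by (metis insert_commute)
    then show ?case by (simp add: mod_Suc_eq)
  qed (use s in simp)
  have all: "xs ! i \<in> set zs" if "i < ?n" for i
  proof -
    have "(s + (i + ?n - s)) mod ?n = i" using that s by simp
    then show ?thesis using step by metis
  qed
  have "cedges xs \<subseteq> cedges zs"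
  proof
    fix e assume "e \<in> cedges xs"
    then obtain i where "i < ?n" "e = {xs ! i, xs ! (Suc i mod ?n)}" by (auto simp: cycle_of_list_def)
    then show "e \<in> cedges zs" using fwd all by simp
  qed
  then have E: "cedges zs = cedges xs" using sub by blast
  have "set zs = set xs"
  proof
    show "set xs \<subseteq> set zs" using all by (metis in_set_conv_nth subsetI)
    show "set zs \<subseteq> set xs"
    proof
      fix x assume "x \<in> set zs"
      then obtain a where "x = z a" using z(2) by auto
      then have "{x, z (a + 1)} \<in> cedges xs" using ring_adj[OF z(1), of a] E by (simp add: adj_def)
      then show "x \<in> set xs" using nx by (auto simp: cycle_of_list_def doubleton_eq_iff)
    qed
  qed
  then show ?thesis using E by (intro prod_eqI) (simp_all add: cycle_of_list_def)
qed

lemma card_cedges_le: "card (cedges xs) \<le> length xs"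
proof -
  have "cedges xs = (\<lambda>i. {xs ! i, xs ! (Suc i mod length xs)}) ` {..<length xs}"
    by (auto simp: cycle_of_list_def)
  then show ?thesis using card_image_le[of "{..<length xs}" "\<lambda>i. {xs ! i, xs ! (Suc i mod length xs)}"] by simp
qed

text \<open>The additive form of the bound \<open>n - l + q\<close>. The outer induction on the
  order supplies the assumption \<open>IH\<close> of \<open>critical_graph\<close>, the inner one on
  the number of edges reduces to \<open>q = 1\<close>.\<close>

lemma num_long_cycles:
  assumes "simple_graph G" "hamiltonian G" "5 \<le> l" "l \<le> card (verts G)"
    "(card (verts G))\<^sup>2 div 4 + 1 \<le> card (edges G)"
  shows "card (verts G) + card (edges G) \<le> num_cycles l G + l + (card (verts G))\<^sup>2 div 4"
  using assms
proof (induction "card (verts G)" arbitrary: G rule: less_induct)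
  case (less G0)
  define n where "n = card (verts G0)"
  have IH: "card (verts H) + card (edges H) \<le> num_cycles l H + l + (card (verts H))\<^sup>2 div 4"
    if "simple_graph H" "hamiltonian H" "card (verts H) < n" "l \<le> card (verts H)"
      "(card (verts H))\<^sup>2 div 4 + 1 \<le> card (edges H)" for H :: "'a graph"
    using less.hyps[of H] that less.prems(3) by (simp add: n_def)
  have ln: "5 \<le> l" "l \<le> n" using less.prems by (simp_all add: n_def)
  have "n + card (edges G) \<le> num_cycles l G + l + n\<^sup>2 div 4"
    if "simple_graph G" "hamiltonian G" "card (verts G) = n" "n\<^sup>2 div 4 + 1 \<le> card (edges G)" for G :: "'a graph"
    using that
  proof (induction "card (edges G)" arbitrary: G rule: less_induct)
    case (less G)
    note G = less.prems(1)
    obtain xs where xs: "cyc G xs" "set xs = verts G" "length xs = n"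
      using hamilton_cycle[OF G less.prems(2)] less.prems(3) by metis
    show ?case
    proof (cases "card (edges G) = n\<^sup>2 div 4 + 1")
      case e: True
      \<comment> \<open>At \<open>q = 1\<close> one cycle is required for \<open>l = n\<close> and
        two for \<open>l = n - 1\<close>; only shorter cycles need the induction on the
        order.\<close>
      consider "l = n" | "l = n - 1" "l < n" | "l + 2 \<le> n" using ln by linarith
      then show ?thesis
      proof cases
        case 1
        then show ?thesis using num_cycles_pos[OF G xs(1)] xs(3) e by simp
      next
        case 2
        obtain c where c: "hamc G c" using less.prems(2) hamiltonian_iff[OF G] by blast
        have "2 \<le> num_cycles (n - 1) G"
          using two_almost_hamilton_cycles[OF G c] less.prems(3,4) ln by simp
        then show ?thesis using 2 e by simp
      next
        case 3
        interpret critical_graph G l n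
          by unfold_locales (use G less.prems(3) e ln 3 IH in auto)
        show ?thesis using enough_cycles[OF less.prems(2)] e by simp
      qed
    next
      case False
      then have e: "n\<^sup>2 div 4 + 2 \<le> card (edges G)" using less.prems(4) by simp
      have del: "n + card (edges G) \<le> num_cycles l (edel G f) + 1 + l + n\<^sup>2 div 4"
        if f: "f \<in> edges G" "f \<notin> cedges xs" for f
      proof -
        have ce: "card (edges (edel G f)) + 1 = card (edges G)" by (rule card_edges_edel[OF G f(1)])
        have "cyc (edel G f) xs" using xs(1) f(2) by (auto simp: cyc_iff_cedges)
        then have "hamiltonian (edel G f)" by (rule hamiltonian_of_cyc[OF simple_edel[OF G]]) (simp add: xs)
        moreover have "n\<^sup>2 div 4 + 1 \<le> card (edges (edel G f))" using ce e by linarith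
        moreover have "card (edges (edel G f)) < card (edges G)" using ce by linarith
        moreover have "card (verts (edel G f)) = n" unfolding verts_edel by (rule less.prems(3))
        ultimately have "n + card (edges (edel G f)) \<le> num_cycles l (edel G f) + l + n\<^sup>2 div 4"
          using less.hyps simple_edel[OF G] by blast
        then show ?thesis using ce by linarith
      qed
      \<comment> \<open>The edge to be deleted must lie on an \<open>l\<close>-cycle but not on
        \<open>xs\<close>, so an \<open>l\<close>-cycle different from \<open>xs\<close> is
        needed.\<close>
      have "\<exists>zs. cyc G zs \<and> length zs = l \<and> cycle_of_list zs \<noteq> cycle_of_list xs"
      proof (cases "l = n")
        case True
        have "2 \<le> num_cycles l G" using sheehan[OF G less.prems(2)] less.prems(3) e True by simp
        then have "2 \<le> card (cycle_of_list ` {xs. cyc G xs \<and> length xs = l})"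
          using num_cycles_eq[OF G, of l] ln by simp
        moreover have "card {cycle_of_list xs} = 1" by simp
        ultimately have "\<not> cycle_of_list ` {xs. cyc G xs \<and> length xs = l} \<subseteq> {cycle_of_list xs}"
          using card_mono[of "{cycle_of_list xs}" "cycle_of_list ` {xs. cyc G xs \<and> length xs = l}"] by auto
        then show ?thesis by blast
      next
        case False
        \<comment> \<open>Since \<open>n \<ge> 6\<close> there are more than \<open>n\<close> edges,
          hence one off the Hamilton cycle; after its deletion an \<open>l\<close>-cycle is left by
          induction.\<close>
        have "n * 6 \<le> n * n" using ln False by (intro mult_le_mono2) simp
        then have "n \<le> n\<^sup>2 div 4" unfolding power2_eq_square by linarith
        moreover have "finite (cedges xs)"
          using finite_edges[OF simple_cycle, of xs] xs(1) by (simp add: cyc_def)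
        ultimately have "\<not> edges G \<subseteq> cedges xs"
          using card_cedges_le[of xs] xs(3) e card_mono[of "cedges xs" "edges G"] by linarith
        then obtain f where f: "f \<in> edges G" "f \<notin> cedges xs" by blast
        have "1 \<le> num_cycles l (edel G f)" using del[OF f] e ln by linarith
        then obtain zs where zs: "cyc (edel G f) zs" "length zs = l"
          using num_cycles_obtain[OF simple_edel[OF G], of l] ln by auto
        have "cyc G zs" using zs(1) by (rule cyc_mono[rotated]) auto
        moreover have "card (set zs) \<noteq> card (set xs)"
          using zs False distinct_card[of zs] xs(2) less.prems(3) by (simp add: cyc_def)
        then have "cycle_of_list zs \<noteq> cycle_of_list xs" by (auto simp: cycle_of_list_def)
        ultimately show ?thesis using zs(2) by blast
      qed
      then obtain zs where zs: "cyc G zs" "length zs = l" "cycle_of_list zs \<noteq> cycle_of_list xs" by blast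
      then have "\<not> cedges zs \<subseteq> cedges xs"
        using cycle_subset_cycle[of xs zs] xs(1) by (auto simp: cyc_def)
      then obtain f where f: "f \<in> cedges zs" "f \<notin> cedges xs" by blast
      then have "f \<in> edges G" using zs(1) by (auto simp: cyc_iff_cedges)
      from del[OF this f(2)] num_cycles_edel[OF G zs(1,2) f(1)] show ?thesis by linarith
    qed
  qed
  from this[OF less.prems(1,2)] less.prems(5) show ?case by (simp add: n_def)
qed

text \<open>The assumption on the number of edges says \<open>q \<ge> 2\<close>, so each of the
  three bounds \<open>n - l + q\<close> yields \<open>n - l + 2\<close>.\<close>

theorem theorem3p1:
  fixes G :: "'a graph" and n l :: nat
  assumes "simple_graph G"
    and "hamiltonian G"
    and "card (verts G) = n"
    and "card (edges G) > n\<^sup>2 div 4 + 1"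
    and "3 \<le> l" and "l \<le> n"
    and "l \<in> {3, 4, 5} \<or> l \<ge> 11
       \<or> l = 6 \<and> (n \<le> 10 \<or> n \<ge> 39)
       \<or> l = 7 \<and> (n \<le> 12 \<or> n \<ge> 360)
       \<or> l = 8 \<and> (n \<le> 14 \<or> n \<ge> 97)
       \<or> l = 9 \<and> (n \<le> 16 \<or> n \<ge> 440)
       \<or> l = 10 \<and> (n \<le> 18 \<or> n \<ge> 124)"
  shows "num_cycles l G \<ge> n - l + 2"
proof -
  consider "l = 3" | "l = 4" | "5 \<le> l" using assms(5) by linarith
  then show ?thesis
  proof cases
    case 1
    define q where "q = card (edges G) - n\<^sup>2 div 4"
    have "n + q \<le> card (tri G) + 3"
      using num_triangles(2)[of G q] assms(1,3,4) by (simp add: q_def)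
    then show ?thesis unfolding 1 using card_tri_le[OF assms(1)] assms(4-6) q_def by linarith
  next
    case 2
    then show ?thesis using num_four_cycles[OF assms(1)] assms(3,4,6) by simp
  next
    case 3
    then show ?thesis using num_long_cycles[OF assms(1,2) 3] assms(3,4,6) by simp
  qed
qed

end
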